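(* Let $q,r\ge2$ be integers, $0<\alpha<1$, and let $P_\alpha$ be the transition matrix on the Diestel–Leader graph $\mathrm{DL}(q,r)$, with $K_1$ and $K_2$ the Martin kernels of its projections $P_1$ on $\mathbb{T}_q$ and $P_2$ on $\mathbb{T}_r$, as defined in the context. (a) Each of the functions $$x_1x_2\mapsto K_1(x_1,\xi_1),\quad \xi_1\in\partial^*\mathbb{T}_q,\qquad\text{and}\qquad x_1x_2\mapsto K_2(x_2,\xi_2),\quad \xi_2\in\partial^*\mathbb{T}_r,$$ is a minimal $P_\alpha$-harmonic function on $\mathrm{DL}(q,r)$. (b) If $\alpha\ne 1/2$, then these are all the minimal $P_\alpha$-harmonic functions on $\mathrm{DL}(q,r)$. (c) If $\alpha=1/2$, then these together with the constant function $\mathbf{1}$ are all the minimal $P_\alpha$-harmonic functions on $\mathrm{DL}(q,r)$ (in particular $\mathbf 1$ is minimal).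
   Context: Trees. For an integer $q\ge 2$, $\mathbb{T}_q$ is the homogeneous tree in which every vertex has degree $q+1$, with graph distance $d$. An end is an equivalence class of geodesic rays (one-sided infinite geodesic paths), two rays being equivalent if their symmetric difference is finite; $\partial\mathbb{T}_q$ is the set of ends. For vertices $x,y$, $\overline{x\,y}$ is the geodesic path from $x$ to $y$; for a vertex $x$ and an end $\xi$, $\overline{x\,\xi}$ is the unique ray starting at $x$ and representing $\xi$. Fix a root vertex $o$ and a reference end $\omega$, and put $\partial^*\mathbb{T}_q=\partial\mathbb{T}_q\setminus\{\omega\}$. For a vertex $x$ and an end $\xi$, the confluent $c=x\wedge\xi$ with respect to $o$ is the vertex defined by $\overline{o\,x}\cap\overline{o\,\xi}=\overline{o\,c}$. For vertices $x,y$, the confluent $b=x\curlywedge y$ with respect to $\omega$ is the vertex defined by $\overline{x\,\omega}\cap\overline{y\,\omega}=\overline{b\,\omega}$. The Busemann function is $\mathfrak{h}(x)=d(x,x\curlywedge o)-d(o,x\curlywedge o)\in\mathbb{Z}$. Every vertex $x$ has exactly one neighbour $x^-$ (its predecessor) with $\mathfrak{h}(x^-)=\mathfrak{h}(x)-1$, and $q$ neighbours $y$ (its successors, satisfying $y^-=x$) with $\mathfrak{h}(y)=\mathfrak{h}(x)+1$. Diestel–Leader graph. Let $q,r\ge2$, and let $\mathbb{T}_q$, $\mathbb{T}_r$ have roots $o_1,o_2$ and reference ends $\omega_1,\omega_2$, respectively; $\mathfrak{h}$, predecessors, confluents and $\partial^*$ are taken in each tree with respect to its own root and reference end. The graph $\mathrm{DL}(q,r)$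 has vertex set $\{x_1x_2=(x_1,x_2)\in\mathbb{T}_q\times\mathbb{T}_r:\mathfrak{h}(x_1)+\mathfrak{h}(x_2)=0\}$, and $x_1x_2\sim y_1y_2$ if and only if $x_1\sim y_1$ and $x_2\sim y_2$. Its reference point is $o=o_1o_2$. Random walks. For $0<\alpha<1$, $P_\alpha$ on $\mathrm{DL}(q,r)$ is given by $p(x_1x_2,y_1y_2)=\alpha/q$ if $y_1^-=x_1$ and $y_2=x_2^-$; $=(1-\alpha)/r$ if $y_1=x_1^-$ and $y_2^-=x_2$; and $=0$ otherwise. The projection $P_1$ on $\mathbb{T}_q$ is given by $p_1(x_1,y_1)=\alpha/q$ if $y_1^-=x_1$; $=1-\alpha$ if $y_1=x_1^-$; $=0$ otherwise. The projection $P_2$ on $\mathbb{T}_r$ is given by $p_2(x_2,y_2)=\alpha$ if $y_2=x_2^-$; $=(1-\alpha)/r$ if $y_2^-=x_2$; $=0$ otherwise. Martin kernels. For $i=1,2$, $F_i(x,y)$ is the probability that the Markov chain with transition matrix $P_i$ started at $x$ ever visits $y$ (time $0$ included). For a vertex $x$ and an end $\xi$ of the $i$-th tree, $K_i(x,\xi)=F_i(x,c)/F_i(o_i,c)$, where $c=x\wedge\xi$. Harmonic and minimal harmonic functions. A function $h:\mathrm{DL}(q,r)\to\mathbb{R}$ is $P_\alpha$-harmonic if $\sum_{y_1y_2}p(x_1x_2,y_1y_2)h(y_1y_2)=h(x_1x_2)$ for all $x_1x_2$. A non-negative $P_\alpha$-harmonic function $h$ is minimal if $h(o)=1$ and, whenever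 $g$ is a non-negative $P_\alpha$-harmonic function with $h\ge g$ pointwise, the quotient $g/h$ is constant. *)

theory Defs
  imports "HOL-Probability.Probability"
begin

section \<open>Homogeneous trees, rays and ends\<close>

text \<open>
  The vertex set of a graph is the whole type \<open>'a\<close>. An end is an equivalence class of rays,
  and a ray is given by its parametrisation \<open>nat \<Rightarrow> 'a\<close> from its starting point.
\<close>

record 'a rooted_tree =
  adj :: "'a \<Rightarrow> 'a \<Rightarrow> bool"
  origin :: 'a
  ref_end :: "(nat \<Rightarrow> 'a) set"

definition homogeneous_tree :: "nat \<Rightarrow> ('a \<Rightarrow> 'a \<Rightarrow> bool) \<Rightarrow> bool" where
  "homogeneous_tree q E \<longleftrightarrow>
     symp E \<and> irreflp E \<and> (\<forall>x y. E\<^sup>*\<^sup>* x y) \<and>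
     (\<nexists>xs. 3 \<le> length xs \<and> distinct xs \<and> successively E xs \<and> E (last xs) (hd xs)) \<and>
     (\<forall>x. card {y. E x y} = q + 1)"

definition tdist :: "'a rooted_tree \<Rightarrow> 'a \<Rightarrow> 'a \<Rightarrow> nat" where
  "tdist T x y = (LEAST n. (adj T ^^ n) x y)"

definition geodesic_on :: "'a rooted_tree \<Rightarrow> nat set \<Rightarrow> (nat \<Rightarrow> 'a) \<Rightarrow> bool" where
  "geodesic_on T I \<gamma> \<longleftrightarrow> (\<forall>m\<in>I. \<forall>n\<in>I. int (tdist T (\<gamma> m) (\<gamma> n)) = \<bar>int m - int n\<bar>)"

definition segment :: "'a rooted_tree \<Rightarrow> 'a \<Rightarrow> 'a \<Rightarrow> 'a set" where
  "segment T x y =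
     (THE S. \<exists>\<gamma> n. geodesic_on T {..n} \<gamma> \<and> \<gamma> 0 = x \<and> \<gamma> n = y \<and> S = \<gamma> ` {..n})"

definition ray :: "'a rooted_tree \<Rightarrow> (nat \<Rightarrow> 'a) \<Rightarrow> bool" where
  "ray T R \<longleftrightarrow> geodesic_on T UNIV R"

definition ray_equiv :: "'a rooted_tree \<Rightarrow> ((nat \<Rightarrow> 'a) \<times> (nat \<Rightarrow> 'a)) set" where
  "ray_equiv T = {(R, S). ray T R \<and> ray T S \<and>
     finite ((range R - range S) \<union> (range S - range R))}"

definition ends :: "'a rooted_tree \<Rightarrow> (nat \<Rightarrow> 'a) set set" where
  "ends T = {R. ray T R} // ray_equiv T"

definition ends_star :: "'a rooted_tree \<Rightarrow> (nat \<Rightarrow> 'a) set set" where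
  "ends_star T = ends T - {ref_end T}"

definition ray_to :: "'a rooted_tree \<Rightarrow> 'a \<Rightarrow> (nat \<Rightarrow> 'a) set \<Rightarrow> 'a set" where
  "ray_to T x \<xi> = range (THE R. R \<in> \<xi> \<and> R 0 = x)"

definition confluent :: "'a rooted_tree \<Rightarrow> 'a \<Rightarrow> (nat \<Rightarrow> 'a) set \<Rightarrow> 'a" where
  "confluent T x \<xi> =
     (THE c. segment T (origin T) x \<inter> ray_to T (origin T) \<xi> = segment T (origin T) c)"

definition confluent_ref :: "'a rooted_tree \<Rightarrow> 'a \<Rightarrow> 'a \<Rightarrow> 'a" where
  "confluent_ref T x y =
     (THE b. ray_to T x (ref_end T) \<inter> ray_to T y (ref_end T) = ray_to T b (ref_end T))"

definition busemann :: "'a rooted_tree \<Rightarrow> 'a \<Rightarrow> int" where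
  "busemann T x =
     int (tdist T x (confluent_ref T x (origin T))) -
     int (tdist T (origin T) (confluent_ref T x (origin T)))"

definition predecessor :: "'a rooted_tree \<Rightarrow> 'a \<Rightarrow> 'a" where
  "predecessor T x = (THE y. adj T x y \<and> busemann T y = busemann T x - 1)"


section \<open>Diestel--Leader graphs and the random walks\<close>

definition DL_verts :: "'a rooted_tree \<Rightarrow> 'b rooted_tree \<Rightarrow> ('a \<times> 'b) set" where
  "DL_verts T1 T2 = {(x1, x2). busemann T1 x1 + busemann T2 x2 = 0}"

text \<open>
  The walk below moves exactly along the edges of this graph; its transition probabilities are
  expressed through predecessors only. It is meant for states in \<open>DL_verts\<close>.
\<close>

definition DL_adj :: "'a rooted_tree \<Rightarrow> 'b rooted_tree \<Rightarrow> 'a \<times> 'b \<Rightarrow> 'a \<times> 'b \<Rightarrow> bool" where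
  "DL_adj T1 T2 = (\<lambda>(x1, x2) (y1, y2).
     (x1, x2) \<in> DL_verts T1 T2 \<and> (y1, y2) \<in> DL_verts T1 T2 \<and> adj T1 x1 y1 \<and> adj T2 x2 y2)"

definition DL_walk ::
  "nat \<Rightarrow> nat \<Rightarrow> real \<Rightarrow> 'a rooted_tree \<Rightarrow> 'b rooted_tree \<Rightarrow> 'a \<times> 'b \<Rightarrow> 'a \<times> 'b \<Rightarrow> real" where
  "DL_walk q r \<alpha> T1 T2 = (\<lambda>(x1, x2) (y1, y2).
     if predecessor T1 y1 = x1 \<and> y2 = predecessor T2 x2 then \<alpha> / real q
     else if y1 = predecessor T1 x1 \<and> predecessor T2 y2 = x2 then (1 - \<alpha>) / real r
     else 0)"

definition proj_walk1 :: "nat \<Rightarrow> real \<Rightarrow> 'a rooted_tree \<Rightarrow> 'a \<Rightarrow> 'a \<Rightarrow> real" where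
  "proj_walk1 q \<alpha> T x y =
     (if predecessor T y = x then \<alpha> / real q
      else if y = predecessor T x then 1 - \<alpha>
      else 0)"

definition proj_walk2 :: "nat \<Rightarrow> real \<Rightarrow> 'a rooted_tree \<Rightarrow> 'a \<Rightarrow> 'a \<Rightarrow> real" where
  "proj_walk2 r \<alpha> T x y =
     (if y = predecessor T x then \<alpha>
      else if predecessor T y = x then (1 - \<alpha>) / real r
      else 0)"


section \<open>Hitting probabilities and Martin kernels\<close>

text \<open>
  Trajectory law of the Markov chain with transition matrix \<open>p\<close> started at \<open>x\<close>, by the
  Ionescu-Tulcea construction: the initial distribution is the point mass at \<open>x\<close>, and the
  conditional law of the state at time \<open>Suc n\<close> given the past is \<open>p (\<omega> n)\<close>.
\<close>

definition chain_kernel :: "('a \<Rightarrow> 'a \<Rightarrow> real) \<Rightarrow> 'a \<Rightarrow> nat \<Rightarrow> (nat \<Rightarrow> 'a) \<Rightarrow> 'a measure" where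
  "chain_kernel p x n \<omega> =
     (case n of
        0 \<Rightarrow> return (count_space UNIV) x
      | Suc m \<Rightarrow> point_measure UNIV (\<lambda>y. ennreal (p (\<omega> m) y)))"

definition chain_law :: "('a \<Rightarrow> 'a \<Rightarrow> real) \<Rightarrow> 'a \<Rightarrow> (nat \<Rightarrow> 'a) measure" where
  "chain_law p x =
     projective_family.lim UNIV
       (Ionescu_Tulcea.CI (chain_kernel p x) (\<lambda>_. count_space UNIV))
       (\<lambda>_. count_space UNIV)"

definition hit_prob :: "('a \<Rightarrow> 'a \<Rightarrow> real) \<Rightarrow> 'a \<Rightarrow> 'a \<Rightarrow> real" where
  "hit_prob p x y = measure (chain_law p x) {\<omega>. \<exists>n. \<omega> n = y}"

definition martin_kernel ::
  "'a rooted_tree \<Rightarrow> ('a \<Rightarrow> 'a \<Rightarrow> real) \<Rightarrow> 'a \<Rightarrow> (nat \<Rightarrow> 'a) set \<Rightarrow> real" where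
  "martin_kernel T p x \<xi> =
     hit_prob p x (confluent T x \<xi>) / hit_prob p (origin T) (confluent T x \<xi>)"


section \<open>Harmonic functions\<close>

definition harmonic_on :: "'v set \<Rightarrow> ('v \<Rightarrow> 'v \<Rightarrow> real) \<Rightarrow> ('v \<Rightarrow> real) \<Rightarrow> bool" where
  "harmonic_on V p h \<longleftrightarrow> (\<forall>x\<in>V. ((\<lambda>y. p x y * h y) has_sum h x) V)"

definition minimal_harmonic_on :: "'v set \<Rightarrow> ('v \<Rightarrow> 'v \<Rightarrow> real) \<Rightarrow> 'v \<Rightarrow> ('v \<Rightarrow> real) \<Rightarrow> bool" where
  "minimal_harmonic_on V p o' h \<longleftrightarrow>
     harmonic_on V p h \<and> (\<forall>x\<in>V. 0 \<le> h x) \<and> h o' = 1 \<and>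
     (\<forall>g. harmonic_on V p g \<and> (\<forall>x\<in>V. 0 \<le> g x) \<and> (\<forall>x\<in>V. g x \<le> h x) \<longrightarrow>
        (\<exists>c. \<forall>x\<in>V. g x / h x = c))"

definition DL_minimal ::
  "nat \<Rightarrow> nat \<Rightarrow> real \<Rightarrow> 'a rooted_tree \<Rightarrow> 'b rooted_tree \<Rightarrow> ('a \<times> 'b \<Rightarrow> real) \<Rightarrow> bool" where
  "DL_minimal q r \<alpha> T1 T2 h \<longleftrightarrow>
     minimal_harmonic_on (DL_verts T1 T2) (DL_walk q r \<alpha> T1 T2) (origin T1, origin T2) h"

end

theory Submission
  imports Defs "HOL-Complex_Analysis.Great_Picard"
begin

text \<open>
  \<^bold>\<open>Decomposition.\<close> On a finite tetrahedron of the graph, spanned by all vertices below a fixed vertex of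
  each tree, the walk is a gambler's ruin in the first height. It exits at the top in a point whose law
  depends only on the first coordinate of the start, and at the bottom in a point whose law depends
  only on the second one. So a non-negative harmonic function on a tetrahedron is a sum of functions
  of one coordinate, and compactness carries this over to the whole graph.
  Hence minimal functions live on one of the two trees.

  \<^bold>\<open>Harmonic functions on a tree.\<close> After a Doob transform, a positive harmonic function on a tree has
  non-negative increments towards the successors, and these form, up to a factor depending on the
  height, a finitely additive measure on the ends. Restricting this measure to the ends below a vertex
  gives a smaller harmonic function, so for a minimal function it is a point mass, which gives a Martin
  kernel, or zero, which leaves the transforming function \<open>\<psi>\<close>. Read off the other tree, \<open>\<psi>\<close>
  corresponds to a measure charging all cones unless \<open>\<alpha> = 1 / 2\<close>.

  \<^bold>\<open>Minimality of the kernels.\<close> The kernel of an end of the first tree has infimum zero on every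
  horocycle, so in the decomposition of a smaller harmonic function the second summand vanishes.
\<close>

section \<open>Hitting probabilities\<close>

text \<open>A power \<open>c powi hgt x\<close> with nonzero base is harmonic for the tree walk
  exactly for c = 1 and c = (1 - a) / a. Dividing by the power with the smaller base makes a step to
  the predecessor at least as likely as a step to some successor; the ratio is \<rho> \<ge> 1. The
  increments at the children of x then average \<rho> times the increment at x, so a negative
  increment persists along some descending path and drives the function below zero. This is the
  source of the sign statement. As each vertex has q children, the height factor of the measure is
  \<open>\<sigma> powi hgt x\<close> with \<sigma> = q \<rho>.

  The transforming function is what the increments cannot see: it carries the zero measure. The two
  coordinates have opposite heights, so seen from the other tree it is the power with the larger
  base. At \<alpha> = 1 / 2 both bases are 1 and the two readings coincide; this is where the
  constant function comes from.\<close>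

locale finite_range_chain =
  fixes p :: "'a \<Rightarrow> 'a \<Rightarrow> real"
  assumes nonneg: "0 \<le> p x y"
    and finite_range: "finite {y. p x y \<noteq> 0}"
    and stochastic: "(\<Sum>y | p x y \<noteq> 0. p x y) = 1"
begin

abbreviation step_measure :: "'a \<Rightarrow> 'a measure" where
  "step_measure x \<equiv> point_measure UNIV (\<lambda>y. ennreal (p x y))"

lemma nn_integral_step:
  assumes "\<And>y. 0 \<le> f y"
  shows "(\<integral>\<^sup>+y. ennreal (f y) \<partial>step_measure x) = ennreal (\<Sum>y | p x y \<noteq> 0. p x y * f y)"
proof -
  have fin: "finite {a \<in> UNIV. 0 < ennreal (p x a) \<and> 0 < ennreal (f a)}"
    by (rule finite_subset[OF _ finite_range[of x]]) auto
  have "(\<integral>\<^sup>+y. ennreal (f y) \<partial>step_measure x) =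
      (\<Sum>a\<in>{a \<in> UNIV. 0 < ennreal (p x a) \<and> 0 < ennreal (f a)}. ennreal (p x a) * ennreal (f a))"
    by (rule nn_integral_point_measure[OF fin])
  also have "\<dots> = (\<Sum>a | p x a \<noteq> 0. ennreal (p x a) * ennreal (f a))"
    using assms nonneg
    by (intro sum.mono_neutral_left finite_range) (auto simp: order.order_iff_strict not_less ennreal_neg)
  also have "\<dots> = ennreal (\<Sum>y | p x y \<noteq> 0. p x y * f y)"
    using assms nonneg by (simp add: ennreal_mult[symmetric] sum_ennreal)
  finally show ?thesis .
qed

lemma prob_space_step: "prob_space (step_measure x)"
proof
  show "emeasure (step_measure x) (space (step_measure x)) = 1"
    using nn_integral_step[of "\<lambda>_. 1" x] stochastic[of x]
    by (simp add: space_point_measure)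
qed

lemma prob_space_chain_kernel: "prob_space (chain_kernel p x n \<omega>)"
  by (auto simp: chain_kernel_def prob_space_step prob_space_return split: nat.split)

lemma Ionescu_Tulcea_chain_kernel:
  "Ionescu_Tulcea (chain_kernel p x) (\<lambda>_. count_space UNIV)"
proof (rule Ionescu_Tulcea.intro[OF _ prob_space_chain_kernel])
  fix i
  have step: "step_measure \<in> measurable (count_space UNIV) (subprob_algebra (count_space UNIV))"
    using prob_space_step
    by (auto simp: space_subprob_algebra sets_point_measure intro: prob_space_imp_subprob_space)
  show "chain_kernel p x i \<in>
      measurable (PiM {0..<i} (\<lambda>_. count_space UNIV)) (subprob_algebra (count_space UNIV))"
  proof (cases i)
    case 0
    have "chain_kernel p x 0 = (\<lambda>_. return (count_space UNIV) x)"
      by (simp add: chain_kernel_def fun_eq_iff)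
    moreover have "return (count_space UNIV) x \<in> space (subprob_algebra (count_space UNIV))"
      by (simp add: space_subprob_algebra prob_space_imp_subprob_space prob_space_return)
    ultimately show ?thesis using 0 by (simp add: measurable_const)
  next
    case (Suc m)
    have "(\<lambda>\<omega>. \<omega> m) \<in> measurable (PiM {0..<Suc m} (\<lambda>_. count_space (UNIV::'a set))) (count_space UNIV)"
      by (rule measurable_component_singleton) simp
    from measurable_compose[OF this step] show ?thesis
      by (simp add: Suc chain_kernel_def[abs_def])
  qed
qed

sublocale IT: Ionescu_Tulcea "chain_kernel p x" "\<lambda>_. count_space UNIV" for x
  by (rule Ionescu_Tulcea_chain_kernel)

abbreviation law_upto :: "'a \<Rightarrow> nat \<Rightarrow> (nat \<Rightarrow> 'a) measure" where
  "law_upto x n \<equiv> IT.C x 0 n (\<lambda>_. undefined)"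

section \<open>Visits within finitely many steps\<close>

primrec hit_within :: "'a \<Rightarrow> nat \<Rightarrow> 'a \<Rightarrow> real" where
  "hit_within y 0 x = (if x = y then 1 else 0)"
| "hit_within y (Suc n) x =
     (if x = y then 1 else \<Sum>z | p x z \<noteq> 0. p x z * hit_within y n z)"

lemma hit_within_le_1: "hit_within y n x \<le> 1"
proof (induction n arbitrary: x)
  case (Suc n)
  have "(\<Sum>z | p x z \<noteq> 0. p x z * hit_within y n z) \<le> (\<Sum>z | p x z \<noteq> 0. p x z * 1)"
    by (intro sum_mono mult_left_mono Suc nonneg)
  then show ?case by (simp add: stochastic)
qed simp

lemma measurable_law_upto: "measurable (law_upto x n) N = measurable (PiM {0..<n} (\<lambda>_. count_space UNIV)) N"
  using IT.sets_C[of "\<lambda>_. undefined" 0 x n] by (intro measurable_cong_sets) (simp_all add: space_PiM)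

lemma nn_integral_law_upto_Suc:
  assumes f: "f \<in> borel_measurable (PiM {0..<Suc n} (\<lambda>_. count_space UNIV))"
  shows "(\<integral>\<^sup>+\<omega>. f \<omega> \<partial>law_upto x (Suc n)) =
    (\<integral>\<^sup>+\<omega>. (\<integral>\<^sup>+z. f (fun_upd \<omega> n z) \<partial>chain_kernel p x n \<omega>) \<partial>law_upto x n)"
proof -
  have "(\<integral>\<^sup>+\<omega>. f \<omega> \<partial>law_upto x (Suc n)) =
      (\<integral>\<^sup>+\<omega>. (\<integral>\<^sup>+\<omega>'. f \<omega>' \<partial>IT.eP x n \<omega>) \<partial>law_upto x n)"
    using IT.measurable_eP[of x n] f
    by (subst IT.C.simps, subst nn_integral_bind[where B="PiM {0..<Suc n} (\<lambda>_. count_space UNIV)"])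
       (auto simp: measurable_law_upto)
  also have "\<dots> = (\<integral>\<^sup>+\<omega>. (\<integral>\<^sup>+z. f (fun_upd \<omega> n z) \<partial>chain_kernel p x n \<omega>) \<partial>law_upto x n)"
    by (intro nn_integral_cong IT.nn_integral_eP f) (simp add: IT.space_C space_PiM)
  finally show ?thesis .
qed

text \<open>Given the states up to time m, the probability of avoiding y up to the fixed horizon m +
  k + 1 is a martingale in m. This is its one-step invariance.\<close>

lemma nn_integral_avoid_step:
  "(\<integral>\<^sup>+\<omega>. indicator {\<omega>. \<forall>i<m. \<omega> i \<noteq> y} \<omega> * ennreal (1 - hit_within y (Suc k) (\<omega> m)) \<partial>law_upto x (Suc m)) =
   (\<integral>\<^sup>+\<omega>. indicator {\<omega>. \<forall>i<Suc m. \<omega> i \<noteq> y} \<omega> * ennreal (1 - hit_within y k (\<omega> (Suc m))) \<partial>law_upto x (Suc (Suc m)))"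
proof -
  let ?M = "\<lambda>n. PiM {0..<n} (\<lambda>_. count_space (UNIV::'a set))"
  have comp: "(\<lambda>\<omega>. g (\<omega> i)) \<in> borel_measurable (?M n)" if "i < n" for i n :: nat and g :: "'a \<Rightarrow> ennreal"
    using that by (intro measurable_compose[OF measurable_component_singleton[of i]]) simp_all
  have ind: "(\<lambda>\<omega>. indicator {\<omega>. \<forall>i<m. \<omega> i \<noteq> y} \<omega> :: ennreal) \<in> borel_measurable (?M n)" if "m \<le> n" for m n :: nat
  proof -
    have eq: "(\<lambda>\<omega>. indicator {\<omega>. \<forall>i<m. \<omega> i \<noteq> y} \<omega> :: ennreal) = (\<lambda>\<omega>. \<Prod>i<m. indicator (- {y}) (\<omega> i))"
      for m :: nat
      by (induction m) (auto simp: fun_eq_iff indicator_def less_Suc_eq)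
    show ?thesis unfolding eq using that by (intro borel_measurable_prod_ennreal comp) auto
  qed
  have *: "indicator {\<omega>. \<forall>i<m. \<omega> i \<noteq> y} \<omega> * ennreal (1 - hit_within y (Suc k) (\<omega> m)) =
      (\<integral>\<^sup>+z. indicator {\<omega>. \<forall>i<Suc m. \<omega> i \<noteq> y} (fun_upd \<omega> (Suc m) z) *
         ennreal (1 - hit_within y k ((fun_upd \<omega> (Suc m) z) (Suc m))) \<partial>chain_kernel p x (Suc m) \<omega>)" for \<omega>
  proof -
    have i: "(indicator {\<omega>. \<forall>i<Suc m. \<omega> i \<noteq> y} (fun_upd \<omega> (Suc m) z) :: ennreal) =
        indicator {\<omega>. \<forall>i<Suc m. \<omega> i \<noteq> y} \<omega>" for z
      by (auto simp: indicator_def)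
    have "(\<integral>\<^sup>+z. indicator {\<omega>. \<forall>i<Suc m. \<omega> i \<noteq> y} (fun_upd \<omega> (Suc m) z) *
         ennreal (1 - hit_within y k ((fun_upd \<omega> (Suc m) z) (Suc m))) \<partial>chain_kernel p x (Suc m) \<omega>) =
       indicator {\<omega>. \<forall>i<Suc m. \<omega> i \<noteq> y} \<omega> * (\<integral>\<^sup>+z. ennreal (1 - hit_within y k z) \<partial>step_measure (\<omega> m))"
      unfolding i by (simp add: chain_kernel_def nn_integral_cmult measurable_point_measure_eq1)
    also have "(\<integral>\<^sup>+z. ennreal (1 - hit_within y k z) \<partial>step_measure (\<omega> m)) =
        ennreal (\<Sum>z | p (\<omega> m) z \<noteq> 0. p (\<omega> m) z * (1 - hit_within y k z))"
      by (rule nn_integral_step) (simp add: hit_within_le_1)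
    also have "(\<Sum>z | p (\<omega> m) z \<noteq> 0. p (\<omega> m) z * (1 - hit_within y k z)) =
        1 - (\<Sum>z | p (\<omega> m) z \<noteq> 0. p (\<omega> m) z * hit_within y k z)"
      by (simp add: right_diff_distrib sum_subtractf stochastic)
    \<comment> \<open>If the state at time m is y, both sides vanish because
      \<open>hit_within\<close> is 1 there; otherwise its recursion applies.\<close>
    finally show ?thesis
      by (auto simp: indicator_def less_Suc_eq)
  qed
  show ?thesis
    unfolding * by (rule nn_integral_law_upto_Suc[symmetric]) (intro borel_measurable_times_ennreal comp ind; simp)
qed

text \<open>The martingale is compared at its two ends: at the horizon n it is the indicator of
  avoidance, at time 0 it is \<open>1 - hit_within y n x\<close>. The inner induction keeps the sum
  of elapsed and remaining time fixed.\<close>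

lemma emeasure_avoid:
  "emeasure (chain_law p x) {\<omega>. \<forall>i\<le>n. \<omega> i \<noteq> y} = ennreal (1 - hit_within y n x)"
proof -
  let ?M = "\<lambda>n. PiM {0..<n} (\<lambda>_. count_space (UNIV::'a set))"
  let ?A = "PiE {0..<Suc n} (\<lambda>_. - {y})"
  have A: "?A \<in> sets (?M (Suc n))"
    by (rule sets_PiM_I_finite) auto
  have emb: "prod_emb UNIV (\<lambda>_. count_space UNIV) {0..<Suc n} ?A = {\<omega>. \<forall>i\<le>n. \<omega> i \<noteq> y}"
    by (auto simp: prod_emb_def space_PiM less_Suc_eq_le)
  have "emeasure (chain_law p x) {\<omega>. \<forall>i\<le>n. \<omega> i \<noteq> y} = emeasure (IT.CI x {0..<Suc n}) ?A"
    unfolding chain_law_def emb[symmetric] by (rule IT.lim[OF _ A]) simp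
  also have "\<dots> = emeasure (law_upto x (Suc n)) ?A"
    by (subst IT.emeasure_CI[OF subset_refl A])
       (simp add: prod_emb_id sets.sets_into_space[OF A, unfolded space_PiM])
  also have "\<dots> = (\<integral>\<^sup>+\<omega>. indicator ?A \<omega> \<partial>law_upto x (Suc n))"
    using A by (subst nn_integral_indicator) (auto simp: IT.sets_C space_PiM simp del: IT.C.simps)
  also have "\<dots> = (\<integral>\<^sup>+\<omega>. indicator {\<omega>. \<forall>i<n. \<omega> i \<noteq> y} \<omega> * ennreal (1 - hit_within y 0 (\<omega> n)) \<partial>law_upto x (Suc n))"
    by (intro nn_integral_cong) (auto simp: indicator_def IT.space_C space_PiM less_Suc_eq PiE_iff extensional_def
      simp del: IT.C.simps)
  also have "\<dots> = ennreal (1 - hit_within y n x)"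
  proof -
    have "(\<integral>\<^sup>+\<omega>. indicator {\<omega>. \<forall>i<m. \<omega> i \<noteq> y} \<omega> * ennreal (1 - hit_within y k (\<omega> m)) \<partial>law_upto x (Suc m)) =
      ennreal (1 - hit_within y (k + m) x)" for k m
    proof (induction m arbitrary: k)
      case 0
      have "(\<integral>\<^sup>+\<omega>. ennreal (1 - hit_within y k (\<omega> 0)) \<partial>law_upto x (Suc 0)) =
         (\<integral>\<^sup>+\<omega>. (\<integral>\<^sup>+z. ennreal (1 - hit_within y k ((fun_upd \<omega> 0 z) 0)) \<partial>chain_kernel p x 0 \<omega>) \<partial>law_upto x 0)"
        by (rule nn_integral_law_upto_Suc, rule measurable_compose[OF measurable_component_singleton]) auto
      also have "\<dots> = ennreal (1 - hit_within y k x)"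
        using IT.prob_space_C[of "\<lambda>_. undefined" 0 x 0, THEN prob_space.emeasure_space_1]
        by (simp add: chain_kernel_def nn_integral_return space_PiM IT.space_C)
      finally show ?case by simp
    next
      case (Suc m)
      have "ennreal (1 - hit_within y (k + Suc m) x) = ennreal (1 - hit_within y (Suc k + m) x)" by simp
      also have "\<dots> = (\<integral>\<^sup>+\<omega>. indicator {\<omega>. \<forall>i<m. \<omega> i \<noteq> y} \<omega> *
          ennreal (1 - hit_within y (Suc k) (\<omega> m)) \<partial>law_upto x (Suc m))"
        by (rule Suc[symmetric])
      finally show ?case by (simp only: nn_integral_avoid_step)
    qed
    from this[of n 0] show ?thesis by simp
  qed
  finally show ?thesis .
qed

theorem hit_within_tendsto_hit_prob: "(\<lambda>n. hit_within y n x) \<longlonglongrightarrow> hit_prob p x y"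
proof -
  have ps: "prob_space (chain_law p x)"
  proof
    have sp: "prod_emb UNIV (\<lambda>_. count_space UNIV) {} {\<lambda>_. undefined} = (UNIV :: (nat \<Rightarrow> 'a) set)"
      by (auto simp: prod_emb_def)
    have "emeasure (chain_law p x) UNIV = emeasure (IT.CI x {}) {\<lambda>_. undefined}"
      unfolding chain_law_def sp[symmetric] by (rule IT.lim) (auto simp: sets_PiM_empty)
    also have "\<dots> = 1"
      using prob_space.emeasure_space_1[OF IT.PF.prob_space_P[of "{}" x]]
      by (simp add: IT.PF.space_P space_PiM)
    finally show "emeasure (chain_law p x) (space (chain_law p x)) = 1"
      by (simp add: chain_law_def space_PiM)
  qed
  interpret prob_space "chain_law p x" by (fact ps)
  have sets: "sets (chain_law p x) = sets (PiM UNIV (\<lambda>_. count_space UNIV))"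
    by (simp add: chain_law_def)
  have space: "space (chain_law p x) = UNIV"
    by (simp add: chain_law_def space_PiM)
  have m: "{\<omega>. P (\<omega> i)} \<in> events" for P and i :: nat
  proof -
    have "{\<omega> \<in> space (PiM UNIV (\<lambda>_. count_space (UNIV::'a set))). \<omega> i \<in> Collect P} \<in> sets (PiM UNIV (\<lambda>_. count_space UNIV))"
      by (rule sets_Collect_single) auto
    then show ?thesis by (simp add: sets space_PiM)
  qed
  have hit: "{\<omega>. \<exists>i\<le>n. \<omega> i = y} \<in> events" for n
  proof -
    have "{\<omega>. \<exists>i\<le>n. \<omega> i = y} = (\<Union>i\<le>n. {\<omega>. \<omega> i = y})" by auto
    then show ?thesis using m by auto
  qed
  have "prob {\<omega>. \<exists>i\<le>n. \<omega> i = y} = hit_within y n x" for n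
  proof -
    have "prob {\<omega>. \<forall>i\<le>n. \<omega> i \<noteq> y} = 1 - hit_within y n x"
      using emeasure_avoid[of x n y] hit_within_le_1[of y n x] by (simp add: measure_def)
    moreover have "{\<omega>. \<forall>i\<le>n. \<omega> i \<noteq> y} = space (chain_law p x) - {\<omega>. \<exists>i\<le>n. \<omega> i = y}"
      by (auto simp: space)
    ultimately show ?thesis using prob_compl[OF hit[of n]] by simp
  qed
  moreover have "(\<lambda>n. prob {\<omega>. \<exists>i\<le>n. \<omega> i = y}) \<longlonglongrightarrow> prob (\<Union>n. {\<omega>. \<exists>i\<le>n. \<omega> i = y})"
    by (rule finite_Lim_measure_incseq) (use hit in \<open>auto simp: incseq_def intro: order_trans\<close>)
  moreover have "(\<Union>n::nat. {\<omega>. \<exists>i\<le>n. \<omega> i = y}) = {\<omega>. \<exists>n. \<omega> n = y}"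
    by blast
  ultimately show ?thesis by (simp add: hit_prob_def)
qed

section \<open>First-step analysis of hitting probabilities\<close>

lemma hit_prob_nonneg: "0 \<le> hit_prob p x y"
  by (simp add: hit_prob_def)

lemma hit_prob_self: "hit_prob p y y = 1"
proof -
  have "hit_within y n y = 1" for n by (cases n) auto
  with hit_within_tendsto_hit_prob[of y y] show ?thesis by (simp add: LIMSEQ_const_iff)
qed

lemma hit_prob_step:
  assumes "x \<noteq> y"
  shows "hit_prob p x y = (\<Sum>z | p x z \<noteq> 0. p x z * hit_prob p z y)"
proof -
  have "(\<lambda>n. hit_within y (Suc n) x) \<longlonglongrightarrow> hit_prob p x y"
    using hit_within_tendsto_hit_prob[of y x] by (rule LIMSEQ_Suc)
  moreover have "(\<lambda>n. hit_within y (Suc n) x) \<longlonglongrightarrow> (\<Sum>z | p x z \<noteq> 0. p x z * hit_prob p z y)"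
    using assms by (auto intro!: tendsto_intros hit_within_tendsto_hit_prob)
  ultimately show ?thesis by (rule LIMSEQ_unique)
qed

text \<open>Each finite-step approximation stays below f by induction on the number of steps. With a
  conjectured closed formula as f, this gives one half of its proof.\<close>

lemma hit_prob_le_superharmonic:
  assumes "\<And>x. 0 \<le> f x" "1 \<le> f y"
    and "\<And>x. x \<noteq> y \<Longrightarrow> (\<Sum>z | p x z \<noteq> 0. p x z * f z) \<le> f x"
  shows "hit_prob p x y \<le> f x"
proof -
  have "hit_within y n x \<le> f x" for n
  proof (induction n arbitrary: x)
    case (Suc n)
    have "(\<Sum>z | p x z \<noteq> 0. p x z * hit_within y n z) \<le> (\<Sum>z | p x z \<noteq> 0. p x z * f z)"
      by (intro sum_mono mult_left_mono Suc nonneg)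
    with assms show ?case by (cases "x = y") (auto intro: order_trans)
  qed (use assms in auto)
  then show ?thesis
    using hit_within_tendsto_hit_prob by (blast intro: LIMSEQ_le_const2)
qed

end

section \<open>Harmonic functions on a tree seen from an end\<close>

text \<open>A tree viewed from one of its ends keeps only the predecessor map and the height:
  \<open>merge\<close> stands for connectedness, and strictly falling heights exclude
  cycles.\<close>

locale pred_tree =
  fixes q :: nat and pr :: "'a \<Rightarrow> 'a" and hgt :: "'a \<Rightarrow> int" and rt :: 'a
  assumes q_ge_2: "2 \<le> q"
    and hgt_pr [simp]: "hgt (pr x) = hgt x - 1"
    and card_children: "card {y. pr y = x} = q"
    and merge: "\<exists>m n. (pr ^^ m) x = (pr ^^ n) y"
    and hgt_rt [simp]: "hgt rt = 0"
begin

section \<open>Ancestors and cones\<close>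

abbreviation children :: "'a \<Rightarrow> 'a set" where
  "children x \<equiv> {y. pr y = x}"

text \<open>x lies on the ray from y to the distinguished end; for fixed x, the vertices y form the
  cone of x.\<close>

definition anc :: "'a \<Rightarrow> 'a \<Rightarrow> bool" where
  "anc x y \<longleftrightarrow> (\<exists>n. (pr ^^ n) y = x)"

lemma finite_children [simp]: "finite (children x)"
  using card_children[of x] q_ge_2 by (intro card_ge_0_finite) auto

lemma children_nonempty: "children x \<noteq> {}"
proof
  assume "children x = {}"
  then have "card (children x) = 0" by simp
  then show False using card_children[of x] q_ge_2 by simp
qed

lemma hgt_pow [simp]: "hgt ((pr ^^ n) x) = hgt x - int n"
  by (induction n) auto

lemma anc_refl [simp]: "anc x x"
  unfolding anc_def by (rule exI[of _ 0]) simp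

lemma anc_pow [simp]: "anc ((pr ^^ n) x) x"
  unfolding anc_def by blast

lemma anc_pr [simp]: "anc (pr x) x"
  using anc_pow[of 1 x] by simp

lemma anc_trans: "anc x y \<Longrightarrow> anc y z \<Longrightarrow> anc x z"
  unfolding anc_def by (metis comp_apply funpow_add)

lemma anc_hgt: "anc x y \<Longrightarrow> hgt x \<le> hgt y"
  unfolding anc_def by auto

lemma ancE:
  assumes "anc x y"
  obtains n where "x = (pr ^^ n) y" "hgt y = hgt x + int n"
  using assms unfolding anc_def by force

lemma anc_eqI: "anc x z \<Longrightarrow> anc y z \<Longrightarrow> hgt x = hgt y \<Longrightarrow> x = y"
  unfolding anc_def by auto

lemma anc_linear:
  assumes "anc x z" "anc y z" "hgt x \<le> hgt y"
  shows "anc x y"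
proof -
  obtain m n where m: "x = (pr ^^ m) z" "hgt z = hgt x + int m" and n: "y = (pr ^^ n) z" "hgt z = hgt y + int n"
    using assms(1,2) by (elim ancE)
  have "m = (m - n) + n" using m(2) n(2) assms(3) by linarith
  then have "x = (pr ^^ (m - n)) y" using m(1) n(1) by (metis comp_apply funpow_add)
  then show ?thesis by simp
qed

lemma anc_cases_pr: "anc x y \<Longrightarrow> x = y \<or> anc x (pr y)"
  unfolding anc_def by (metis funpow_0 funpow_swap1 old.nat.exhaust funpow.simps(2) comp_apply)

lemma anc_child: "anc x y \<Longrightarrow> x \<noteq> y \<Longrightarrow> \<exists>z. pr z = x \<and> anc z y"
  unfolding anc_def by (metis funpow_0 old.nat.exhaust funpow.simps(2) comp_apply)

lemma ex_descendant: "\<exists>y. anc x y \<and> hgt y = hgt x + int n"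
proof (induction n)
  case (Suc n)
  then obtain y where y: "anc x y" "hgt y = hgt x + int n" by blast
  obtain z where z: "pr z = y" using children_nonempty[of y] by blast
  then have "anc x z" using y(1) anc_pr anc_trans by blast
  moreover have "hgt z = hgt x + int (Suc n)" using y(2) hgt_pr[of z] z by simp
  ultimately show ?case by blast
qed (auto intro: exI[of _ x])

lemma ex_hgt: "\<exists>x. hgt x = n"
proof (cases "0 \<le> n")
  case True
  then show ?thesis using ex_descendant[of rt "nat n"] by auto
next
  case False
  then have "hgt ((pr ^^ nat (- n)) rt) = n" by simp
  then show ?thesis by blast
qed

text \<open>The cones of the ancestors of the root exhaust the tree. This yields countability and
  the exhaustion of the graph by tetrahedra.\<close>

lemma anc_pow_rt: "eventually (\<lambda>n. anc ((pr ^^ n) rt) x) sequentially"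
proof -
  obtain m n where mn: "(pr ^^ m) x = (pr ^^ n) rt" using merge by blast
  have "anc ((pr ^^ k) rt) x" if "n \<le> k" for k
  proof -
    have "k = (k - n) + n" using that by simp
    then have "(pr ^^ k) rt = (pr ^^ (k - n)) ((pr ^^ m) x)" using mn by (metis comp_apply funpow_add)
    then show ?thesis by (metis anc_pow anc_trans)
  qed
  then show ?thesis by (auto simp: eventually_sequentially)
qed

lemma finite_cone_level: "finite {y. anc x y \<and> hgt y = hgt x + int n}"
proof (induction n)
  case 0
  have "{y. anc x y \<and> hgt y = hgt x + int 0} \<subseteq> {x}"
  proof clarsimp
    fix y assume "anc x y" "hgt y = hgt x"
    then show "y = x" using anc_eqI[of x y y] by simp
  qed
  then show ?case by (rule finite_subset) simp
next
  case (Suc n)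
  have "{y. anc x y \<and> hgt y = hgt x + int (Suc n)} \<subseteq> (\<Union>z\<in>{y. anc x y \<and> hgt y = hgt x + int n}. children z)"
  proof clarsimp
    fix y assume y: "anc x y" "hgt y = hgt x + (1 + int n)"
    then show "anc x (pr y)" using anc_cases_pr[of x y] by auto
  qed
  then show ?case by (rule finite_subset) (use Suc in auto)
qed

lemma countable_UNIV_vertices: "countable (UNIV :: 'a set)"
proof -
  have "\<exists>n k. anc ((pr ^^ n) rt) x \<and> hgt x = hgt ((pr ^^ n) rt) + int k" for x
  proof -
    obtain n where n: "anc ((pr ^^ n) rt) x"
      using eventually_happens[OF anc_pow_rt[of x]] by auto
    then show ?thesis by (metis ancE)
  qed
  then have "(UNIV :: 'a set) = (\<Union>n k. {x. anc ((pr ^^ n) rt) x \<and> hgt x = hgt ((pr ^^ n) rt) + int k})"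
    by blast
  moreover have "countable \<dots>"
    by (intro countable_UN countableI_type countable_finite finite_cone_level)
  ultimately show ?thesis by simp
qed

section \<open>Chains, lines, and the level at which a vertex joins them\<close>

text \<open>With at most one vertex per height, such a set consists of the ancestors of one vertex
  or is a bi-infinite geodesic, the case singled out by \<open>line\<close>.\<close>

definition chain :: "'a set \<Rightarrow> bool" where
  "chain C \<longleftrightarrow> C \<noteq> {} \<and> (\<forall>x\<in>C. pr x \<in> C) \<and> (\<forall>x\<in>C. \<forall>y\<in>C. hgt x = hgt y \<longrightarrow> x = y)"

definition line :: "'a set \<Rightarrow> bool" where
  "line C \<longleftrightarrow> chain C \<and> (\<forall>x\<in>C. \<exists>y\<in>C. pr y = x)"

text \<open>The height of the first ancestor of x in C. If C consists of the ancestors of y, this is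
  the height of the confluent of x and y with respect to the distinguished end.\<close>

definition lv :: "'a set \<Rightarrow> 'a \<Rightarrow> int" where
  "lv C x = hgt x - int (LEAST k. (pr ^^ k) x \<in> C)"

lemma chain_pow: "chain C \<Longrightarrow> x \<in> C \<Longrightarrow> (pr ^^ n) x \<in> C"
  by (induction n) (auto simp: chain_def)

lemma chain_anc_mem: "chain C \<Longrightarrow> x \<in> C \<Longrightarrow> anc y x \<Longrightarrow> y \<in> C"
  using chain_pow by (auto simp: anc_def)

lemma chain_ancI: "chain C \<Longrightarrow> x \<in> C \<Longrightarrow> y \<in> C \<Longrightarrow> hgt y \<le> hgt x \<Longrightarrow> anc y x"
proof -
  assume C: "chain C" "x \<in> C" "y \<in> C" "hgt y \<le> hgt x"
  then have "(pr ^^ nat (hgt x - hgt y)) x = y"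
    using chain_pow[OF C(1,2), of "nat (hgt x - hgt y)"] unfolding chain_def by simp
  then show "anc y x" unfolding anc_def by blast
qed

lemma chain_ancestors: "chain {x. anc x y}"
  unfolding chain_def
proof (intro conjI ballI impI)
  show "{x. anc x y} \<noteq> {}" using anc_refl by blast
  show "pr x \<in> {x. anc x y}" if "x \<in> {x. anc x y}" for x
    using that anc_pr anc_trans by blast
  show "x = z" if "x \<in> {x. anc x y}" "z \<in> {x. anc x y}" "hgt x = hgt z" for x z
    using that anc_eqI by blast
qed

lemma chain_reach: "chain C \<Longrightarrow> \<exists>k. (pr ^^ k) x \<in> C"
  using merge[of x] chain_pow unfolding chain_def by (metis ex_in_conv)

lemma lvE:
  assumes "chain C"
  obtains z where "z \<in> C" "anc z x" "hgt z = lv C x" "\<And>w. w \<in> C \<Longrightarrow> anc w x \<Longrightarrow> hgt w \<le> lv C x"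
proof -
  let ?k = "LEAST k. (pr ^^ k) x \<in> C"
  have "(pr ^^ ?k) x \<in> C" using LeastI_ex[OF chain_reach[OF assms, of x]] .
  moreover have "hgt w \<le> lv C x" if "w \<in> C" "anc w x" for w
    using that by (elim ancE) (auto simp: lv_def Least_le)
  ultimately show thesis by (intro that[of "(pr ^^ ?k) x"]) (auto simp: lv_def)
qed

lemma lvI:
  assumes "chain C" "z \<in> C" "anc z x" "\<And>w. w \<in> C \<Longrightarrow> anc w x \<Longrightarrow> hgt w \<le> hgt z"
  shows "lv C x = hgt z"
  using assms by (metis lvE order_antisym)

lemma lv_le_hgt: "lv C x \<le> hgt x"
  by (simp add: lv_def)

lemma lv_mem: "chain C \<Longrightarrow> x \<in> C \<Longrightarrow> lv C x = hgt x"
  by (rule lvI) (auto intro: anc_hgt)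

lemma lv_pr: assumes "chain C" "x \<notin> C" shows "lv C (pr x) = lv C x"
proof -
  obtain z where z: "z \<in> C" "anc z x" "hgt z = lv C x" "\<And>w. w \<in> C \<Longrightarrow> anc w x \<Longrightarrow> hgt w \<le> lv C x"
    using lvE[OF assms(1)] by metis
  have "lv C (pr x) = hgt z"
  proof (rule lvI[OF assms(1) z(1)])
    show "anc z (pr x)" using anc_cases_pr[OF z(2)] z(1) assms(2) by auto
    show "hgt w \<le> hgt z" if "w \<in> C" "anc w (pr x)" for w
      using z(3,4) that anc_trans[OF that(2) anc_pr] by simp
  qed
  with z show ?thesis by simp
qed

text \<open>The vertex where x joins C is an ancestor of y, so cutting C off after y does not move
  it. Lines can thus be replaced by the ancestors of a far vertex.\<close>

lemma lv_ancestors: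
  assumes C: "chain C" and y: "y \<in> C" "lv C x \<le> hgt y"
  shows "lv {z. anc z y} x = lv C x"
proof -
  obtain z where z: "z \<in> C" "anc z x" "hgt z = lv C x" "\<And>w. w \<in> C \<Longrightarrow> anc w x \<Longrightarrow> hgt w \<le> lv C x"
    using lvE[OF assms(1)] by metis
  have "lv {z. anc z y} x = hgt z"
  proof (rule lvI[OF chain_ancestors])
    show "z \<in> {z. anc z y}" using chain_ancI[OF C y(1) z(1)] z y by simp
    fix w assume "w \<in> {z. anc z y}" "anc w x"
    then show "hgt w \<le> hgt z" using z chain_anc_mem[OF C y(1)] by auto
  qed (use z in auto)
  with z show ?thesis by simp
qed

lemma lv_ancestors_le: "lv {z. anc z y} x \<le> hgt y"
  using lvE[OF chain_ancestors] by (metis anc_hgt mem_Collect_eq)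

text \<open>
  Harmonicity at \<open>x\<close> for the nearest neighbour walk, written in terms of increments: \<open>\<rho>\<close> is the
  probability of stepping to the predecessor divided by that of stepping to some successor.
\<close>

definition incr :: "('a \<Rightarrow> real) \<Rightarrow> 'a \<Rightarrow> real" where
  "incr g x = g x - g (pr x)"

definition conserved :: "real \<Rightarrow> ('a \<Rightarrow> real) \<Rightarrow> 'a \<Rightarrow> bool" where
  "conserved \<rho> g x \<longleftrightarrow> (\<Sum>y\<in>children x. incr g y) = real q * \<rho> * incr g x"

section \<open>Growth and sign of increments\<close>

lemma incr_diff: "incr (\<lambda>x. f x - g x) x = incr f x - incr g x"
  by (simp add: incr_def)

lemma incr_cmult: "incr (\<lambda>x. c * f x) x = c * incr f x"
  by (simp add: incr_def right_diff_distrib)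

lemma conserved_diff: "conserved \<rho> f x \<Longrightarrow> conserved \<rho> g x \<Longrightarrow> conserved \<rho> (\<lambda>x. f x - g x) x"
  by (simp add: conserved_def incr_diff sum_subtractf right_diff_distrib)

lemma conserved_cmult: "conserved \<rho> f x \<Longrightarrow> conserved \<rho> (\<lambda>x. c * f x) x"
  by (simp add: conserved_def incr_cmult flip: sum_distrib_left)

text \<open>The average increment at the children is \<rho> \<ge> 1 times the increment at the
  parent, so some child has an increment at least as large. Following such children gives linear
  growth.\<close>

lemma growth:
  assumes "1 \<le> \<rho>" and hm: "\<And>y. anc x y \<Longrightarrow> conserved \<rho> g y" and pos: "0 < incr g x"
  shows "\<exists>y. anc x y \<and> incr g x \<le> incr g y \<and> g x + real n * incr g x \<le> g y"
proof (induction n)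
  case 0
  show ?case by (rule exI[of _ x]) simp
next
  case (Suc n)
  then obtain y where y: "anc x y" "incr g x \<le> incr g y" "g x + real n * incr g x \<le> g y" by blast
  have "\<exists>z\<in>children y. incr g y \<le> incr g z"
  proof (rule ccontr)
    assume "\<not> (\<exists>z\<in>children y. incr g y \<le> incr g z)"
    then have "(\<Sum>z\<in>children y. incr g z) < (\<Sum>z\<in>children y. incr g y)"
      using children_nonempty[of y] by (intro sum_strict_mono) (auto simp: not_le)
    also have "\<dots> = real q * incr g y" using card_children by simp
    also have "\<dots> \<le> real q * \<rho> * incr g y"
      using \<open>1 \<le> \<rho>\<close> pos y(2) by (simp add: mult_left_mono mult.assoc)
    finally show False using hm[OF y(1)] by (simp add: conserved_def)
  qed
  then obtain z where z: "pr z = y" "incr g y \<le> incr g z" by blast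
  have "g x + real (Suc n) * incr g x \<le> g y + incr g z"
    using y z by (simp add: algebra_simps)
  then have "g x + real (Suc n) * incr g x \<le> g z" using z by (simp add: incr_def)
  moreover have "anc x z" using y(1) z(1) anc_pr anc_trans by blast
  ultimately show ?case using y(2) z(2) by (intro exI[of _ z]) auto
qed

text \<open>Linear growth of a positive increment would break the bound. All conditions concern the
  cone of x only, which allows the function to fail conservation elsewhere.\<close>

lemma incr_nonpos_of_bounded:
  assumes "1 \<le> \<rho>" "\<And>y. anc x y \<Longrightarrow> conserved \<rho> g y" "\<And>y. anc x y \<Longrightarrow> g y \<le> B"
  shows "incr g x \<le> 0"
proof (rule ccontr)
  assume "\<not> incr g x \<le> 0"
  then have pos: "0 < incr g x" by simp
  obtain n where n: "B - g x < real n * incr g x" using ex_less_of_nat_mult[OF pos] by blast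
  with growth[OF assms(1,2) pos, of n] assms(3) show False by fastforce
qed

lemma incr_nonneg:
  assumes "1 \<le> \<rho>" "\<And>y. anc x y \<Longrightarrow> conserved \<rho> g y" "\<And>y. anc x y \<Longrightarrow> 0 \<le> g y"
  shows "0 \<le> incr g x"
proof -
  have "incr (\<lambda>y. (-1) * g y) x \<le> 0"
    using assms by (intro incr_nonpos_of_bounded[of \<rho> _ _ 0] conserved_cmult) auto
  then show ?thesis by (simp add: incr_def)
qed

lemma pow_le_of_incr_nonneg:
  assumes "\<And>y. 0 \<le> incr g y"
  shows "g ((pr ^^ n) x) \<le> g x"
proof (induction n)
  case (Suc n)
  then show ?case using assms[of "(pr ^^ n) x"] by (simp add: incr_def)
qed simp

lemma const_of_incr_zero:
  assumes "\<And>y. incr g y = 0"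
  shows "g x = g y"
proof -
  have "g ((pr ^^ n) x) = g x" for n x
    using assms by (induction n) (auto simp: incr_def)
  then show ?thesis using merge[of x y] by metis
qed

section \<open>Powers of the level as model functions\<close>

text \<open>For a line C and \<sigma> = q \<rho>, this is the Martin kernel of the end of C before
  normalisation at the root and before undoing the Doob transform.\<close>

definition kap :: "real \<Rightarrow> 'a set \<Rightarrow> 'a \<Rightarrow> real" where
  "kap \<sigma> C x = \<sigma> powi lv C x"

lemma kap_pos: "0 < \<sigma> \<Longrightarrow> 0 < kap \<sigma> C x"
  by (simp add: kap_def)

lemma kap_le: "1 \<le> \<sigma> \<Longrightarrow> kap \<sigma> C x \<le> \<sigma> powi hgt x"
  unfolding kap_def by (intro power_int_increasing lv_le_hgt) auto

lemma kap_pr_mem: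
  assumes "0 < \<sigma>" "chain C" "x \<in> C"
  shows "kap \<sigma> C (pr x) = kap \<sigma> C x / \<sigma>"
  using assms by (simp add: kap_def lv_mem chain_def power_int_diff)

lemma incr_kap_mem:
  "0 < \<sigma> \<Longrightarrow> chain C \<Longrightarrow> x \<in> C \<Longrightarrow> incr (kap \<sigma> C) x = (1 - 1 / \<sigma>) * kap \<sigma> C x"
  by (simp add: incr_def kap_pr_mem left_diff_distrib)

lemma incr_kap_notmem: "chain C \<Longrightarrow> x \<notin> C \<Longrightarrow> incr (kap \<sigma> C) x = 0"
  by (simp add: incr_def kap_def lv_pr)

text \<open>Siblings have equal height, so a chain contains at most one of them.\<close>

lemma sum_children_chain:
  assumes C: "chain C" and f: "\<And>y. y \<notin> C \<Longrightarrow> f y = (0::real)" and y: "y \<in> C"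
  shows "(\<Sum>z\<in>children (pr y). f z) = f y"
proof -
  have "f z = 0" if "z \<in> children (pr y) - {y}" for z
  proof (rule f)
    have "hgt z = hgt y" using that hgt_pr[of z] hgt_pr[of y] by simp
    then show "z \<notin> C" using that C y unfolding chain_def by auto
  qed
  then have "(\<Sum>z\<in>children (pr y). f z) = (\<Sum>z\<in>{y}. f z)"
    by (intro sum.mono_neutral_right) auto
  then show ?thesis by simp
qed

text \<open>The increments form a flow along C: they vanish off C, and each step to the child in C
  multiplies them by \<sigma>. Only a last vertex of C, which has no such child, breaks the balance
  and has to be left out.\<close>

lemma conserved_kap:
  assumes C: "chain C" and \<sigma>: "0 < \<sigma>" and x: "x \<notin> C \<or> (\<exists>y\<in>C. pr y = x)"
  shows "conserved (\<sigma> / real q) (kap \<sigma> C) x"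
proof (cases "x \<in> C")
  case False
  then have "y \<notin> C" if "pr y = x" for y using that C unfolding chain_def by blast
  then show ?thesis using False C by (simp add: conserved_def incr_kap_notmem)
next
  case True
  then obtain y where y: "y \<in> C" "pr y = x" using x by blast
  have "(\<Sum>z\<in>children x. incr (kap \<sigma> C) z) = incr (kap \<sigma> C) y"
    using sum_children_chain[OF C incr_kap_notmem[OF C] y(1)] y(2) by simp
  then show ?thesis
    using incr_kap_mem[OF \<sigma> C y(1)] incr_kap_mem[OF \<sigma> C True] kap_pr_mem[OF \<sigma> C y(1)] y(2) \<sigma> q_ge_2
    by (simp add: conserved_def)
qed

text \<open>Increments determine a function only up to an additive constant; decay towards the
  distinguished end is what later fixes the constant.\<close>

lemma kap_tendsto_0:
  assumes "1 < \<sigma>"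
  shows "(\<lambda>n. kap \<sigma> C ((pr ^^ n) x)) \<longlonglongrightarrow> 0"
proof (rule tendsto_sandwich[of "\<lambda>_. 0"])
  show "\<forall>\<^sub>F n in sequentially. 0 \<le> kap \<sigma> C ((pr ^^ n) x)"
    using kap_pos[of \<sigma>] assms by (intro always_eventually allI less_imp_le) auto
  show "\<forall>\<^sub>F n in sequentially. kap \<sigma> C ((pr ^^ n) x) \<le> \<sigma> powi hgt x * (1 / \<sigma>) ^ n"
  proof (intro always_eventually allI)
    fix n
    have "\<sigma> powi hgt ((pr ^^ n) x) = \<sigma> powi hgt x * (1 / \<sigma>) ^ n"
      using assms by (simp add: power_int_diff power_divide)
    then show "kap \<sigma> C ((pr ^^ n) x) \<le> \<sigma> powi hgt x * (1 / \<sigma>) ^ n"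
      using kap_le[of \<sigma> C "(pr ^^ n) x"] assms by simp
  qed
  show "(\<lambda>n. \<sigma> powi hgt x * (1 / \<sigma>) ^ n) \<longlonglongrightarrow> 0"
    using assms by (intro tendsto_mult_right_zero LIMSEQ_realpow_zero) auto
qed simp

end

section \<open>The tree walk and its Doob transform\<close>

locale pred_tree_walk = pred_tree +
  fixes a :: real
  assumes a_pos: "0 < a" and a_less_1: "a < 1"
begin

definition walk :: "'a \<Rightarrow> 'a \<Rightarrow> real" where
  "walk x y = (if pr y = x then a / real q else if y = pr x then 1 - a else 0)"

definition harm_at :: "('a \<Rightarrow> real) \<Rightarrow> 'a \<Rightarrow> bool" where
  "harm_at f x \<longleftrightarrow> f x = a / real q * (\<Sum>y\<in>children x. f y) + (1 - a) * f (pr x)"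

text \<open>The odds of the predecessor against the successors after the transform by \<psi>: the
  original odds \<open>(1 - a) / a\<close> or, where the transform reverses the drift, their
  inverse.\<close>

definition \<rho> :: real where "\<rho> = max ((1 - a) / a) (a / (1 - a))"

text \<open>Of the two harmonic powers of the height, the one that does not grow away from the
  distinguished end.\<close>

definition \<psi> :: "'a \<Rightarrow> real" where "\<psi> x = min 1 ((1 - a) / a) powi hgt x"

lemma \<rho>_ge_1: "1 \<le> \<rho>"
  using a_pos a_less_1 by (cases "a \<le> 1 / 2") (auto simp: \<rho>_def max_def field_simps)

lemma q\<rho>_gt_1: "1 < real q * \<rho>"
proof -
  have "2 * 1 \<le> real q * \<rho>" using q_ge_2 \<rho>_ge_1 by (intro mult_mono) auto
  then show ?thesis by simp
qed

lemma q\<rho>_pos: "0 < real q * \<rho>"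
  using q\<rho>_gt_1 by simp

lemma conserved_kap':
  "chain C \<Longrightarrow> x \<notin> C \<or> (\<exists>y\<in>C. pr y = x) \<Longrightarrow> conserved \<rho> (kap (real q * \<rho>) C) x"
  using conserved_kap[OF _ q\<rho>_pos] q_ge_2 by simp

lemma \<psi>_pos: "0 < \<psi> x"
  using a_pos a_less_1 by (simp add: \<psi>_def)

lemma \<psi>_nz [simp]: "\<psi> x \<noteq> 0"
  using \<psi>_pos[of x] by simp

lemma \<psi>_rt [simp]: "\<psi> rt = 1"
  by (simp add: \<psi>_def)

lemma \<psi>_pr: "\<psi> (pr x) = \<psi> x / min 1 ((1 - a) / a)"
proof -
  have "min 1 ((1 - a) / a) \<noteq> 0" using a_pos a_less_1 by (simp add: min_def)
  then show ?thesis by (simp add: \<psi>_def power_int_diff)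
qed

text \<open>The Doob transform by \<open>\<psi>\<close> turns the walk into one whose drift does not point away from the
  reference end.\<close>

lemma harm_at_iff: "harm_at f x \<longleftrightarrow> conserved \<rho> (\<lambda>x. f x / \<psi> x) x"
proof -
  \<comment> \<open>This is the case a > 1 / 2, where \<open>b / a\<close> is the base of \<psi> and
    \<open>a / b\<close> is \<rho>; a + b = 1 enters after clearing denominators.\<close>
  have identity: "S / (b / a) - q * u - q * (a / b) * (u - (b / a) * v) = q / b * (a / q * S + b * v - u)"
    if "a \<noteq> 0" "b \<noteq> 0" "q \<noteq> 0" "a + b = 1" for a b q S u v :: real
  proof -
    have "S / (b / a) - q * u - q * (a / b) * (u - (b / a) * v) = (a * S - q * (a + b) * u + q * b * v) / b"
      using that(1-3) by (simp add: field_simps)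
    also have "\<dots> = q / b * (a / q * S + b * v - u)"
      unfolding that(4) using that(1-3) by (simp add: field_simps)
    finally show ?thesis .
  qed
  let ?F = "min 1 ((1 - a) / a)" and ?S = "\<Sum>y\<in>children x. f y"
  have F: "0 < ?F" using a_pos a_less_1 by simp
  have "incr (\<lambda>x. f x / \<psi> x) y = (f y / ?F - f x) / \<psi> x" if "y \<in> children x" for y
    using that \<psi>_pr[of y] F by (auto simp: incr_def field_simps)
  then have "(\<Sum>y\<in>children x. incr (\<lambda>x. f x / \<psi> x) y) = (\<Sum>y\<in>children x. (f y / ?F - f x) / \<psi> x)"
    by simp
  also have "\<dots> = (?S / ?F - real q * f x) / \<psi> x"
    using card_children[of x] by (simp add: sum_subtractf flip: sum_divide_distrib)
  finally have 1: "(\<Sum>y\<in>children x. incr (\<lambda>x. f x / \<psi> x) y) = (?S / ?F - real q * f x) / \<psi> x" .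
  have 2: "incr (\<lambda>x. f x / \<psi> x) x = (f x - ?F * f (pr x)) / \<psi> x"
    using \<psi>_pr[of x] F by (simp add: incr_def field_simps)
  have "conserved \<rho> (\<lambda>x. f x / \<psi> x) x \<longleftrightarrow> ?S / ?F - real q * f x = real q * \<rho> * (f x - ?F * f (pr x))"
    unfolding conserved_def 1 2 by simp
  also have "\<dots> \<longleftrightarrow> harm_at f x"
  proof -
    \<comment> \<open>The two equations differ by a nonzero factor: q / a without drift reversal, q
      / (1 - a) with it.\<close>
    have "\<exists>k. k \<noteq> 0 \<and> ?S / ?F - real q * f x - real q * \<rho> * (f x - ?F * f (pr x)) =
        k * (a / real q * ?S + (1 - a) * f (pr x) - f x)"
    proof (cases "a \<le> 1 / 2")
      case True
      have "a * a \<le> (1 - a) * (1 - a)" using True a_pos by (intro mult_mono) auto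
      then have F: "?F = 1" and \<rho>: "\<rho> = (1 - a) / a"
        using True a_pos a_less_1 by (auto simp: \<rho>_def min_def max_def field_simps)
      show ?thesis unfolding F \<rho>
        using a_pos a_less_1 q_ge_2 by (intro exI[of _ "real q / a"]) (simp add: field_simps)
    next
      case False
      then have "(1 - a) * (1 - a) < a * a" using a_less_1 by (intro mult_strict_mono) auto
      then have F: "?F = (1 - a) / a" and \<rho>: "\<rho> = a / (1 - a)"
        using False a_pos a_less_1 by (auto simp: \<rho>_def min_def max_def field_simps)
      show ?thesis unfolding F \<rho>
        using a_pos a_less_1 q_ge_2 identity[of a "1 - a" "real q"]
        by (intro exI[of _ "real q / (1 - a)"]) simp
    qed
    then show ?thesis by (auto simp: harm_at_def)
  qed
  finally show ?thesis ..
qed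

lemma harm_at_\<psi>_mult: "conserved \<rho> g x \<Longrightarrow> harm_at (\<lambda>x. \<psi> x * g x) x"
  by (simp add: harm_at_iff)

section \<open>Hitting probabilities of the tree walk in closed form\<close>

lemma walk_support: "{y. walk x y \<noteq> 0} = insert (pr x) (children x)"
  using a_pos a_less_1 q_ge_2 by (auto simp: walk_def)

lemma pr_pr_neq: "pr (pr x) \<noteq> x"
  using hgt_pr[of "pr x"] hgt_pr[of x] by fastforce

lemma sum_walk: "(\<Sum>y | walk x y \<noteq> 0. walk x y * f y) = a / real q * (\<Sum>y\<in>children x. f y) + (1 - a) * f (pr x)"
proof -
  have "(\<Sum>y\<in>children x. walk x y * f y) = (\<Sum>y\<in>children x. a / real q * f y)"
    by (intro sum.cong) (auto simp: walk_def)
  moreover have "walk x (pr x) = 1 - a" using pr_pr_neq by (simp add: walk_def)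
  ultimately show ?thesis
    unfolding walk_support using pr_pr_neq by (simp add: sum_distrib_left)
qed

sublocale finite_range_chain walk
proof
  fix x y
  show "0 \<le> walk x y" using a_pos a_less_1 by (simp add: walk_def)
  show "finite {y. walk x y \<noteq> 0}" by (simp add: walk_support)
  show "(\<Sum>y | walk x y \<noteq> 0. walk x y) = 1"
    using sum_walk[of x "\<lambda>_. 1"] card_children[of x] q_ge_2 by simp
qed

text \<open>The formula is harmonic off y and equals 1 at y, so it dominates the hitting
  probability. The transformed difference w is bounded, conserved off y and zero at y; the proof
  shows that all its increments vanish.\<close>

theorem hit_prob_walk:
  "hit_prob walk x y = \<psi> x * kap (real q * \<rho>) {z. anc z y} x / (\<psi> y * (real q * \<rho>) powi hgt y)"
proof -
  let ?C = "{z. anc z y}" and ?\<sigma> = "real q * \<rho>"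
  define c where "c = 1 / (\<psi> y * ?\<sigma> powi hgt y)"
  define f where "f x = \<psi> x * (c * kap ?\<sigma> ?C x)" for x
  define w where "w x = (f x - hit_prob walk x y) / \<psi> x" for x
  have \<sigma>: "0 < ?\<sigma> powi hgt y" by (rule zero_less_power_int[OF q\<rho>_pos])
  have c: "0 < c" using \<sigma> \<psi>_pos[of y] by (simp add: c_def)
  have fy: "f y = 1"
    using less_imp_neq[OF \<sigma>] by (simp add: f_def c_def kap_def lv_mem chain_ancestors del: power_int_eq_0_iff)
  have hf: "harm_at f x" if "x \<noteq> y" for x
    unfolding f_def
    using that anc_child
    by (intro harm_at_\<psi>_mult conserved_cmult conserved_kap' chain_ancestors) auto
  have hu: "harm_at (\<lambda>x. hit_prob walk x y) x" if "x \<noteq> y" for x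
    using hit_prob_step[OF that] by (simp add: harm_at_def sum_walk)
  have ule: "hit_prob walk x y \<le> f x" for x
  proof (rule hit_prob_le_superharmonic)
    show "0 \<le> f x" for x
      using \<psi>_pos[of x] c kap_pos[OF q\<rho>_pos, of ?C x] by (simp add: f_def less_imp_le)
    show "(\<Sum>z | walk x z \<noteq> 0. walk x z * f z) \<le> f x" if "x \<noteq> y" for x
      using hf[OF that] by (simp add: harm_at_def sum_walk)
  qed (simp add: fy)
  have w0: "0 \<le> w x" for x using ule[of x] \<psi>_pos[of x] by (simp add: w_def)
  have wle: "w x \<le> c * kap ?\<sigma> ?C x" for x
  proof -
    have "w x \<le> f x / \<psi> x"
      unfolding w_def using \<psi>_pos[of x] hit_prob_nonneg by (intro divide_right_mono) auto
    then show ?thesis by (simp add: f_def)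
  qed
  have wbd: "w x \<le> c * ?\<sigma> powi hgt y" for x
  proof -
    have "kap ?\<sigma> ?C x \<le> ?\<sigma> powi hgt y"
      unfolding kap_def using q\<rho>_gt_1 by (intro power_int_increasing lv_ancestors_le) auto
    then show ?thesis using wle[of x] c by (meson mult_left_mono less_imp_le order_trans)
  qed
  have wy: "w y = 0" by (simp add: w_def fy hit_prob_self)
  have hw: "conserved \<rho> w x" if "x \<noteq> y" for x
    using conserved_diff[OF hf[OF that, unfolded harm_at_iff] hu[OF that, unfolded harm_at_iff]]
    unfolding w_def by (simp add: diff_divide_distrib)
  \<comment> \<open>The cone of such an x does not contain y, so w is conserved on all of it, and
    boundedness on both sides leaves no increment.\<close>
  have off: "incr w x = 0" if "\<not> anc x y" for x
  proof (rule antisym)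
    have "conserved \<rho> w z" if "anc x z" for z
      using that \<open>\<not> anc x y\<close> by (intro hw) auto
    then show "incr w x \<le> 0" "0 \<le> incr w x"
      using w0 wbd \<rho>_ge_1 by (auto intro!: incr_nonpos_of_bounded[of \<rho>] incr_nonneg[of \<rho>])
  qed
  \<comment> \<open>Only ancestors of y can now carry increments, so conservation there is a
    geometric recursion.\<close>
  have step: "incr w ((pr ^^ n) y) = incr w y / ?\<sigma> ^ n" for n
  proof (induction n)
    case (Suc n)
    have ne: "(pr ^^ Suc n) y \<noteq> y"
    proof
      assume "(pr ^^ Suc n) y = y"
      from arg_cong[OF this, of hgt] show False unfolding hgt_pow by simp
    qed
    have "(\<Sum>z\<in>children (pr ((pr ^^ n) y)). incr w z) = incr w ((pr ^^ n) y)"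
      using off by (intro sum_children_chain[OF chain_ancestors[of y]]) auto
    with hw[OF ne] have "incr w ((pr ^^ n) y) = ?\<sigma> * incr w ((pr ^^ Suc n) y)"
      by (simp add: conserved_def)
    then have "incr w ((pr ^^ Suc n) y) = incr w ((pr ^^ n) y) / ?\<sigma>"
      using q\<rho>_pos by (metis nonzero_mult_div_cancel_left less_irrefl)
    with Suc show ?case by (simp only: power_Suc2 divide_divide_eq_left)
  qed simp
  \<comment> \<open>As w is non-negative and zero at y, its increment at y cannot be positive. Were
    it negative, w would stay at least \<open>- incr w y\<close> along the proper ancestors of y,
    against the decay of its upper bound.\<close>
  have "incr w y \<le> 0" using w0[of "pr y"] wy by (simp add: incr_def)
  then have mono: "- incr w y \<le> w ((pr ^^ Suc n) y)" for n
  proof (induction n)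
    case 0
    then show ?case using wy by (simp add: incr_def)
  next
    case (Suc n)
    have "incr w ((pr ^^ Suc n) y) \<le> 0"
      unfolding step using Suc.prems q\<rho>_pos by (simp add: divide_nonpos_pos)
    moreover have "w ((pr ^^ Suc (Suc n)) y) = w ((pr ^^ Suc n) y) - incr w ((pr ^^ Suc n) y)"
      by (simp add: incr_def)
    ultimately show ?case using Suc.IH[OF Suc.prems] by linarith
  qed
  have "(\<lambda>n. c * kap ?\<sigma> ?C ((pr ^^ Suc n) y)) \<longlonglongrightarrow> 0"
    by (intro tendsto_mult_right_zero LIMSEQ_Suc[OF kap_tendsto_0] q\<rho>_gt_1)
  then have "- incr w y \<le> 0"
    by (rule LIMSEQ_le_const) (use mono wle in \<open>auto intro: order_trans\<close>)
  with \<open>incr w y \<le> 0\<close> have "incr w y = 0" by simp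
  with step have on: "incr w x = 0" if "anc x y" for x
    using that by (auto simp: anc_def)
  have "w x = w y" by (rule const_of_incr_zero) (use on off in blast)
  with wy have "hit_prob walk x y = f x" by (simp add: w_def)
  then show ?thesis by (simp add: f_def c_def)
qed

section \<open>Kernels attached to lines\<close>

text \<open>For conserved g, the value \<open>incr g x / \<sigma> powi hgt x\<close> is the sum of
  the same values over the children of x: a finitely additive measure on cones.\<close>

definition \<sigma> :: real where "\<sigma> = real q * \<rho>"

lemma \<sigma>_gt_1: "1 < \<sigma>"
  using q\<rho>_gt_1 by (simp add: \<sigma>_def)

lemma \<sigma>_pos: "0 < \<sigma>"
  using \<sigma>_gt_1 by simp

lemma conserved_\<sigma>: "conserved \<rho> g x \<longleftrightarrow> (\<Sum>y\<in>children x. incr g y) = \<sigma> * incr g x"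
  by (simp add: conserved_def \<sigma>_def)

lemma conserved_kap_\<sigma>:
  "chain C \<Longrightarrow> x \<notin> C \<or> (\<exists>y\<in>C. pr y = x) \<Longrightarrow> conserved \<rho> (kap \<sigma> C) x"
  unfolding \<sigma>_def by (rule conserved_kap')

definition martin_line :: "'a set \<Rightarrow> 'a \<Rightarrow> real" where
  "martin_line C x = \<psi> x * (kap \<sigma> C x / kap \<sigma> C rt)"

lemma martin_line_pos: "0 < martin_line C x"
  unfolding martin_line_def by (intro mult_pos_pos divide_pos_pos \<psi>_pos kap_pos \<sigma>_pos)

lemma martin_line_rt [simp]: "martin_line C rt = 1"
  using kap_pos[OF \<sigma>_pos, of C rt] by (simp add: martin_line_def)

lemma line_chain: "line C \<Longrightarrow> chain C"
  by (simp add: line_def)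

lemma line_conserved_kap: "line C \<Longrightarrow> conserved \<rho> (kap \<sigma> C) x"
  by (rule conserved_kap_\<sigma>) (auto simp: line_def)

lemma harm_at_martin_line:
  assumes "line C"
  shows "harm_at (martin_line C) x"
proof -
  have "harm_at (\<lambda>x. \<psi> x * (1 / kap \<sigma> C rt * kap \<sigma> C x)) x"
    by (intro harm_at_\<psi>_mult conserved_cmult line_conserved_kap assms)
  then show ?thesis by (simp add: martin_line_def[abs_def])
qed

lemma anc_of_pr: "anc x (pr y) \<Longrightarrow> anc x y"
  using anc_pr anc_trans by blast

text \<open>Otherwise the vertex where y joins C would descend from x, which would put x into
  C.\<close>

lemma lv_le_off:
  assumes "chain C" "x \<notin> C" "anc x y"
  shows "lv C y \<le> hgt x"
proof -
  obtain z where z: "z \<in> C" "anc z y" "hgt z = lv C y" using lvE[OF assms(1)] by metis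
  show ?thesis
  proof (rule ccontr)
    assume "\<not> lv C y \<le> hgt x"
    then have "anc x z" using z assms(3) by (intro anc_linear[of x y z]) auto
    then show False using chain_anc_mem[OF assms(1) z(1)] assms(2) by blast
  qed
qed

lemma chain_ex_hgt:
  assumes "chain C"
  shows "\<exists>x\<in>C. hgt x \<le> n"
proof -
  obtain c where c: "c \<in> C" using assms by (auto simp: chain_def)
  have "(pr ^^ nat (hgt c - n)) c \<in> C" by (rule chain_pow[OF assms c])
  moreover have "hgt ((pr ^^ nat (hgt c - n)) c) \<le> n" by simp
  ultimately show ?thesis by blast
qed

lemma line_ex_hgt:
  assumes "line C"
  shows "\<exists>x\<in>C. n \<le> hgt x"
proof -
  obtain c where c: "c \<in> C" using line_chain[OF assms] by (auto simp: chain_def)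
  have "\<exists>x\<in>C. hgt x = hgt c + int k" for k
  proof (induction k)
    case 0
    then show ?case using c by auto
  next
    case (Suc k)
    then obtain x where x: "x \<in> C" "hgt x = hgt c + int k" by blast
    then obtain y where "y \<in> C" "pr y = x" using assms by (auto simp: line_def)
    then show ?case using x hgt_pr[of y] by (intro bexI[of _ y]) auto
  qed
  then obtain x where "x \<in> C" "hgt x = hgt c + int (nat (n - hgt c))" by blast
  then show ?thesis by (intro bexI[of _ x]) auto
qed

lemma children_not_subset_chain:
  assumes "chain C"
  shows "\<exists>y. pr y = x \<and> y \<notin> C"
proof (rule ccontr)
  assume "\<nexists>y. pr y = x \<and> y \<notin> C"
  then have C: "children x \<subseteq> C" by blast
  obtain y where y: "pr y = x" using children_nonempty[of x] by blast
  have "z = y" if "z \<in> children x" for z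
    using that y C assms hgt_pr[of y] hgt_pr[of z] unfolding chain_def by auto
  then have "children x \<subseteq> {y}" by blast
  then have "card (children x) \<le> card {y}" by (intro card_mono) simp
  then show False using card_children[of x] q_ge_2 by simp
qed

text \<open>Leaving C very close to the distinguished end and then descending to height s makes the
  level arbitrarily low, while \<psi> is constant on that horocycle.\<close>

lemma martin_line_small:
  assumes C: "chain C" and \<epsilon>: "0 < \<epsilon>"
  shows "\<exists>x. hgt x = s \<and> martin_line C x < \<epsilon>"
proof -
  define B where "B = min 1 ((1 - a) / a) powi s / kap \<sigma> C rt"
  have B: "0 < B"
    unfolding B_def using a_pos a_less_1 kap_pos[OF \<sigma>_pos, of C rt] by (intro divide_pos_pos zero_less_power_int) auto
  obtain N where N: "(1 / \<sigma>) ^ N < \<epsilon> / B"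
    using real_arch_pow_inv[of "\<epsilon> / B" "1 / \<sigma>"] \<epsilon> B \<sigma>_gt_1 by auto
  \<comment> \<open>Height at most s - 1 leaves room for the child y on the way to height s; height
    at most -N gives the bound on the level.\<close>
  obtain c where c: "c \<in> C" "hgt c \<le> min (s - 1) (- int N)" using chain_ex_hgt[OF C] by blast
  obtain y where y: "pr y = c" "y \<notin> C" using children_not_subset_chain[OF C] by blast
  have hy: "hgt y = hgt c + 1" using hgt_pr[of y] y(1) by simp
  obtain x where x: "anc y x" "hgt x = s"
    using ex_descendant[of y "nat (s - hgt y)"] hy c(2) by auto
  have "lv C x \<le> hgt c"
  proof -
    obtain z where z: "z \<in> C" "anc z x" "hgt z = lv C x" using lvE[OF C] by metis
    show ?thesis
    proof (rule ccontr)
      assume "\<not> lv C x \<le> hgt c"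
      then have "anc y z" using z hy x(1) by (intro anc_linear[of y x z]) auto
      then show False using chain_anc_mem[OF C z(1)] y(2) by blast
    qed
  qed
  then have "kap \<sigma> C x \<le> \<sigma> powi (- int N)"
    unfolding kap_def using c(2) \<sigma>_gt_1 by (intro power_int_increasing) auto
  also have "\<dots> = (1 / \<sigma>) ^ N" by (simp add: power_int_minus power_inverse divide_inverse)
  also have "\<dots> < \<epsilon> / B" by (rule N)
  finally have "kap \<sigma> C x < \<epsilon> / B" .
  then have "B * kap \<sigma> C x < \<epsilon>" using B by (simp add: field_simps)
  then have "martin_line C x < \<epsilon>" using x(2) by (simp add: martin_line_def \<psi>_def B_def)
  with x(2) show ?thesis by blast
qed

section \<open>Minimal harmonic functions of the tree walk\<close>

definition tree_minimal :: "('a \<Rightarrow> real) \<Rightarrow> bool" where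
  "tree_minimal f \<longleftrightarrow> (\<forall>x. harm_at f x) \<and> (\<forall>x. 0 \<le> f x) \<and> f rt = 1 \<and>
     (\<forall>g. (\<forall>x. harm_at g x) \<and> (\<forall>x. 0 \<le> g x) \<and> (\<forall>x. g x \<le> f x) \<longrightarrow> (\<exists>c. \<forall>x. g x = c * f x))"

text \<open>Off C the kernel is bounded on cones, so the smaller function has increments on C only.
  There conservation makes them proportional to those of the kernel, and decay towards the
  distinguished end excludes an additive constant.\<close>

lemma martin_line_minimal:
  assumes C: "line C" and f: "\<And>x. harm_at f x" "\<And>x. 0 \<le> f x" "\<And>x. f x \<le> martin_line C x"
  shows "\<exists>c. \<forall>x. f x = c * martin_line C x"
proof -
  note ch = line_chain[OF C]
  define g where "g x = f x / \<psi> x" for x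
  define b where "b = 1 / kap \<sigma> C rt"
  have b: "0 < b" using kap_pos[OF \<sigma>_pos, of C rt] by (simp add: b_def)
  have cg: "conserved \<rho> g x" for x using f(1)[of x] unfolding harm_at_iff g_def .
  have g0: "0 \<le> g x" for x using f(2)[of x] \<psi>_pos[of x] by (simp add: g_def)
  have g_le: "g x \<le> b * kap \<sigma> C x" for x
    using f(3)[of x] \<psi>_pos[of x] by (simp add: g_def martin_line_def b_def divide_le_eq mult.commute)
  have off: "incr g x = 0" if "x \<notin> C" for x
  proof (rule antisym)
    show "0 \<le> incr g x" using \<rho>_ge_1 cg g0 by (rule incr_nonneg)
    show "incr g x \<le> 0"
    proof (rule incr_nonpos_of_bounded[OF \<rho>_ge_1 cg])
      fix y assume "anc x y"
      then have "kap \<sigma> C y \<le> \<sigma> powi hgt x"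
        unfolding kap_def using lv_le_off[OF ch that] \<sigma>_gt_1 by (intro power_int_increasing) auto
      then have "b * kap \<sigma> C y \<le> b * \<sigma> powi hgt x" using b by (intro mult_left_mono) auto
      with g_le[of y] show "g y \<le> b * \<sigma> powi hgt x" by simp
    qed
  qed
  \<comment> \<open>One step along C multiplies both the increment of g and \<open>kap\<close> by
    \<sigma>, so this ratio is constant on C.\<close>
  define R where "R x = incr g x / kap \<sigma> C x" for x
  have R_pr: "R (pr x) = R x" if "x \<in> C" for x
  proof -
    have "incr g x = \<sigma> * incr g (pr x)"
      using cg[of "pr x"] sum_children_chain[OF ch off that] by (simp add: conserved_\<sigma>)
    then show ?thesis using kap_pr_mem[OF \<sigma>_pos ch that] by (simp add: R_def)
  qed
  have R_pow: "R ((pr ^^ n) x) = R x" if "x \<in> C" for x n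
  proof (induction n)
    case (Suc n)
    then show ?case using R_pr[OF chain_pow[OF ch that, of n]] by simp
  qed simp
  have R_const: "R x = R y" if "x \<in> C" "y \<in> C" for x y
  proof -
    have "anc x y \<or> anc y x" using chain_ancI[OF ch] that by (meson linear)
    then show ?thesis using R_pow that by (auto simp: anc_def)
  qed
  obtain x0 where x0: "x0 \<in> C" using ch by (auto simp: chain_def)
  \<comment> \<open>The divisor is the factor by which \<open>incr_kap_mem\<close> relates the
    increment of \<open>kap\<close> to its value.\<close>
  define c where "c = R x0 / (1 - 1 / \<sigma>)"
  have "incr (\<lambda>x. g x - c * kap \<sigma> C x) x = 0" for x
  proof (cases "x \<in> C")
    case True
    have "incr g x = R x0 * kap \<sigma> C x"
      using R_const[OF True x0] less_imp_neq[OF kap_pos[OF \<sigma>_pos, of C x]] by (simp add: R_def field_simps)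
    moreover have "c * (1 - 1 / \<sigma>) = R x0" using \<sigma>_gt_1 unfolding c_def by simp
    ultimately show ?thesis
      unfolding incr_diff incr_cmult incr_kap_mem[OF \<sigma>_pos ch True] by (simp add: mult.assoc[symmetric])
  qed (simp add: incr_diff incr_cmult off incr_kap_notmem[OF ch])
  then have const: "g x - c * kap \<sigma> C x = g y - c * kap \<sigma> C y" for x y by (rule const_of_incr_zero)
  have "(\<lambda>n. g ((pr ^^ n) rt) - c * kap \<sigma> C ((pr ^^ n) rt)) \<longlonglongrightarrow> 0 - c * 0"
  proof (intro tendsto_intros kap_tendsto_0 \<sigma>_gt_1)
    have "(\<lambda>n. b * kap \<sigma> C ((pr ^^ n) rt)) \<longlonglongrightarrow> 0"
      by (intro tendsto_mult_right_zero kap_tendsto_0 \<sigma>_gt_1)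
    then show "(\<lambda>n. g ((pr ^^ n) rt)) \<longlonglongrightarrow> 0"
      by (rule tendsto_sandwich[OF _ _ tendsto_const, rotated 2]) (use g0 g_le in auto)
  qed
  moreover have "(\<lambda>n. g ((pr ^^ n) rt) - c * kap \<sigma> C ((pr ^^ n) rt)) = (\<lambda>n. g rt - c * kap \<sigma> C rt)"
    by (intro ext const)
  ultimately have "(\<lambda>n. g rt - c * kap \<sigma> C rt) \<longlonglongrightarrow> 0" by simp
  then have "g rt - c * kap \<sigma> C rt = 0" by (simp add: LIMSEQ_const_iff)
  then have "g x = c * kap \<sigma> C x" for x using const[of x rt] by simp
  then have "f x = c * kap \<sigma> C rt * martin_line C x" for x
    using kap_pos[OF \<sigma>_pos, of C rt] \<psi>_nz[of x] by (simp add: martin_line_def g_def field_simps)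
  then show ?thesis by blast
qed

text \<open>
  In the representation of \<open>g\<close> by a measure on the ends, this restricts the measure to the ends below
  \<open>x\<close>. The coefficient sums the geometric series of the resulting increments at the ancestors of \<open>x\<close>.
\<close>

definition cone_part :: "('a \<Rightarrow> real) \<Rightarrow> 'a \<Rightarrow> 'a \<Rightarrow> real" where
  "cone_part g x y = incr g x / ((1 - 1 / \<sigma>) * \<sigma> powi hgt x) * kap \<sigma> {z. anc z x} y +
     (if anc x y then g y - g x else 0)"

lemma incr_cone_part_off:
  assumes "\<not> anc x y \<or> y = x"
  shows "incr (cone_part g x) y = incr g x / ((1 - 1 / \<sigma>) * \<sigma> powi hgt x) * incr (kap \<sigma> {z. anc z x}) y"
proof -
  have "\<not> anc x (pr y)"
  proof
    assume xy: "anc x (pr y)"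
    then have "anc x y" using anc_pr anc_trans by blast
    then show False using assms anc_hgt[OF xy] by auto
  qed
  then show ?thesis using assms by (auto simp: incr_def cone_part_def right_diff_distrib)
qed

text \<open>The coefficient in \<open>cone_part\<close> is fixed by this requirement, since on the
  ancestors of x the increment of \<open>kap\<close> at x is
  \<open>(1 - 1 / \<sigma>) * \<sigma> powi hgt x\<close>.\<close>

lemma incr_cone_part_self: "incr (cone_part g x) x = incr g x"
proof -
  have "1 - 1 / \<sigma> \<noteq> 0" "\<sigma> powi hgt x \<noteq> 0"
    using \<sigma>_gt_1 zero_less_power_int[OF \<sigma>_pos, of "hgt x"] by (simp, linarith)
  then show ?thesis
    using incr_cone_part_off[of x x g] incr_kap_mem[OF \<sigma>_pos chain_ancestors, of x x]
    by (simp add: kap_def lv_mem chain_ancestors del: power_int_eq_0_iff)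
qed

lemma incr_cone_part_below:
  assumes "anc x y"
  shows "incr (cone_part g x) y = incr g y"
proof (cases "y = x")
  case False
  then have "anc x (pr y)" using anc_cases_pr[OF assms] by auto
  moreover have "\<not> anc y x"
    using False anc_eqI[of x y y] anc_hgt[OF assms] anc_hgt[of y x] assms by auto
  ultimately show ?thesis
    using assms lv_pr[OF chain_ancestors, of y x] by (simp add: incr_def cone_part_def kap_def)
qed (simp add: incr_cone_part_self)

text \<open>In the cone of x the increments are those of g, elsewhere those of a multiple of
  \<open>kap\<close>. The latter is conserved except at x, the last vertex of its chain; there the
  increments of g take over with the matching value.\<close>

lemma conserved_cone_part:
  assumes "\<And>y. conserved \<rho> g y"
  shows "conserved \<rho> (cone_part g x) z"
proof (cases "anc x z")
  case True
  have "(\<Sum>y\<in>children z. incr (cone_part g x) y) = (\<Sum>y\<in>children z. incr g y)"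
  proof (intro sum.cong refl incr_cone_part_below)
    fix y assume "y \<in> children z"
    then show "anc x y" using anc_trans[OF True] anc_pr[of y] by simp
  qed
  then show ?thesis using assms[of z] incr_cone_part_below[OF True] by (simp add: conserved_\<sigma>)
next
  case False
  let ?c = "incr g x / ((1 - 1 / \<sigma>) * \<sigma> powi hgt x)" and ?K = "kap \<sigma> {z. anc z x}"
  have "(\<Sum>y\<in>children z. incr (cone_part g x) y) = (\<Sum>y\<in>children z. ?c * incr ?K y)"
  proof (intro sum.cong refl incr_cone_part_off)
    fix y assume "y \<in> children z"
    then show "\<not> anc x y \<or> y = x" using False anc_cases_pr[of x y] by auto
  qed
  also have "\<dots> = \<sigma> * (?c * incr ?K z)"
  proof -
    have "z \<notin> {z. anc z x} \<or> (\<exists>y\<in>{z. anc z x}. pr y = z)"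
      using False anc_child[of z x] by auto
    then have "conserved \<rho> ?K z" by (rule conserved_kap_\<sigma>[OF chain_ancestors])
    then show ?thesis by (simp only: conserved_\<sigma> mult.left_commute flip: sum_distrib_left)
  qed
  finally show ?thesis using incr_cone_part_off[of x z g] False by (simp add: conserved_\<sigma>)
qed

lemma cone_part_nonneg:
  assumes "\<And>y. 0 \<le> incr g y"
  shows "0 \<le> cone_part g x y"
proof -
  have "0 \<le> incr g x / ((1 - 1 / \<sigma>) * \<sigma> powi hgt x) * kap \<sigma> {z. anc z x} y"
    using \<sigma>_gt_1 zero_less_power_int[OF \<sigma>_pos, of "hgt x"] kap_pos[OF \<sigma>_pos, of "{z. anc z x}" y] assms[of x]
    by (intro mult_nonneg_nonneg divide_nonneg_nonneg) auto
  moreover have "g x \<le> g y" if "anc x y"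
    using that pow_le_of_incr_nonneg[OF assms] by (auto simp: anc_def)
  ultimately show ?thesis by (simp add: cone_part_def)
qed

text \<open>The measure of the cone of x is at most that of the cone of any ancestor, so the
  difference e has non-negative increments. It also has a non-negative lower limit towards the
  distinguished end, hence is non-negative.\<close>

lemma cone_part_le:
  assumes cg: "\<And>y. conserved \<rho> g y" and D: "\<And>y. 0 \<le> incr g y" and g0: "\<And>y. 0 \<le> g y"
  shows "cone_part g x y \<le> g y"
proof -
  let ?c = "incr g x / ((1 - 1 / \<sigma>) * \<sigma> powi hgt x)" and ?K = "kap \<sigma> {z. anc z x}"
  define e where "e y = g y - cone_part g x y" for y
  have up: "incr g z \<le> \<sigma> * incr g (pr z)" for z
  proof -
    have "incr g z \<le> (\<Sum>y\<in>children (pr z). incr g y)"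
      using D by (intro member_le_sum) auto
    then show ?thesis using cg[of "pr z"] by (simp add: conserved_\<sigma>)
  qed
  have anc_incr: "incr g x \<le> \<sigma> ^ n * incr g ((pr ^^ n) x)" for n
  proof (induction n)
    case (Suc n)
    have "\<sigma> ^ n * incr g ((pr ^^ n) x) \<le> \<sigma> ^ n * (\<sigma> * incr g (pr ((pr ^^ n) x)))"
      using up \<sigma>_pos by (intro mult_left_mono) auto
    with Suc show ?case by (simp add: algebra_simps)
  qed simp
  have "incr e y = incr g y - incr (cone_part g x) y" for y
    unfolding e_def by (rule incr_diff)
  moreover have "incr (cone_part g x) y \<le> incr g y" for y
  proof (cases "anc x y")
    case True
    then show ?thesis by (simp add: incr_cone_part_below)
  next
    case False
    show ?thesis
    proof (cases "anc y x")
      case True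
      then obtain n where n: "y = (pr ^^ n) x" "hgt x = hgt y + int n" by (rule ancE)
      have nz: "1 - 1 / \<sigma> \<noteq> 0" "\<sigma> \<noteq> 0" "\<sigma> powi hgt y \<noteq> 0"
        using \<sigma>_gt_1 zero_less_power_int[OF \<sigma>_pos, of "hgt y"] by (simp, linarith, linarith)
      have pw: "\<sigma> powi hgt x = \<sigma> powi hgt y * \<sigma> ^ n"
        using nz(2) unfolding n(2) by (subst power_int_add) auto
      have "incr ?K y = (1 - 1 / \<sigma>) * \<sigma> powi hgt y"
        using incr_kap_mem[OF \<sigma>_pos chain_ancestors, of y x] True by (simp add: kap_def lv_mem chain_ancestors)
      then have "incr (cone_part g x) y =
          incr g x / ((1 - 1 / \<sigma>) * (\<sigma> powi hgt y * \<sigma> ^ n)) * ((1 - 1 / \<sigma>) * \<sigma> powi hgt y)"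
        using incr_cone_part_off[of x y g] False by (simp only: pw simp_thms)
      also have "\<dots> = incr g x / \<sigma> ^ n" using nz by (simp del: power_int_eq_0_iff)
      also have "\<dots> \<le> incr g y"
        using anc_incr[of n] \<sigma>_pos unfolding n(1) by (simp add: divide_le_eq mult.commute)
      finally show ?thesis .
    next
      case nanc: False
      then have "incr (cone_part g x) y = 0"
        using incr_cone_part_off[of x y g] False incr_kap_notmem[OF chain_ancestors, of y x] by simp
      then show ?thesis using D[of y] by simp
    qed
  qed
  ultimately have e_mono: "0 \<le> incr e y" for y by (metis diff_ge_0_iff_ge)
  \<comment> \<open>Beyond this n the ancestor lies outside the cone of x, where only the
    \<open>kap\<close> term is subtracted from the non-negative g; that term tends to zero.\<close>
  have low: "- (?c * ?K ((pr ^^ n) y)) \<le> e y" if "hgt y - hgt x < int n" for n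
  proof -
    have "\<not> anc x ((pr ^^ n) y)" using anc_hgt[of x "(pr ^^ n) y"] that by auto
    then have "- (?c * ?K ((pr ^^ n) y)) \<le> e ((pr ^^ n) y)"
      using g0[of "(pr ^^ n) y"] by (simp add: e_def cone_part_def)
    also have "\<dots> \<le> e y" by (rule pow_le_of_incr_nonneg[OF e_mono])
    finally show ?thesis .
  qed
  have "(\<lambda>n. - (?c * ?K ((pr ^^ n) y))) \<longlonglongrightarrow> - 0"
    by (intro tendsto_minus tendsto_mult_right_zero kap_tendsto_0 \<sigma>_gt_1)
  then have "- 0 \<le> e y"
  proof (rule LIMSEQ_le_const2)
    show "\<exists>N. \<forall>n\<ge>N. - (?c * ?K ((pr ^^ n) y)) \<le> e y"
      by (rule exI[of _ "nat (hgt y - hgt x) + 1"]) (intro allI impI low, linarith)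
  qed
  then show ?thesis by (simp add: e_def)
qed

text \<open>C is the set of vertices whose cone has positive measure. Minimality forces the whole
  mass into the cone of each vertex of C, so C cannot branch.\<close>

theorem tree_minimal_cases:
  assumes "tree_minimal f"
  defines "C \<equiv> {x. 0 < incr (\<lambda>x. f x / \<psi> x) x}"
  shows "C = {} \<and> f = \<psi> \<or> line C \<and> f = martin_line C"
proof -
  define g where "g x = f x / \<psi> x" for x
  have f: "\<And>x. harm_at f x" "\<And>x. 0 \<le> f x" "f rt = 1"
    "\<And>g. (\<And>x. harm_at g x) \<Longrightarrow> (\<And>x. 0 \<le> g x) \<Longrightarrow> (\<And>x. g x \<le> f x) \<Longrightarrow> \<exists>c. \<forall>x. g x = c * f x"
    using assms(1) unfolding tree_minimal_def by blast+
  have C: "C = {x. 0 < incr g x}" by (simp add: C_def g_def[abs_def])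
  have f_g: "f x = \<psi> x * g x" for x by (simp add: g_def)
  have cg: "conserved \<rho> g x" for x using f(1)[of x] unfolding harm_at_iff g_def .
  have g0: "0 \<le> g x" for x using f(2)[of x] \<psi>_pos[of x] by (simp add: g_def)
  have D: "0 \<le> incr g x" for x using \<rho>_ge_1 cg g0 by (rule incr_nonneg)
  \<comment> \<open>Up to the factor \<psi> the cone part is a harmonic minorant of f, hence a
    multiple of f; equal nonzero increments at x make the multiple 1.\<close>
  have part: "cone_part g x = g" if "x \<in> C" for x
  proof -
    have "\<exists>c. \<forall>y. \<psi> y * cone_part g x y = c * f y"
    proof (rule f(4))
      show "harm_at (\<lambda>y. \<psi> y * cone_part g x y) y" for y
        by (intro harm_at_\<psi>_mult conserved_cone_part cg)
      show "0 \<le> \<psi> y * cone_part g x y" for y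
        using cone_part_nonneg[OF D] \<psi>_pos[of y] by simp
      show "\<psi> y * cone_part g x y \<le> f y" for y
        unfolding f_g using cone_part_le[OF cg D g0] \<psi>_pos[of y] by simp
    qed
    then obtain c where "\<And>y. \<psi> y * cone_part g x y = c * f y" by blast
    then have c: "cone_part g x y = c * g y" for y by (simp add: g_def field_simps)
    then have "incr g x = c * incr g x"
      using incr_cone_part_self[of g x] by (simp add: incr_def right_diff_distrib)
    then have "c = 1" using that by (simp add: C)
    with c show ?thesis by (simp add: fun_eq_iff)
  qed
  show ?thesis
  proof (cases "C = {}")
    case True
    then have "incr g x = 0" for x using D[of x] by (auto simp: C order.order_iff_strict)
    then have "g x = g rt" for x by (rule const_of_incr_zero)
    then have "f = \<psi>" using f(3) by (simp add: fun_eq_iff f_g)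
    with True show ?thesis by simp
  next
    case False
    \<comment> \<open>By \<open>part\<close>, g has no increment at a vertex that is neither in the
      cone of x nor an ancestor of x.\<close>
    have comparable: "anc x y \<or> anc y x" if "x \<in> C" "y \<in> C" for x y
    proof (rule ccontr)
      assume n: "\<not> (anc x y \<or> anc y x)"
      then have "incr (cone_part g x) y = 0"
        using incr_cone_part_off[of x y g] incr_kap_notmem[OF chain_ancestors, of y x] by simp
      then show False using part[OF that(1)] that(2) by (simp add: C)
    qed
    have chain: "chain C"
      unfolding chain_def
    proof (intro conjI ballI impI)
      show "pr x \<in> C" if "x \<in> C" for x
      proof -
        have "incr g x \<le> (\<Sum>y\<in>children (pr x). incr g y)"
          using D by (intro member_le_sum) auto
        then have "0 < \<sigma> * incr g (pr x)" using that cg[of "pr x"] by (simp add: C conserved_\<sigma>)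
        then show ?thesis using \<sigma>_pos unfolding C by (simp only: zero_less_mult_pos mem_Collect_eq)
      qed
      show "x = y" if "x \<in> C" "y \<in> C" "hgt x = hgt y" for x y
        using comparable[OF that(1,2)] that(3) anc_eqI[of x y y] anc_eqI[of y x x] by auto
    qed (fact False)
    have line: "line C"
      unfolding line_def
    proof (intro conjI ballI chain)
      fix x assume "x \<in> C"
      then have "(\<Sum>y\<in>children x. incr g y) \<noteq> 0"
        using cg[of x] \<sigma>_pos by (simp add: C conserved_\<sigma>)
      then obtain y where "y \<in> children x" "incr g y \<noteq> 0" by (meson sum.neutral)
      then have "y \<in> C" "pr y = x" using D[of y] by (auto simp: C)
      then show "\<exists>y\<in>C. pr y = x" by blast
    qed
    have "g y = kap \<sigma> C y / kap \<sigma> C rt" for y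
    proof -
      \<comment> \<open>With x beyond the heights of y and of the root, one coefficient serves for
        both, and \<open>lv_ancestors\<close> replaces the ancestors of x by C.\<close>
      obtain x where x: "x \<in> C" "\<bar>hgt y\<bar> + 1 \<le> hgt x" using line_ex_hgt[OF line] by blast
      let ?c = "incr g x / ((1 - 1 / \<sigma>) * \<sigma> powi hgt x)"
      have "g z = ?c * kap \<sigma> C z" if "hgt z < hgt x" for z
      proof -
        have "\<not> anc x z" using anc_hgt[of x z] that by auto
        moreover have "lv {w. anc w x} z = lv C z"
          using lv_le_hgt[of C z] that by (intro lv_ancestors[OF chain x(1)]) simp
        ultimately show ?thesis
          using arg_cong[OF part[OF x(1)], of "\<lambda>f. f z"] by (simp add: cone_part_def kap_def)
      qed
      then have "g y = ?c * kap \<sigma> C y" "g rt = ?c * kap \<sigma> C rt" using x(2) by auto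
      moreover have "g rt = 1" using f(3) by (simp add: g_def)
      ultimately have "g y = ?c * kap \<sigma> C y" "1 = ?c * kap \<sigma> C rt" by auto
      then have "g y * (?c * kap \<sigma> C rt) = ?c * kap \<sigma> C y" by (metis mult.right_neutral)
      moreover have "?c \<noteq> 0" using \<open>1 = ?c * kap \<sigma> C rt\<close> by (metis mult_zero_left zero_neq_one)
      ultimately have "g y * kap \<sigma> C rt = kap \<sigma> C y" by (metis mult.left_commute mult_left_cancel)
      then show ?thesis using kap_pos[OF \<sigma>_pos, of C rt] by (simp add: eq_divide_eq)
    qed
    then have "f = martin_line C" by (simp add: fun_eq_iff f_g martin_line_def)
    with line show ?thesis by simp
  qed
qed

text \<open>In the driftless case \<psi> is 1, so boundedness above and below acts on f itself and
  leaves no increment.\<close>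

lemma harm_const_of_bounded:
  assumes "a = 1 / 2" "\<And>x. harm_at f x" "\<And>x. 0 \<le> f x" "\<And>x. f x \<le> B"
  shows "f x = f y"
proof (rule const_of_incr_zero)
  have \<psi>1: "\<psi> x = 1" for x using assms(1) by (simp add: \<psi>_def)
  have cf: "conserved \<rho> f x" for x using assms(2)[of x] unfolding harm_at_iff \<psi>1 by simp
  show "incr f y = 0" for y
    using incr_nonpos_of_bounded[OF \<rho>_ge_1 cf assms(4)] incr_nonneg[OF \<rho>_ge_1 cf assms(3)] by (meson antisym)
qed

text \<open>Such a measure charges every cone, whereas a line misses at least one child of each
  vertex.\<close>

lemma not_tree_minimal_growing:
  assumes "\<And>x. 0 < incr (\<lambda>x. f x / \<psi> x) x"
  shows "\<not> tree_minimal f"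
proof
  assume "tree_minimal f"
  moreover have "{x. 0 < incr (\<lambda>x. f x / \<psi> x) x} = UNIV" using assms by blast
  ultimately have "line UNIV" using tree_minimal_cases[of f] by auto
  then show False using children_not_subset_chain[OF line_chain] by blast
qed

end

section \<open>Geodesics, rays and ends\<close>

locale tree_with_end =
  fixes T :: "'a rooted_tree" and q :: nat
  assumes q_ge_2: "2 \<le> q" and tree: "homogeneous_tree q (adj T)" and ref_end: "ref_end T \<in> ends T"
begin

abbreviation "E \<equiv> adj T"
abbreviation "d \<equiv> tdist T"
abbreviation "rt \<equiv> origin T"

section \<open>Distances in a tree\<close>

lemma adj_sym: "E x y \<Longrightarrow> E y x"
  using tree unfolding homogeneous_tree_def by (elim conjE) (rule sympD)

lemma adj_irrefl [simp]: "\<not> E x x"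
  using tree unfolding homogeneous_tree_def by (elim conjE) (rule irreflpD)

lemma connected: "E\<^sup>*\<^sup>* x y"
proof -
  have "\<forall>x y. E\<^sup>*\<^sup>* x y"
    using tree unfolding homogeneous_tree_def by (elim conjE)
  then show ?thesis by blast
qed

lemma no_cycle:
  assumes "3 \<le> length xs" "distinct xs" "successively E xs"
  shows "\<not> E (last xs) (hd xs)"
proof
  assume "E (last xs) (hd xs)"
  with assms have "3 \<le> length xs \<and> distinct xs \<and> successively E xs \<and> E (last xs) (hd xs)"
    by (intro conjI)
  moreover have "\<nexists>xs. 3 \<le> length xs \<and> distinct xs \<and> successively E xs \<and> E (last xs) (hd xs)"
    using tree unfolding homogeneous_tree_def by (elim conjE)
  ultimately show False by (elim notE) (rule exI)
qed

lemma card_neighbours: "card {y. E x y} = q + 1"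
proof -
  have "\<forall>x. card {y. E x y} = q + 1"
    using tree unfolding homogeneous_tree_def by (elim conjE)
  then show ?thesis ..
qed

lemma finite_neighbours [simp]: "finite {y. E x y}"
  using card_neighbours[of x] by (intro card_ge_0_finite) auto

lemma relpowp_dist: "(E ^^ d x y) x y"
proof -
  obtain n where "(E ^^ n) x y" using connected[of x y] by (auto simp: rtranclp_power)
  then show ?thesis unfolding tdist_def by (rule LeastI[of "\<lambda>n. (E ^^ n) x y"])
qed

lemma dist_le: "(E ^^ n) x y \<Longrightarrow> d x y \<le> n"
  unfolding tdist_def by (rule Least_le[of "\<lambda>n. (E ^^ n) x y"])

lemma dist_self [simp]: "d x x = 0"
  using dist_le[of 0 x x] by simp

lemma dist_0_iff [simp]: "d x y = 0 \<longleftrightarrow> x = y"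
  using relpowp_dist[of x y] by auto

lemma relpowp_sym: "(E ^^ n) x y \<Longrightarrow> (E ^^ n) y x"
proof (induction n arbitrary: x)
  case (Suc n)
  then obtain z where z: "E x z" "(E ^^ n) z y" by (meson relpowp_Suc_D2)
  show ?case by (rule relpowp_Suc_I[OF Suc.IH[OF z(2)] adj_sym[OF z(1)]])
qed simp

lemma dist_sym: "d x y = d y x"
  by (rule antisym; rule dist_le, rule relpowp_sym, rule relpowp_dist)

lemma dist_triangle: "d x z \<le> d x y + d y z"
  by (rule dist_le, unfold relpowp_add, rule relcomppI) (rule relpowp_dist)+

lemma dist_adj: "E x y \<Longrightarrow> d x y = 1"
  using dist_le[of 1 x y] dist_0_iff[of x y] by (metis One_nat_def adj_irrefl le_SucE le_zero_eq relpowp_1)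

lemma dist_1D: "d x y = 1 \<Longrightarrow> E x y"
  using relpowp_dist[of x y] by (simp add: relpowp_1[unfolded One_nat_def] del: relpowp.simps)

lemma dist_adj_le: "E x y \<Longrightarrow> d x z \<le> Suc (d y z)"
  using dist_triangle[of x z y] dist_adj[of x y] by simp

lemma ex_closer:
  assumes "x \<noteq> z"
  shows "\<exists>y. E x y \<and> d x z = Suc (d y z)"
proof -
  obtain n where n: "d x z = Suc n" using assms by (metis dist_0_iff not0_implies_Suc)
  then obtain y where y: "E x y" "(E ^^ n) y z"
    using relpowp_dist[of x z] by (metis relpowp_Suc_D2)
  then have "d y z \<le> n" by (intro dist_le)
  then have "d x z = Suc (d y z)" using dist_adj_le[OF y(1), of z] n by simp
  with y show ?thesis by blast
qed

text \<open>Loop erasure, one step at a time: if the new first vertex already occurs on the path,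
  the part before that occurrence is dropped.\<close>

lemma distinct_path_of_rtranclp:
  assumes "(\<lambda>u v. E u v \<and> u \<noteq> x \<and> v \<noteq> x)\<^sup>*\<^sup>* y z" "z \<noteq> x"
  shows "\<exists>xs. xs \<noteq> [] \<and> distinct xs \<and> successively E xs \<and> hd xs = y \<and> last xs = z \<and> x \<notin> set xs"
  using assms
proof (induction rule: converse_rtranclp_induct)
  case base
  then show ?case by (intro exI[of _ "[z]"]) auto
next
  case (step y u)
  then obtain xs where xs: "xs \<noteq> []" "distinct xs" "successively E xs" "hd xs = u" "last xs = z" "x \<notin> set xs"
    by blast
  show ?case
  proof (cases "y \<in> set xs")
    case True
    then obtain as bs where "xs = as @ y # bs" by (meson split_list)
    with xs show ?thesis
      by (intro exI[of _ "y # bs"]) (auto simp: successively_append_iff)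
  next
    case False
    with xs step show ?thesis
      by (intro exI[of _ "y # xs"]) (auto simp: successively_Cons)
  qed
qed

text \<open>After its first step, a geodesic from y to z is strictly closer to z than x is, so it
  cannot meet x.\<close>

lemma walk_avoiding:
  assumes "d y z \<le> d x z" "y \<noteq> x" "z \<noteq> x"
  shows "(\<lambda>u v. E u v \<and> u \<noteq> x \<and> v \<noteq> x)\<^sup>*\<^sup>* y z"
  using assms
proof (induction "d y z" arbitrary: y)
  case (Suc n)
  then obtain u where u: "E y u" "d y z = Suc (d u z)" using ex_closer[of y z] by (metis Zero_not_Suc dist_self)
  then have "u \<noteq> x" using Suc.prems by auto
  then have "(\<lambda>u v. E u v \<and> u \<noteq> x \<and> v \<noteq> x)\<^sup>*\<^sup>* u z" using Suc u by auto
  then show ?case using u \<open>u \<noteq> x\<close> Suc.prems by (intro converse_rtranclp_into_rtranclp[of _ y u]) auto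
qed auto

text \<open>Both neighbours reach z without meeting x; joined, these paths and x would close a
  cycle. The weak inequalities also cover a neighbour at equal distance, as
  \<open>dist_adj_cases\<close> requires.\<close>

lemma not_two_closer:
  assumes "E x y" "E x y'" "d y z \<le> d x z" "d y' z \<le> d x z"
  shows "y = y'"
proof (rule ccontr)
  assume ne: "y \<noteq> y'"
  have yx: "y \<noteq> x" "y' \<noteq> x" using assms(1,2) by auto
  have zx: "z \<noteq> x" using assms(3) yx by auto
  let ?E = "\<lambda>u v. E u v \<and> u \<noteq> x \<and> v \<noteq> x"
  have "symp ?E" using adj_sym by (auto simp: symp_def)
  then have "?E\<^sup>*\<^sup>* z y'"
    using walk_avoiding[OF assms(4) yx(2) zx] by (metis (no_types, lifting) symp_rtranclp sympD)
  then have "?E\<^sup>*\<^sup>* y y'" using walk_avoiding[OF assms(3) yx(1) zx] by (rule rtranclp_trans[rotated])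
  then obtain xs where xs: "xs \<noteq> []" "distinct xs" "successively E xs" "hd xs = y" "last xs = y'" "x \<notin> set xs"
    using distinct_path_of_rtranclp yx(2) by blast
  have "length xs \<noteq> 1" using xs ne by (cases xs) auto
  then have "3 \<le> length (x # xs)" using xs(1) by (cases xs) (auto simp: Suc_le_eq)
  moreover have "distinct (x # xs)" "successively E (x # xs)" "E (last (x # xs)) (hd (x # xs))"
    using xs assms(1,2) adj_sym by (auto simp: successively_Cons)
  ultimately show False using no_cycle by blast
qed

lemma dist_adj_cases:
  assumes "E x y"
  shows "d x z = Suc (d y z) \<or> d y z = Suc (d x z)"
proof (cases "d x z = d y z")
  case True
  then have "x \<noteq> z" using assms by auto
  then obtain u where "E x u" "d x z = Suc (d u z)" using ex_closer by blast
  with not_two_closer[OF assms, of u z] True show ?thesis by auto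
next
  case False
  then show ?thesis using dist_adj_le[OF assms, of z] dist_adj_le[OF adj_sym[OF assms], of z] by linarith
qed

lemma unique_closer:
  "E x y \<Longrightarrow> E x y' \<Longrightarrow> d x z = Suc (d y z) \<Longrightarrow> d x z = Suc (d y' z) \<Longrightarrow> y = y'"
  by (rule not_two_closer[of x y y' z]) auto

section \<open>Geodesics and rays\<close>

lemma path_dist_le:
  fixes \<gamma> :: "nat \<Rightarrow> 'a"
  assumes "\<And>i. i < n \<Longrightarrow> E (\<gamma> i) (\<gamma> (Suc i))" "i \<le> j" "j \<le> n"
  shows "d (\<gamma> i) (\<gamma> j) \<le> j - i"
  using assms(2,3)
proof (induction rule: dec_induct)
  case (step k)
  have "d (\<gamma> i) (\<gamma> (Suc k)) \<le> d (\<gamma> i) (\<gamma> k) + d (\<gamma> k) (\<gamma> (Suc k))" by (rule dist_triangle)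
  then show ?case using step assms(1)[of k] by (simp add: dist_adj)
qed simp

lemma geodesic_onI:
  assumes "\<And>i. i < n \<Longrightarrow> E (\<gamma> i) (\<gamma> (Suc i))" "\<And>i. i \<le> n \<Longrightarrow> d (\<gamma> 0) (\<gamma> i) = i"
  shows "geodesic_on T {..n} \<gamma>"
proof -
  have *: "d (\<gamma> i) (\<gamma> j) = j - i" if "i \<le> j" "j \<le> n" for i j
    using path_dist_le[of n \<gamma> i j] assms(1) that dist_triangle[of "\<gamma> 0" "\<gamma> j" "\<gamma> i"] assms(2)[of i] assms(2)[of j] that by simp
  show ?thesis unfolding geodesic_on_def
  proof (intro ballI)
    fix i j assume "i \<in> {..n}" "j \<in> {..n}"
    then show "int (d (\<gamma> i) (\<gamma> j)) = \<bar>int i - int j\<bar>"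
      using *[of i j] *[of j i] dist_sym[of "\<gamma> i" "\<gamma> j"] by (cases "i \<le> j") auto
  qed
qed

lemma ray_iff_geodesic: "ray T R \<longleftrightarrow> (\<forall>n. geodesic_on T {..n} R)"
proof
  assume R: "\<forall>n. geodesic_on T {..n} R"
  show "ray T R" unfolding ray_def geodesic_on_def
  proof (intro ballI)
    fix m n
    show "int (d (R m) (R n)) = \<bar>int m - int n\<bar>"
      using R[rule_format, of "max m n"] unfolding geodesic_on_def by simp
  qed
qed (auto simp: ray_def geodesic_on_def)

lemma rayI: "(\<And>i. E (R i) (R (Suc i))) \<Longrightarrow> (\<And>i. d (R 0) (R i) = i) \<Longrightarrow> ray T R"
  by (auto simp: ray_iff_geodesic intro: geodesic_onI)

lemma ray_dist: "ray T R \<Longrightarrow> d (R m) (R n) = nat \<bar>int m - int n\<bar>"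
  unfolding ray_def geodesic_on_def by (metis UNIV_I nat_int)

lemma ray_adj: "ray T R \<Longrightarrow> E (R n) (R (Suc n))"
  by (intro dist_1D) (simp add: ray_dist)

lemma ray_inj: "ray T R \<Longrightarrow> inj R"
proof (rule injI)
  fix m n assume "ray T R" "R m = R n"
  then show "m = n" using ray_dist[of R m n] by simp
qed

lemma ex_geodesic: "\<exists>\<gamma>. \<gamma> 0 = x \<and> \<gamma> (d x y) = y \<and> geodesic_on T {..d x y} \<gamma>"
proof -
  obtain \<gamma> where \<gamma>: "\<gamma> 0 = x" "\<gamma> (d x y) = y" "\<forall>i<d x y. E (\<gamma> i) (\<gamma> (Suc i))"
    using relpowp_dist[of x y] by (auto simp: relpowp_fun_conv)
  have "d (\<gamma> 0) (\<gamma> i) = i" if "i \<le> d x y" for i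
    using path_dist_le[of "d x y" \<gamma> 0 i] path_dist_le[of "d x y" \<gamma> i "d x y"] \<gamma> that
      dist_triangle[of x y "\<gamma> i"] by auto
  with \<gamma> show ?thesis by (blast intro: geodesic_onI)
qed

lemma geodesic_dist: "geodesic_on T {..n} \<gamma> \<Longrightarrow> i \<le> n \<Longrightarrow> j \<le> n \<Longrightarrow> d (\<gamma> i) (\<gamma> j) = nat \<bar>int i - int j\<bar>"
  unfolding geodesic_on_def by (metis atMost_iff nat_int)

lemma geodesic_adj: "geodesic_on T {..n} \<gamma> \<Longrightarrow> i < n \<Longrightarrow> E (\<gamma> i) (\<gamma> (Suc i))"
  by (intro dist_1D) (simp add: geodesic_dist)

lemma geodesic_on_mono: "geodesic_on T I \<gamma> \<Longrightarrow> J \<subseteq> I \<Longrightarrow> geodesic_on T J \<gamma>"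
  unfolding geodesic_on_def by blast

lemma geodesic_unique:
  assumes "geodesic_on T {..n} \<gamma>" "geodesic_on T {..n} \<gamma>'" "\<gamma> 0 = \<gamma>' 0" "\<gamma> n = \<gamma>' n" "i \<le> n"
  shows "\<gamma> i = \<gamma>' i"
  using assms(5)
proof (induction rule: inc_induct)
  case (step m)
  show ?case
  proof (rule unique_closer[of "\<gamma> (Suc m)" _ _ "\<gamma> 0"])
    show "E (\<gamma> (Suc m)) (\<gamma> m)" using geodesic_adj[OF assms(1)] step adj_sym by blast
    show "E (\<gamma> (Suc m)) (\<gamma>' m)" unfolding step.IH using geodesic_adj[OF assms(2)] step adj_sym by blast
    show "d (\<gamma> (Suc m)) (\<gamma> 0) = Suc (d (\<gamma> m) (\<gamma> 0))"
      using geodesic_dist[OF assms(1), of "Suc m" 0] geodesic_dist[OF assms(1), of m 0] step by simp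
    show "d (\<gamma> (Suc m)) (\<gamma> 0) = Suc (d (\<gamma>' m) (\<gamma> 0))"
      unfolding step.IH assms(3)
      using geodesic_dist[OF assms(2), of "Suc m" 0] geodesic_dist[OF assms(2), of m 0] step by simp
  qed
qed (use assms in simp)

lemma segment_eq:
  assumes "geodesic_on T {..n} \<gamma>" "\<gamma> 0 = x" "\<gamma> n = y"
  shows "segment T x y = \<gamma> ` {..n}"
  unfolding segment_def
proof (rule the_equality)
  fix S assume "\<exists>\<gamma> n. geodesic_on T {..n} \<gamma> \<and> \<gamma> 0 = x \<and> \<gamma> n = y \<and> S = \<gamma> ` {..n}"
  then obtain \<gamma>' n' where *: "geodesic_on T {..n'} \<gamma>'" "\<gamma>' 0 = x" "\<gamma>' n' = y" "S = \<gamma>' ` {..n'}" by blast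
  have "n' = n"
    using geodesic_dist[OF assms(1), of 0 n] geodesic_dist[OF *(1), of 0 n'] assms * by simp
  then have "\<gamma> i = \<gamma>' i" if "i \<le> n" for i
    using geodesic_unique[OF assms(1) _ _ _ that] * assms by simp
  then show "S = \<gamma> ` {..n}" using * \<open>n' = n\<close> by auto
qed (use assms in blast)

section \<open>Ends and confluents\<close>

lemma equiv_ray_equiv: "equiv {R. ray T R} (ray_equiv T)"
proof (intro equivI)
  show "refl_on {R. ray T R} (ray_equiv T)" by (auto simp: refl_on_def ray_equiv_def)
  show "sym (ray_equiv T)" by (auto simp: sym_def ray_equiv_def)
  show "trans (ray_equiv T)"
  proof (rule transI)
    fix R S U assume "(R, S) \<in> ray_equiv T" "(S, U) \<in> ray_equiv T"
    then show "(R, U) \<in> ray_equiv T"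
      unfolding ray_equiv_def
      by (auto intro: finite_subset[of "range R - range U" "(range R - range S) \<union> (range S - range U)"]
          finite_subset[of "range U - range R" "(range U - range S) \<union> (range S - range R)"])
  qed
  show "ray_equiv T \<subseteq> {R. ray T R} \<times> {R. ray T R}" by (auto simp: ray_equiv_def)
qed

lemma end_memD:
  assumes "\<xi> \<in> ends T" "R \<in> \<xi>"
  shows "ray T R" "\<xi> = ray_equiv T `` {R}"
proof -
  obtain Q where Q: "\<xi> = ray_equiv T `` {Q}"
    using assms(1) unfolding ends_def by (rule quotientE)
  then have "(Q, R) \<in> ray_equiv T" using assms(2) by simp
  then show "\<xi> = ray_equiv T `` {R}"
    unfolding Q by (rule equiv_class_eq[OF equiv_ray_equiv])
  show "ray T R" using assms equiv_ray_equiv unfolding ends_def by (metis in_quotient_imp_subset mem_Collect_eq subsetD)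
qed

lemma end_nonempty: "\<xi> \<in> ends T \<Longrightarrow> \<exists>R. R \<in> \<xi>"
  using equiv_ray_equiv unfolding ends_def by (metis ex_in_conv in_quotient_imp_non_empty)

text \<open>The index of a vertex on a ray is its distance from the start, so the rays share
  vertices of equal index arbitrarily far out; uniqueness of geodesics does the rest.\<close>

lemma ray_equiv_same_start:
  assumes "(R, S) \<in> ray_equiv T" "R 0 = S 0"
  shows "R = S"
proof
  fix n
  have R: "ray T R" and S: "ray T S" and fin: "finite (range R - range S)"
    using assms(1) by (auto simp: ray_equiv_def)
  have "finite {m. R m \<notin> range S}"
    by (rule finite_subset[OF _ finite_vimageI[OF fin ray_inj[OF R]]]) auto
  then obtain b where b: "\<forall>m\<in>{m. R m \<notin> range S}. m < b"
    unfolding finite_nat_set_iff_bounded by blast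
  define m where "m = max (Suc n) b"
  have m: "n < m" "R m \<in> range S" using b by (auto simp: m_def)
  then obtain k where k: "R m = S k" by blast
  have "m = d (R 0) (R m)" by (simp add: ray_dist[OF R])
  also have "\<dots> = d (S 0) (S k)" by (simp only: assms(2) k)
  also have "\<dots> = k" by (simp add: ray_dist[OF S])
  finally have "R m = S m" using k by simp
  then show "R n = S n"
    using R S m assms(2) by (intro geodesic_unique[of m R S n]) (auto simp: ray_iff_geodesic)
qed

lemma antimono_int_eventually_const:
  fixes f :: "nat \<Rightarrow> int"
  assumes "\<And>n. f (Suc n) \<le> f n" "\<And>n. c \<le> f n"
  shows "\<exists>N. \<forall>n\<ge>N. f n = f N"
proof -
  have mono: "f n \<le> f m" if "m \<le> n" for m n
    using assms(1) that by (rule lift_Suc_antimono_le)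
  obtain N where N: "\<And>n. nat (f N - c) \<le> nat (f n - c)"
    using ex_has_least_nat[of "\<lambda>_. True" _ "\<lambda>n. nat (f n - c)"] by blast
  then show ?thesis using mono assms(2) by (intro exI[of _ N]) (smt (verit) nat_le_eq_zle)
qed

text \<open>The integer sequence is non-increasing along the ray and bounded below by the triangle
  inequality. Its final value gives the height.\<close>

lemma ray_dist_eventually:
  assumes "ray T R"
  shows "\<exists>N. \<forall>n\<ge>N. int (d x (R n)) - int n = int (d x (R N)) - int N"
proof (rule antimono_int_eventually_const)
  show "int (d x (R (Suc n))) - int (Suc n) \<le> int (d x (R n)) - int n" for n
    using dist_adj_le[OF adj_sym[OF ray_adj[OF assms, of n]], of x] dist_sym by simp
  show "- int (d x (R 0)) \<le> int (d x (R n)) - int n" for n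
    using dist_triangle[of "R 0" "R n" x] ray_dist[OF assms, of 0 n] dist_sym[of x "R 0"] by simp
qed

text \<open>Past N each step of Q moves away from x, so the geodesic from x to \<open>Q N\<close>
  continued by the tail of Q is again a ray.\<close>

lemma ex_ray_from:
  assumes "\<xi> \<in> ends T"
  shows "\<exists>R. R \<in> \<xi> \<and> R 0 = x"
proof -
  obtain Q where Q: "Q \<in> \<xi>" using end_nonempty[OF assms] by blast
  note rQ = end_memD(1)[OF assms Q]
  obtain N where N: "\<And>n. n \<ge> N \<Longrightarrow> int (d x (Q n)) - int n = int (d x (Q N)) - int N"
    using ray_dist_eventually[OF rQ] by blast
  obtain \<gamma> where \<gamma>: "\<gamma> 0 = x" "\<gamma> (d x (Q N)) = Q N" "geodesic_on T {..d x (Q N)} \<gamma>"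
    using ex_geodesic by blast
  let ?k = "d x (Q N)"
  define R where "R i = (if i \<le> ?k then \<gamma> i else Q (i - ?k + N))" for i
  have R0: "R 0 = x" using \<gamma> by (simp add: R_def)
  have "E (R i) (R (Suc i))" for i
  proof -
    consider "i < ?k" | "i = ?k" | "?k < i" by linarith
    then show ?thesis
    proof cases
      case 1 then show ?thesis using geodesic_adj[OF \<gamma>(3)] by (simp add: R_def)
    next
      case 2 then show ?thesis using \<gamma>(2) ray_adj[OF rQ, of N] by (simp add: R_def)
    next
      case 3 then show ?thesis using ray_adj[OF rQ, of "i - ?k + N"] by (simp add: R_def Suc_diff_le)
    qed
  qed
  moreover have "d (R 0) (R i) = i" for i
    using geodesic_dist[OF \<gamma>(3), of 0 i] N[of "i - ?k + N"] \<gamma>(1) by (auto simp: R_def)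
  ultimately have rR: "ray T R" by (rule rayI)
  have "range R - range Q \<subseteq> R ` {..?k}" by (auto simp: R_def)
  moreover have "range Q - range R \<subseteq> Q ` {..N}"
  proof
    fix z assume "z \<in> range Q - range R"
    then obtain n where n: "z = Q n" "Q n \<notin> range R" by blast
    have "n \<le> N"
    proof (rule ccontr)
      assume "\<not> n \<le> N"
      then have "\<not> n - N + ?k \<le> ?k" "n - N + ?k - ?k + N = n" by auto
      then have "R (n - N + ?k) = Q n" by (simp only: R_def if_False simp_thms)
      with n show False by (metis rangeI)
    qed
    with n show "z \<in> Q ` {..N}" by simp
  qed
  ultimately have "(Q, R) \<in> ray_equiv T"
    using rQ rR finite_subset[of "range R - range Q"] finite_subset[of "range Q - range R"]
    by (simp add: ray_equiv_def)
  then show ?thesis using R0 end_memD(2)[OF assms Q] by blast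
qed

lemma the_ray_from:
  assumes "\<xi> \<in> ends T" "R \<in> \<xi>" "R 0 = x"
  shows "(THE S. S \<in> \<xi> \<and> S 0 = x) = R"
proof (rule the_equality)
  fix S assume S: "S \<in> \<xi> \<and> S 0 = x"
  then have "(R, S) \<in> ray_equiv T" using end_memD(2)[OF assms(1,2)] by blast
  then show "S = R" using ray_equiv_same_start S assms(3) by metis
qed (use assms in auto)

lemma ray_to_eq: "\<xi> \<in> ends T \<Longrightarrow> R \<in> \<xi> \<Longrightarrow> R 0 = x \<Longrightarrow> ray_to T x \<xi> = range R"
  unfolding ray_to_def by (simp add: the_ray_from)

text \<open>The confluent is the last vertex that the geodesic to x shares with the ray S. Without
  cycles, every geodesic from x to a later vertex of S passes through it.\<close>

lemma confluent_on_geodesic: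
  assumes "\<xi> \<in> ends T" "S \<in> \<xi>" "S 0 = rt"
  shows "\<exists>j. confluent T x \<xi> = S j \<and> (\<forall>t\<ge>j. d x (S t) = d x (S j) + d (S j) (S t))"
proof -
  note rS = end_memD(1)[OF assms(1,2)]
  obtain \<gamma> where \<gamma>: "\<gamma> 0 = rt" "\<gamma> (d rt x) = x" "geodesic_on T {..d rt x} \<gamma>"
    using ex_geodesic by blast
  let ?n = "d rt x"
  \<comment> \<open>Both paths are geodesics from the root, so they can meet only at equal
    indices.\<close>
  have idx: "i = k" if "\<gamma> i = S k" "i \<le> ?n" for i k
    using geodesic_dist[OF \<gamma>(3), of 0 i] ray_dist[OF rS, of 0 k] that assms(3) \<gamma>(1) by simp
  define J where "J = {i. i \<le> ?n \<and> \<gamma> i = S i}"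
  have J: "finite J" "0 \<in> J" using assms \<gamma> by (auto simp: J_def)
  define j where "j = Max J"
  have j: "j \<in> J" "\<And>i. i \<in> J \<Longrightarrow> i \<le> j"
    using J unfolding j_def by (auto intro: Max_in Max_ge)
  then have jn: "j \<le> ?n" "\<gamma> j = S j" by (auto simp: J_def)
  have gS: "geodesic_on T {..j} S" using rS by (simp add: ray_iff_geodesic)
  have g\<gamma>: "geodesic_on T {..j} \<gamma>" using \<gamma>(3) jn by (auto intro: geodesic_on_mono)
  have eq: "\<gamma> i = S i" if "i \<le> j" for i
    using geodesic_unique[OF g\<gamma> gS _ _ that] jn assms \<gamma> by simp
  have inter: "segment T rt x \<inter> ray_to T rt \<xi> = S ` {..j}"
  proof -
    have "\<gamma> ` {..?n} \<inter> range S = S ` {..j}"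
    proof (intro equalityI subsetI)
      fix z assume "z \<in> \<gamma> ` {..?n} \<inter> range S"
      then obtain i k where "i \<le> ?n" "z = \<gamma> i" "z = S k" by blast
      then have "i \<in> J" "z = S i" using idx[of i k] by (auto simp: J_def)
      then show "z \<in> S ` {..j}" using j by blast
    next
      fix z assume "z \<in> S ` {..j}"
      then obtain i where "i \<le> j" "z = S i" by blast
      then show "z \<in> \<gamma> ` {..?n} \<inter> range S" using eq[of i] jn by (auto intro!: image_eqI[of _ _ i])
    qed
    then show ?thesis using segment_eq[OF \<gamma>(3,1,2)] ray_to_eq[OF assms] by simp
  qed
  have segS: "segment T rt (S k) = S ` {..k}" for k
    using rS assms(3) by (intro segment_eq) (auto simp: ray_iff_geodesic)
  have conf: "confluent T x \<xi> = S j"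
    unfolding confluent_def inter
  proof (rule the_equality)
    show "S ` {..j} = segment T rt (S j)" by (simp add: segS)
    fix c assume c: "S ` {..j} = segment T rt c"
    obtain \<delta> where \<delta>: "\<delta> 0 = rt" "\<delta> (d rt c) = c" "geodesic_on T {..d rt c} \<delta>"
      using ex_geodesic by blast
    have seg: "S ` {..j} = \<delta> ` {..d rt c}" using c segment_eq[OF \<delta>(3,1,2)] by simp
    then have "c \<in> S ` {..j}" using \<delta>(2) by (metis atMost_iff image_eqI order_refl)
    then obtain k where k: "k \<le> j" "c = S k" by blast
    then have "S ` {..j} = S ` {..k}" using c segS by simp
    then have "S j \<in> S ` {..k}" by (metis atMost_iff image_eqI order_refl)
    then have "j \<le> k" using ray_inj[OF rS] by (auto dest: injD)
    with k show "c = S j" by simp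
  qed
  \<comment> \<open>Each step along the geodesic away from \<open>S j\<close> increases the distance
    to \<open>S t\<close>. A first step towards it would be \<open>S (Suc j)\<close>, against the
    maximality of j; a later one would turn back.\<close>
  have "d (\<gamma> i) (S t) = (i - j) + d (S j) (S t)" if "j \<le> t" "j \<le> i" "i \<le> ?n" for i t
    using that(2,3)
  proof (induction rule: dec_induct)
    case base
    then show ?case using jn by simp
  next
    case (step i)
    have a1: "E (\<gamma> i) (\<gamma> (Suc i))" using geodesic_adj[OF \<gamma>(3)] step by simp
    have "d (\<gamma> i) (S t) \<noteq> Suc (d (\<gamma> (Suc i)) (S t))"
    proof
      assume closer: "d (\<gamma> i) (S t) = Suc (d (\<gamma> (Suc i)) (S t))"
      show False
      proof (cases "i = j")
        case True
        then have "j \<noteq> t" using closer jn by auto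
        then have "d (S j) (S t) = Suc (d (S (Suc j)) (S t))" using \<open>j \<le> t\<close> ray_dist[OF rS] by simp
        then have "\<gamma> (Suc j) = S (Suc j)"
          using unique_closer[of "S j" "\<gamma> (Suc j)" "S (Suc j)" "S t"] a1 True jn closer ray_adj[OF rS] by simp
        then have "Suc j \<in> J" using step True by (simp add: J_def)
        then show False using j(2) by fastforce
      next
        case False
        then obtain i' where i': "i = Suc i'" "j \<le> i'" using step by (metis le_SucE not0_implies_Suc le_zero_eq)
        have "E (\<gamma> i) (\<gamma> i')" using i' geodesic_adj[OF \<gamma>(3), of i'] step adj_sym by simp
        moreover have "d (\<gamma> i) (S t) \<noteq> Suc (d (\<gamma> i') (S t)) \<or> \<gamma> (Suc i) = \<gamma> i'"
          using unique_closer[of "\<gamma> i" "\<gamma> (Suc i)" "\<gamma> i'" "S t"] a1 closer calculation by blast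
        moreover have "\<gamma> (Suc i) \<noteq> \<gamma> i'"
          using geodesic_dist[OF \<gamma>(3), of "Suc i" i'] i' step by fastforce
        moreover have "d (\<gamma> i) (S t) = Suc (d (\<gamma> i') (S t)) \<or> d (\<gamma> i') (S t) = Suc (d (\<gamma> i) (S t))"
          using calculation(1) by (rule dist_adj_cases)
        ultimately have "d (\<gamma> i') (S t) = Suc (d (\<gamma> i) (S t))" by blast
        moreover have "d (\<gamma> i) (S t) = i - j + d (S j) (S t)" using step by simp
        moreover have "d (\<gamma> i') (S t) \<le> (i' - j) + d (S j) (S t)"
          using dist_triangle[of "\<gamma> i'" "S t" "\<gamma> j"] geodesic_dist[OF \<gamma>(3), of i' j] i' step jn by simp
        ultimately show False using i' by simp
      qed
    qed
    then have "d (\<gamma> (Suc i)) (S t) = Suc (d (\<gamma> i) (S t))" using dist_adj_cases[OF a1] by blast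
    then show ?case using step by simp
  qed
  from this[OF _ jn(1) order_refl] have "\<And>t. j \<le> t \<Longrightarrow> d x (S t) = (?n - j) + d (S j) (S t)"
    using \<gamma>(2) by simp
  moreover have "d x (S j) = ?n - j"
    using geodesic_dist[OF \<gamma>(3), of ?n j] jn \<gamma>(2) by simp
  ultimately show ?thesis using conf by (intro exI[of _ j]) simp
qed

section \<open>Heights and predecessors from the reference end\<close>

definition ref_ray :: "nat \<Rightarrow> 'a" where
  "ref_ray = (SOME R. R \<in> ref_end T)"

text \<open>The Busemann function as a limit along one chosen ray, a form in which neighbours are
  easily compared; \<open>busemann_eq\<close> links its normalisation at the root to the form
  through confluents.\<close>

definition horo :: "'a \<Rightarrow> int" where
  "horo x = (SOME c. \<forall>\<^sub>F n in sequentially. int (d x (ref_ray n)) - int n = c)"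

definition ht :: "'a \<Rightarrow> int" where
  "ht x = horo x - horo rt"

definition up :: "'a \<Rightarrow> 'a" where
  "up x = (THE y. E x y \<and> ht y = ht x - 1)"

lemma ref_ray_mem: "ref_ray \<in> ref_end T"
  unfolding ref_ray_def using end_nonempty[OF ref_end] by (rule someI_ex)

lemma ray_ref_ray: "ray T ref_ray"
  using end_memD(1)[OF ref_end ref_ray_mem] .

lemma horo_eventually: "\<forall>\<^sub>F n in sequentially. int (d x (ref_ray n)) - int n = horo x"
proof -
  obtain N where "\<forall>n\<ge>N. int (d x (ref_ray n)) - int n = int (d x (ref_ray N)) - int N"
    using ray_dist_eventually[OF ray_ref_ray, of x] by (rule exE)
  then have "\<forall>\<^sub>F n in sequentially. int (d x (ref_ray n)) - int n = int (d x (ref_ray N)) - int N"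
    unfolding eventually_sequentially by (rule exI)
  then show ?thesis unfolding horo_def
    by (rule someI[of "\<lambda>c. \<forall>\<^sub>F n in sequentially. int (d x (ref_ray n)) - int n = c"])
qed

lemma ht_rt [simp]: "ht rt = 0"
  by (simp add: ht_def)

lemma ht_adj:
  assumes "E x y"
  shows "ht y = ht x + 1 \<or> ht y = ht x - 1"
proof -
  have "\<forall>\<^sub>F n in sequentially. int (d x (ref_ray n)) - int n = horo x \<and> int (d y (ref_ray n)) - int n = horo y"
    by (intro eventually_conj horo_eventually)
  then obtain n where "int (d x (ref_ray n)) - int n = horo x" "int (d y (ref_ray n)) - int n = horo y"
    using eventually_happens'[OF sequentially_bot] by blast
  then show ?thesis using dist_adj_cases[OF assms, of "ref_ray n"] by (auto simp: ht_def)
qed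

text \<open>For large n the heights of x and of its finitely many neighbours are read off from the
  distances to the same vertex \<open>ref_ray n\<close>, and exactly one neighbour is closer to
  it.\<close>

lemma ex1_up: "\<exists>!y. E x y \<and> ht y = ht x - 1"
proof -
  have "\<forall>\<^sub>F n in sequentially. \<forall>y\<in>insert x {y. E x y}. int (d y (ref_ray n)) - int n = horo y"
    by (intro eventually_ball_finite ballI horo_eventually) simp
  \<comment> \<open>A closer neighbour exists only if x is not \<open>ref_ray n\<close> itself; the
    ray passes x at most once.\<close>
  moreover have "\<forall>\<^sub>F n in sequentially. x \<noteq> ref_ray n"
  proof -
    have "{n. x = ref_ray n} \<subseteq> {THE n. x = ref_ray n}"
      using ray_inj[OF ray_ref_ray] by (auto dest: injD intro!: the_equality[symmetric])
    then have "finite {n. x = ref_ray n}" by (rule finite_subset) simp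
    then show ?thesis by (simp add: eventually_sequentially finite_nat_set_iff_bounded)
      (metis not_le)
  qed
  ultimately have "\<forall>\<^sub>F n in sequentially. (\<forall>y\<in>insert x {y. E x y}. int (d y (ref_ray n)) - int n = horo y) \<and> x \<noteq> ref_ray n"
    by (rule eventually_conj)
  then obtain n where n: "\<And>y. y = x \<or> E x y \<Longrightarrow> int (d y (ref_ray n)) - int n = horo y" "x \<noteq> ref_ray n"
    using eventually_happens'[OF sequentially_bot] by blast
  have iff: "ht y = ht x - 1 \<longleftrightarrow> d x (ref_ray n) = Suc (d y (ref_ray n))" if "E x y" for y
    using n(1)[of x] n(1)[of y] that by (auto simp: ht_def)
  obtain y where "E x y" "d x (ref_ray n) = Suc (d y (ref_ray n))" using ex_closer[OF n(2)] by blast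
  then show ?thesis using iff unique_closer by (intro ex1I[of _ y]) auto
qed

lemma adj_up: "E x (up x)" and ht_up [simp]: "ht (up x) = ht x - 1"
  using theI'[OF ex1_up[of x]] by (auto simp: up_def)

lemma up_eqI: "E x y \<Longrightarrow> ht y = ht x - 1 \<Longrightarrow> up x = y"
  using ex1_up[of x] adj_up[of x] ht_up[of x] by blast

lemma adj_iff: "E x y \<longleftrightarrow> y = up x \<or> up y = x"
proof
  assume xy: "E x y"
  show "y = up x \<or> up y = x"
    using ht_adj[OF xy] up_eqI[OF xy] up_eqI[OF adj_sym[OF xy]] by auto
qed (auto intro: adj_up adj_sym)

lemma card_up: "card {y. up y = x} = q"
proof -
  have "{y. E x y} = insert (up x) {y. up y = x}" by (auto simp: adj_iff)
  moreover have "up (up x) \<noteq> x"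
  proof
    assume "up (up x) = x"
    from arg_cong[OF this, of ht] show False by simp
  qed
  moreover have "finite {y. up y = x}" using finite_neighbours[of x] by (rule rev_finite_subset) (auto simp: adj_iff)
  ultimately show ?thesis using card_neighbours[of x] by simp
qed

lemma up_merge: "\<exists>m n. (up ^^ m) x = (up ^^ n) y"
  using connected[of x y]
proof (induction rule: rtranclp_induct)
  case (step y z)
  then obtain m n where mn: "(up ^^ m) x = (up ^^ n) y" by blast
  from step(2) consider "z = up y" | "up z = y" by (auto simp: adj_iff)
  then show ?case
  proof cases
    case 1
    then have "(up ^^ Suc m) x = (up ^^ n) z" using mn by (simp add: funpow_swap1)
    then show ?thesis by blast
  next
    case 2
    then have "(up ^^ m) x = (up ^^ Suc n) z" using mn by (simp add: funpow_swap1)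
    then show ?thesis by blast
  qed
qed blast

sublocale P: pred_tree q up ht rt
  using q_ge_2 card_up up_merge by unfold_locales auto

section \<open>Distance and Busemann function through levels\<close>

text \<open>The right-hand side is the length of the path through the confluent. It changes by one
  along every edge, which bounds the distance from below; it vanishes only at y and can be lowered
  wherever it is positive, which bounds the distance from above.\<close>

lemma dist_eq: "int (d x y) = ht x + ht y - 2 * P.lv {z. P.anc z y} x"
proof -
  define f where "f u = ht u + ht y - 2 * P.lv {z. P.anc z y} u" for u
  note ch = P.chain_ancestors[of y]
  have f_up_mem: "f (up u) = f u + 1" if "P.anc u y" for u
  proof -
    have "P.anc (up u) y" using that P.anc_pr P.anc_trans by blast
    then show ?thesis using that by (simp add: f_def P.lv_mem[OF ch])
  qed
  have f_up_notmem: "f (up u) = f u - 1" if "\<not> P.anc u y" for u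
    using that by (simp add: f_def P.lv_pr[OF ch])
  have f_nonneg: "0 \<le> f u" for u
    using P.lv_le_hgt[of "{z. P.anc z y}" u] P.lv_ancestors_le[of y u] by (simp add: f_def)
  have fy: "f y = 0" by (simp add: f_def P.lv_mem[OF ch])
  have lip: "f u \<le> f v + 1" if "E u v" for u v
  proof -
    have step: "f (up w) = f w + 1 \<or> f (up w) = f w - 1" for w
      using f_up_mem f_up_notmem by blast
    from that consider "v = up u" | "u = up v" by (auto simp: adj_iff)
    then show ?thesis using step[of u] step[of v] by cases auto
  qed
  have "f x \<le> int (d x y)"
  proof -
    have "f u \<le> int n" if "(E ^^ n) u y" for n u
      using that
    proof (induction n arbitrary: u)
      case (Suc n)
      then obtain v where v: "E u v" "(E ^^ n) v y" by (meson relpowp_Suc_D2)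
      show ?case using lip[OF v(1)] Suc.IH[OF v(2)] by simp
    qed (simp add: fy)
    then show ?thesis using relpowp_dist by blast
  qed
  moreover have "d x y \<le> nat (f x)"
  proof -
    have "(E ^^ n) u y" if "f u = int n" for n u
      using that
    proof (induction n arbitrary: u)
      case 0
      then have "P.lv {z. P.anc z y} u = ht u" "ht u = ht y"
        using P.lv_le_hgt[of "{z. P.anc z y}" u] P.lv_ancestors_le[of y u] by (auto simp: f_def)
      moreover obtain z where "P.anc z y" "P.anc z u" "ht z = P.lv {z. P.anc z y} u"
        using P.lvE[OF ch, of u] by blast
      ultimately have "u = y" using P.anc_eqI[of z u u] P.anc_eqI[of z y y] by simp
      then show ?case by simp
    next
      case (Suc n)
      have "\<exists>v. E u v \<and> f v = int n"
      proof (cases "P.anc u y")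
        case True
        then have "u \<noteq> y" using Suc.prems fy by auto
        then obtain v where v: "up v = u" "P.anc v y" using P.anc_child[OF True] by blast
        then show ?thesis using f_up_mem[OF v(2)] Suc.prems by (intro exI[of _ v]) (auto simp: adj_iff)
      next
        case False
        then show ?thesis using f_up_notmem[OF False] Suc.prems by (intro exI[of _ "up u"]) (auto simp: adj_up)
      qed
      then show ?case using Suc.IH by (metis relpowp_Suc_I2)
    qed
    then show ?thesis using f_nonneg[of x] by (intro dist_le) simp
  qed
  ultimately show ?thesis using f_nonneg[of x] by (simp add: f_def)
qed

lemma dist_anc: "P.anc x y \<Longrightarrow> int (d x y) = ht y - ht x"
  by (simp add: dist_eq P.lv_mem[OF P.chain_ancestors])

lemma ray_up: "ray T (\<lambda>n. (up ^^ n) x)"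
proof (rule rayI)
  show "E ((up ^^ i) x) ((up ^^ Suc i) x)" for i by (simp add: adj_up)
  show "d ((up ^^ 0) x) ((up ^^ i) x) = i" for i
    using dist_anc[of "(up ^^ i) x" x] dist_sym[of x] by simp
qed

lemma range_up: "range (\<lambda>n. (up ^^ n) x) = {z. P.anc z x}"
  by (auto simp: P.anc_def)

text \<open>The height drops by one at each step of the chosen ray, and only the predecessor has
  this property.\<close>

lemma ref_ray_up: "ref_ray n = (up ^^ n) (ref_ray 0)"
proof -
  have h: "horo (ref_ray n) = - int n" for n
  proof -
    have "\<forall>\<^sub>F m in sequentially. int (d (ref_ray n) (ref_ray m)) - int m = - int n"
      unfolding eventually_sequentially by (rule exI[of _ n]) (simp add: ray_dist[OF ray_ref_ray])
    then have "\<forall>\<^sub>F m in sequentially. int (d (ref_ray n) (ref_ray m)) - int m = - int n \<and>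
        int (d (ref_ray n) (ref_ray m)) - int m = horo (ref_ray n)"
      by (intro eventually_conj horo_eventually)
    then show ?thesis using eventually_happens'[OF sequentially_bot] by force
  qed
  show ?thesis
  proof (induction n)
    case (Suc n)
    have "up (ref_ray n) = ref_ray (Suc n)"
      by (rule up_eqI[OF ray_adj[OF ray_ref_ray]]) (simp add: ht_def h)
    then show ?case using Suc by simp
  qed simp
qed

lemma up_ray_equiv: "((\<lambda>n. (up ^^ n) x), (\<lambda>n. (up ^^ n) y)) \<in> ray_equiv T"
proof -
  have fin: "finite (range (\<lambda>n. (up ^^ n) x) - range (\<lambda>n. (up ^^ n) y))" for x y
  proof -
    obtain m n where mn: "(up ^^ m) x = (up ^^ n) y" using up_merge by blast
    have "range (\<lambda>n. (up ^^ n) x) - range (\<lambda>n. (up ^^ n) y) \<subseteq> (\<lambda>i. (up ^^ i) x) ` {..<m}"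
    proof
      fix z assume "z \<in> range (\<lambda>n. (up ^^ n) x) - range (\<lambda>n. (up ^^ n) y)"
      then obtain i where i: "z = (up ^^ i) x" "z \<notin> range (\<lambda>n. (up ^^ n) y)" by blast
      have "i < m"
      proof (rule ccontr)
        assume "\<not> i < m"
        then have "i = (i - m) + m" by simp
        then have "z = (up ^^ (i - m)) ((up ^^ n) y)" using i(1) mn by (metis comp_apply funpow_add)
        then have "z = (up ^^ (i - m + n)) y" by (simp add: funpow_add)
        with i(2) show False by blast
      qed
      with i(1) show "z \<in> (\<lambda>i. (up ^^ i) x) ` {..<m}" by blast
    qed
    then show ?thesis by (rule finite_subset) simp
  qed
  show ?thesis using fin[of x y] fin[of y x] ray_up by (simp add: ray_equiv_def)
qed

lemma up_ray_mem: "(\<lambda>n. (up ^^ n) x) \<in> ref_end T"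
proof -
  have "ref_ray = (\<lambda>n. (up ^^ n) (ref_ray 0))" using ref_ray_up by blast
  then have "(ref_ray, \<lambda>n. (up ^^ n) x) \<in> ray_equiv T" using up_ray_equiv[of "ref_ray 0" x] by simp
  then show ?thesis using end_memD(2)[OF ref_end ref_ray_mem] by blast
qed

lemma ray_to_ref_end: "ray_to T x (ref_end T) = {z. P.anc z x}"
  using ray_to_eq[OF ref_end up_ray_mem, of x x] by (simp add: range_up)

text \<open>Both distances run along ancestors to the lowest common one, so they are differences of
  heights.\<close>

lemma busemann_eq: "busemann T x = ht x"
proof -
  obtain b where b: "P.anc b rt" "P.anc b x" "ht b = P.lv {z. P.anc z rt} x"
    "\<And>w. P.anc w rt \<Longrightarrow> P.anc w x \<Longrightarrow> ht w \<le> ht b"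
    using P.lvE[OF P.chain_ancestors, of rt x] by (metis mem_Collect_eq)
  have "confluent_ref T x rt = b"
    unfolding confluent_ref_def ray_to_ref_end
  proof (rule the_equality)
    have "P.anc w x \<and> P.anc w rt \<longleftrightarrow> P.anc w b" for w
      using b P.anc_linear[of w x b] P.anc_trans by blast
    then show eq: "{z. P.anc z x} \<inter> {z. P.anc z rt} = {z. P.anc z b}" by blast
    fix c assume "{z. P.anc z x} \<inter> {z. P.anc z rt} = {z. P.anc z c}"
    with eq have "P.anc c b" "P.anc b c" using P.anc_refl by blast+
    then have "ht c = ht b" using P.anc_hgt[of c b] P.anc_hgt[of b c] by simp
    with \<open>P.anc c b\<close> show "c = b" using P.anc_eqI P.anc_refl by blast
  qed
  then show ?thesis
    using dist_anc[OF b(1)] dist_anc[OF b(2)] by (simp add: busemann_def dist_sym)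
qed

lemma predecessor_eq: "predecessor T = up"
  by (simp add: predecessor_def up_def busemann_eq fun_eq_iff)

section \<open>Correspondence of ends and lines\<close>

text \<open>Passing from the confluent to a later \<open>S t\<close> adds the same length to the
  distances from x and from the root. Through \<open>dist_eq\<close> this converts a confluent seen
  from the root into levels seen from the reference end; only their difference enters the
  kernel.\<close>

lemma lv_confluent:
  assumes "\<xi> \<in> ends T" "S \<in> \<xi>" "S 0 = rt"
  shows "\<exists>j. \<forall>t\<ge>j. P.lv {z. P.anc z (confluent T x \<xi>)} x - P.lv {z. P.anc z (confluent T x \<xi>)} rt =
      P.lv {z. P.anc z (S t)} x - P.lv {z. P.anc z (S t)} rt"
proof -
  obtain j where j: "confluent T x \<xi> = S j" "\<And>t. t \<ge> j \<Longrightarrow> d x (S t) = d x (S j) + d (S j) (S t)"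
    using confluent_on_geodesic[OF assms] by blast
  have "P.lv {z. P.anc z (S j)} x - P.lv {z. P.anc z (S j)} rt =
      P.lv {z. P.anc z (S t)} x - P.lv {z. P.anc z (S t)} rt" if "j \<le> t" for t
  proof -
    have "d rt (S t) = d rt (S j) + d (S j) (S t)"
      using ray_dist[OF end_memD(1)[OF assms(1,2)]] that assms(3)[symmetric] by simp
    then have "int (d rt (S t)) = int (d rt (S j)) + int (d (S j) (S t))" by simp
    moreover have "int (d x (S t)) = int (d x (S j)) + int (d (S j) (S t))" using j(2)[OF that] by simp
    ultimately show ?thesis unfolding dist_eq by simp
  qed
  with j(1) show ?thesis by auto
qed

text \<open>An end other than the reference end corresponds to a bi-infinite geodesic emanating from the
  reference end, encoded by its set of vertices.\<close>

lemma ex_line_of_end: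
  assumes "\<xi> \<in> ends_star T"
  shows "\<exists>C. P.line C \<and> (\<forall>x. P.lv {z. P.anc z (confluent T x \<xi>)} x - P.lv {z. P.anc z (confluent T x \<xi>)} rt =
      P.lv C x - P.lv C rt)"
proof -
  have \<xi>: "\<xi> \<in> ends T" "\<xi> \<noteq> ref_end T" using assms by (auto simp: ends_star_def)
  obtain S where S: "S \<in> \<xi>" "S 0 = rt" using ex_ray_from[OF \<xi>(1)] by blast
  note rS = end_memD(1)[OF \<xi>(1) S(1)]
  \<comment> \<open>A ray that always moves to the predecessor represents the reference end, so the
    ray to \<xi> must descend at some point.\<close>
  have "\<exists>k. up (S (Suc k)) = S k"
  proof (rule ccontr)
    assume "\<nexists>k. up (S (Suc k)) = S k"
    then have "S (Suc k) = up (S k)" for k using ray_adj[OF rS, of k] by (auto simp: adj_iff)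
    then have "S k = (up ^^ k) rt" for k using S(2) by (induction k) auto
    then have "S \<in> ref_end T" using up_ray_mem[of rt] by (metis ext)
    then show False using \<xi> end_memD(2)[OF \<xi>(1) S(1)] end_memD(2)[OF ref_end] by metis
  qed
  then obtain k0 where k0: "up (S (Suc k0)) = S k0" by blast
  \<comment> \<open>After one descent, moving to the predecessor would revisit a vertex.\<close>
  have down: "up (S (Suc k)) = S k" if "k0 \<le> k" for k
    using that
  proof (induction rule: dec_induct)
    case (step k)
    have "S (Suc (Suc k)) \<noteq> S k" using ray_inj[OF rS] by (auto dest: injD)
    then show ?case using ray_adj[OF rS, of "Suc k"] step.IH by (auto simp: adj_iff)
  qed (rule k0)
  define C where "C = {z. \<exists>k\<ge>k0. P.anc z (S k)}"
  have anc_S: "P.anc (S k) (S l)" if "k0 \<le> k" "k \<le> l" for k l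
    using that(2)
  proof (induction rule: dec_induct)
    case (step l)
    then have "P.anc (S l) (S (Suc l))" using down[of l] that P.anc_pr[of "S (Suc l)"] by simp
    with step show ?case using P.anc_trans by blast
  qed simp
  have ht_S: "ht (S (k0 + i)) = ht (S k0) + int i" for i
  proof (induction i)
    case (Suc i)
    then show ?case using down[of "k0 + i"] ht_up[of "S (Suc (k0 + i))"] by simp
  qed simp
  have mem_S: "S k \<in> C" if "k0 \<le> k" for k using that P.anc_refl by (auto simp: C_def)
  have chain: "P.chain C"
    unfolding P.chain_def
  proof (intro conjI ballI impI)
    show "C \<noteq> {}" using mem_S by blast
    show "up x \<in> C" if "x \<in> C" for x using that P.anc_pr P.anc_trans unfolding C_def by blast
    show "x = y" if xy: "x \<in> C" "y \<in> C" "ht x = ht y" for x y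
    proof -
      obtain k l where "k0 \<le> k" "P.anc x (S k)" "k0 \<le> l" "P.anc y (S l)" using xy by (auto simp: C_def)
      then have "P.anc x (S (max k l))" "P.anc y (S (max k l))"
        using anc_S[of k "max k l"] anc_S[of l "max k l"] by (meson P.anc_trans max.cobounded1 max.cobounded2)+
      then show ?thesis using xy(3) by (rule P.anc_eqI)
    qed
  qed
  have line: "P.line C"
    unfolding P.line_def
  proof (intro conjI ballI chain)
    fix x assume "x \<in> C"
    then obtain k where k: "k0 \<le> k" "P.anc x (S k)" by (auto simp: C_def)
    show "\<exists>y\<in>C. up y = x"
    proof (cases "x = S k")
      case True
      then show ?thesis using down[OF k(1)] mem_S[of "Suc k"] k(1) by auto
    next
      case False
      then obtain y where "up y = x" "P.anc y (S k)" using P.anc_child[OF k(2)] by blast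
      then show ?thesis using k(1) by (auto simp: C_def)
    qed
  qed
  have "P.lv {z. P.anc z (confluent T x \<xi>)} x - P.lv {z. P.anc z (confluent T x \<xi>)} rt =
      P.lv C x - P.lv C rt" for x
  proof -
    obtain j where j: "\<And>t. t \<ge> j \<Longrightarrow> P.lv {z. P.anc z (confluent T x \<xi>)} x - P.lv {z. P.anc z (confluent T x \<xi>)} rt =
      P.lv {z. P.anc z (S t)} x - P.lv {z. P.anc z (S t)} rt"
      using lv_confluent[OF \<xi>(1) S] by blast
    \<comment> \<open>Large enough for index k0 + i to exceed j and for the vertex there to be at
      least as high as x and the root, hence as both levels.\<close>
    define i where "i = j + nat (\<bar>ht (S k0)\<bar> + \<bar>ht x\<bar>)"
    have "P.lv C x \<le> ht (S (k0 + i))" "P.lv C rt \<le> ht (S (k0 + i))"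
      using P.lv_le_hgt[of C x] P.lv_le_hgt[of C rt] by (auto simp: ht_S i_def)
    then have "P.lv {z. P.anc z (S (k0 + i))} x = P.lv C x" "P.lv {z. P.anc z (S (k0 + i))} rt = P.lv C rt"
      using P.lv_ancestors[OF chain] mem_S by auto
    then show ?thesis using j[of "k0 + i"] by (simp add: i_def)
  qed
  with line show ?thesis by blast
qed

text \<open>Choosing successors inside C gives a ray with unbounded heights; its class is the
  required end.\<close>

lemma ex_end_of_line:
  assumes C: "P.line C"
  shows "\<exists>\<xi>\<in>ends_star T. \<forall>x. P.lv {z. P.anc z (confluent T x \<xi>)} x - P.lv {z. P.anc z (confluent T x \<xi>)} rt =
      P.lv C x - P.lv C rt"
proof -
  have chain: "P.chain C" using C by (simp add: P.line_def)
  obtain c where "c \<in> C" using chain by (auto simp: P.chain_def)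
  obtain Q where Q: "\<And>n. Q n \<in> C" "\<And>n. up (Q (Suc n)) = Q n"
  proof -
    have "\<exists>Q. \<forall>n. Q n \<in> C \<and> up (Q (Suc n)) = Q n"
      using \<open>c \<in> C\<close> C unfolding P.line_def by (intro dependent_nat_choice) auto
    then show thesis using that by blast
  qed
  have ht_Q: "ht (Q n) = ht (Q 0) + int n" for n
    using Q(2) ht_up by (induction n) (simp, metis add.assoc add_diff_cancel_right' diff_add_cancel of_nat_Suc add.commute)
  have rQ: "ray T Q"
  proof (rule rayI)
    show "E (Q i) (Q (Suc i))" for i using Q(2) by (simp add: adj_iff)
    have "P.anc (Q 0) (Q i)" for i using P.chain_ancI[OF chain Q(1) Q(1)] ht_Q[of i] by simp
    then show "d (Q 0) (Q i) = i" for i using dist_anc[of "Q 0" "Q i"] ht_Q[of i] by simp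
  qed
  define \<xi> where "\<xi> = ray_equiv T `` {Q}"
  have \<xi>: "\<xi> \<in> ends T" using rQ unfolding \<xi>_def ends_def by (intro quotientI) simp
  have finQ: "finite {n. ht (Q n) \<le> B}" for B
  proof -
    have "n \<le> nat (B - ht (Q 0))" if "ht (Q n) \<le> B" for n using that ht_Q[of n] by simp
    then have "{n. ht (Q n) \<le> B} \<subseteq> {..nat (B - ht (Q 0))}" by blast
    then show ?thesis by (rule finite_subset) simp
  qed
  have "\<xi> \<noteq> ref_end T"
  proof
    assume "\<xi> = ref_end T"
    then have "(Q, \<lambda>n. (up ^^ n) rt) \<in> ray_equiv T" using up_ray_mem[of rt] by (auto simp: \<xi>_def)
    then have fin: "finite (range Q - {z. P.anc z rt})" by (auto simp: ray_equiv_def range_up)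
    \<comment> \<open>Equivalence with the ray of ancestors of the root would allow only finitely
      many vertices of Q outside those ancestors; but these have height at most 0, while the heights
      along Q are unbounded.\<close>
    have "\<exists>n. Q n \<notin> range Q - {z. P.anc z rt} \<and> 0 < ht (Q n)"
    proof -
      have "finite ({n. Q n \<in> range Q - {z. P.anc z rt}} \<union> {n. ht (Q n) \<le> 0})"
        using finite_vimageI[OF fin ray_inj[OF rQ]] finQ by (simp add: vimage_def)
      then obtain n where "n \<notin> {n. Q n \<in> range Q - {z. P.anc z rt}} \<union> {n. ht (Q n) \<le> 0}"
        using ex_new_if_finite[OF infinite_UNIV_nat] by blast
      then show ?thesis by (intro exI[of _ n]) simp
    qed
    then obtain n where n: "Q n \<notin> range Q - {z. P.anc z rt}" "0 < ht (Q n)" by blast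
    then have "P.anc (Q n) rt" by blast
    from P.anc_hgt[OF this] n(2) show False by simp
  qed
  with \<xi> have star: "\<xi> \<in> ends_star T" by (simp add: ends_star_def)
  obtain S where S: "S \<in> \<xi>" "S 0 = rt" using ex_ray_from[OF \<xi>] by blast
  note rS = end_memD(1)[OF \<xi> S(1)]
  have "P.lv {z. P.anc z (confluent T x \<xi>)} x - P.lv {z. P.anc z (confluent T x \<xi>)} rt =
      P.lv C x - P.lv C rt" for x
  proof -
    obtain j where j: "\<And>t. t \<ge> j \<Longrightarrow> P.lv {z. P.anc z (confluent T x \<xi>)} x - P.lv {z. P.anc z (confluent T x \<xi>)} rt =
      P.lv {z. P.anc z (S t)} x - P.lv {z. P.anc z (S t)} rt"
      using lv_confluent[OF \<xi> S] by blast
    have fin: "finite (range Q - range S)" using S(1) by (auto simp: \<xi>_def ray_equiv_def)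
    \<comment> \<open>S and Q share all but finitely many vertices, so some common vertex lies past
      index j of S and higher than x and the root.\<close>
    have "finite ({n. Q n \<in> range Q - range S} \<union> {n. Q n \<in> S ` {..<j}} \<union> {n. ht (Q n) \<le> \<bar>ht x\<bar>})"
      using finite_vimageI[OF fin ray_inj[OF rQ]] finite_vimageI[of "S ` {..<j}", OF _ ray_inj[OF rQ]] finQ
      by (simp add: vimage_def)
    from ex_new_if_finite[OF infinite_UNIV_nat this]
    obtain n where n: "n \<notin> {n. Q n \<in> range Q - range S} \<union> {n. Q n \<in> S ` {..<j}} \<union> {n. ht (Q n) \<le> \<bar>ht x\<bar>}"
      by (rule exE)
    have n: "Q n \<in> range S" "Q n \<notin> S ` {..<j}" "\<bar>ht x\<bar> < ht (Q n)"
      using n unfolding Un_iff mem_Collect_eq by (blast, blast, linarith)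
    obtain t where t: "Q n = S t" using n(1) by (rule rangeE)
    have "j \<le> t"
    proof (rule ccontr)
      assume "\<not> j \<le> t"
      then have "Q n \<in> S ` {..<j}" using t by simp
      with n(2) show False by blast
    qed
    have "P.lv C x \<le> ht (S t)" "P.lv C rt \<le> ht (S t)"
      using P.lv_le_hgt[of C x] P.lv_le_hgt[of C rt] n(3) t by auto
    then have "P.lv {z. P.anc z (S t)} x = P.lv C x" "P.lv {z. P.anc z (S t)} rt = P.lv C rt"
      using P.lv_ancestors[OF chain, of "S t"] Q(1)[of n] t by auto
    then show ?thesis using j[OF \<open>j \<le> t\<close>] by simp
  qed
  with star show ?thesis by blast
qed

end

section \<open>Martin kernels of the tree walk\<close>

locale tree_with_end_walk = tree_with_end +
  fixes a :: real
  assumes a_pos: "0 < a" and a_less_1: "a < 1"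
begin

sublocale W: pred_tree_walk q up ht rt a
  using a_pos a_less_1 by unfold_locales

text \<open>In the quotient of hitting probabilities the factor belonging to the target cancels, and
  what remains depends on the level difference only.\<close>

lemma martin_kernel_eq:
  assumes "\<And>x. P.lv {z. P.anc z (confluent T x \<xi>)} x - P.lv {z. P.anc z (confluent T x \<xi>)} rt = P.lv C x - P.lv C rt"
  shows "martin_kernel T W.walk x \<xi> = W.martin_line C x"
proof -
  let ?\<sigma> = "real q * W.\<rho>" and ?c = "confluent T x \<xi>"
  have \<sigma>: "?\<sigma> \<noteq> 0" using W.q\<rho>_pos by (rule less_imp_neq[symmetric])
  have nz: "?\<sigma> powi n \<noteq> 0" for n using \<sigma> unfolding power_int_eq_0_iff by blast
  have "martin_kernel T W.walk x \<xi> = W.\<psi> x * (P.kap ?\<sigma> {z. P.anc z ?c} x / P.kap ?\<sigma> {z. P.anc z ?c} rt)"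
    using nz by (simp add: martin_kernel_def W.hit_prob_walk)
  also have "P.kap ?\<sigma> {z. P.anc z ?c} x / P.kap ?\<sigma> {z. P.anc z ?c} rt = P.kap ?\<sigma> C x / P.kap ?\<sigma> C rt"
    unfolding P.kap_def using power_int_diff[OF disjI1[OF \<sigma>]] assms[of x] by metis
  finally show ?thesis by (simp only: W.martin_line_def W.\<sigma>_def)
qed

theorem martin_kernel_end: "\<xi> \<in> ends_star T \<Longrightarrow> \<exists>C. P.line C \<and> (\<forall>x. martin_kernel T W.walk x \<xi> = W.martin_line C x)"
  using ex_line_of_end martin_kernel_eq by metis

theorem martin_kernel_line: "P.line C \<Longrightarrow> \<exists>\<xi>\<in>ends_star T. \<forall>x. martin_kernel T W.walk x \<xi> = W.martin_line C x"
  using ex_end_of_line martin_kernel_eq by metis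

lemma proj_walk1_eq: "proj_walk1 q a T = W.walk"
  by (simp add: proj_walk1_def W.walk_def predecessor_eq fun_eq_iff)

text \<open>On the second tree the successors carry the complementary weight. The cases are tested
  in the opposite order, which is harmless since they exclude each other.\<close>

lemma proj_walk2_eq: "proj_walk2 q (1 - a) T = W.walk"
  using W.pr_pr_neq by (auto simp: proj_walk2_def W.walk_def predecessor_eq fun_eq_iff)

end

section \<open>Harmonic functions on the Diestel--Leader graph\<close>

text \<open>Keeping b as a parameter tied to a by the sum condition makes the setting symmetric, so
  that \<open>swapped\<close> transfers every statement to the other tree.\<close>

locale DL_walks =
  A: pred_tree_walk q p1 h1 o1 a + B: pred_tree_walk r p2 h2 o2 b
  for q r :: nat and p1 :: "'a \<Rightarrow> 'a" and p2 :: "'b \<Rightarrow> 'b" and h1 h2 o1 o2 and a b :: real +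
  assumes a_plus_b: "a + b = 1"
begin

lemma swapped: "DL_walks r q p2 p1 h2 h1 o2 o1 b a"
  using a_plus_b by unfold_locales auto

definition opp :: "'a \<Rightarrow> 'b \<Rightarrow> bool" where
  "opp x1 x2 \<longleftrightarrow> h1 x1 + h2 x2 = 0"

definition dl_mean :: "('a \<Rightarrow> 'b \<Rightarrow> real) \<Rightarrow> 'a \<Rightarrow> 'b \<Rightarrow> real" where
  "dl_mean f x1 x2 = a / real q * (\<Sum>y1\<in>A.children x1. f y1 (p2 x2)) + b / real r * (\<Sum>y2\<in>B.children x2. f (p1 x1) y2)"

definition dl_harm :: "('a \<Rightarrow> 'b \<Rightarrow> real) \<Rightarrow> bool" where
  "dl_harm f \<longleftrightarrow> (\<forall>x1 x2. opp x1 x2 \<longrightarrow> f x1 x2 = dl_mean f x1 x2)"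

definition dl_minimal :: "('a \<Rightarrow> 'b \<Rightarrow> real) \<Rightarrow> bool" where
  "dl_minimal f \<longleftrightarrow> dl_harm f \<and> (\<forall>x1 x2. opp x1 x2 \<longrightarrow> 0 \<le> f x1 x2) \<and> f o1 o2 = 1 \<and>
     (\<forall>g. dl_harm g \<and> (\<forall>x1 x2. opp x1 x2 \<longrightarrow> 0 \<le> g x1 x2) \<and> (\<forall>x1 x2. opp x1 x2 \<longrightarrow> g x1 x2 \<le> f x1 x2) \<longrightarrow>
       (\<exists>c. \<forall>x1 x2. opp x1 x2 \<longrightarrow> g x1 x2 / f x1 x2 = c))"

lemma opp_origin [simp]: "opp o1 o2"
  by (simp add: opp_def)

lemma ex_opp1: "\<exists>x2. opp x1 x2"
proof -
  obtain x2 where "h2 x2 = - h1 x1" using B.ex_hgt by blast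
  then show ?thesis by (intro exI[of _ x2]) (simp add: opp_def)
qed

lemma ex_opp2: "\<exists>x1. opp x1 x2"
proof -
  obtain x1 where "h1 x1 = - h2 x2" using A.ex_hgt by blast
  then show ?thesis by (intro exI[of _ x1]) (simp add: opp_def)
qed

lemma opp_up1: "opp x1 x2 \<Longrightarrow> p1 y1 = x1 \<Longrightarrow> opp y1 (p2 x2)"
  using A.hgt_pr[of y1] by (auto simp: opp_def)

lemma opp_up2: "opp x1 x2 \<Longrightarrow> p2 y2 = x2 \<Longrightarrow> opp (p1 x1) y2"
  using B.hgt_pr[of y2] by (auto simp: opp_def)

lemma q_pos: "0 < real q" "0 < real r"
  using A.q_ge_2 B.q_ge_2 by auto

lemma ab_pos: "0 < a" "0 < b"
  by (rule A.a_pos, rule B.a_pos)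

lemma ab_eq: "1 - a = b" "1 - b = a"
  using a_plus_b by auto

lemma dl_mean_cong:
  assumes "opp x1 x2" "\<And>x1 x2. opp x1 x2 \<Longrightarrow> f x1 x2 = g x1 x2"
  shows "dl_mean f x1 x2 = dl_mean g x1 x2"
  unfolding dl_mean_def using assms opp_up1 opp_up2
  by (intro arg_cong2[of _ _ _ _ "(+)"] arg_cong2[of _ _ _ _ "(*)"] sum.cong refl) auto

lemma dl_harm_cong:
  assumes "\<And>x1 x2. opp x1 x2 \<Longrightarrow> f x1 x2 = g x1 x2"
  shows "dl_harm f \<longleftrightarrow> dl_harm g"
proof -
  have "opp x1 x2 \<longrightarrow> (f x1 x2 = dl_mean f x1 x2 \<longleftrightarrow> g x1 x2 = dl_mean g x1 x2)" for x1 x2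
    using assms[of x1 x2] dl_mean_cong[of x1 x2 f g, OF _ assms] by auto
  then show ?thesis unfolding dl_harm_def by blast
qed

lemma dl_minimal_cong:
  assumes "\<And>x1 x2. opp x1 x2 \<Longrightarrow> f x1 x2 = g x1 x2"
  shows "dl_minimal f \<longleftrightarrow> dl_minimal g"
proof -
  have 1: "(\<forall>x1 x2. opp x1 x2 \<longrightarrow> Q x1 x2 (f x1 x2)) \<longleftrightarrow> (\<forall>x1 x2. opp x1 x2 \<longrightarrow> Q x1 x2 (g x1 x2))" for Q
    using assms by auto
  have 2: "dl_harm f \<longleftrightarrow> dl_harm g" using assms by (rule dl_harm_cong)
  have 3: "f o1 o2 = g o1 o2" by (rule assms[OF opp_origin])
  show ?thesis
    unfolding dl_minimal_def 2 3 1[of "\<lambda>_ _. (\<le>) 0"] 1[of "\<lambda>x1 x2 t. u x1 x2 \<le> t" for u]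
      1[of "\<lambda>x1 x2 t. u x1 x2 / t = c" for u c] ..
qed

lemma dl_mean_diff: "dl_mean (\<lambda>x y. f x y - g x y) x1 x2 = dl_mean f x1 x2 - dl_mean g x1 x2"
  by (simp add: dl_mean_def sum_subtractf algebra_simps)

lemma dl_mean_lift1: "dl_mean (\<lambda>x _. f x) x1 x2 = a / real q * (\<Sum>y\<in>A.children x1. f y) + (1 - a) * f (p1 x1)"
  using B.card_children[of x2] q_pos unfolding ab_eq by (simp add: dl_mean_def)

lemma dl_mean_lift2: "dl_mean (\<lambda>_ y. f y) x1 x2 = b / real r * (\<Sum>y\<in>B.children x2. f y) + (1 - b) * f (p2 x2)"
  using A.card_children[of x1] q_pos unfolding ab_eq by (simp add: dl_mean_def)

lemma harm_at_iff_mean1: "A.harm_at f x1 \<longleftrightarrow> f x1 = dl_mean (\<lambda>x _. f x) x1 x2"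
  by (simp add: A.harm_at_def dl_mean_lift1)

lemma harm_at_iff_mean2: "B.harm_at f x2 \<longleftrightarrow> f x2 = dl_mean (\<lambda>_ y. f y) x1 x2"
  by (simp add: B.harm_at_def dl_mean_lift2)

text \<open>For a function of the first coordinate the mean on the graph is the mean of the
  projected walk, and every vertex of the first tree occurs as a first coordinate.\<close>

lemma dl_harm_lift1: "dl_harm (\<lambda>x _. f x) \<longleftrightarrow> (\<forall>x. A.harm_at f x)"
  unfolding dl_harm_def using harm_at_iff_mean1 ex_opp1 by metis

lemma dl_harm_lift2: "dl_harm (\<lambda>_ y. f y) \<longleftrightarrow> (\<forall>x. B.harm_at f x)"
  unfolding dl_harm_def using harm_at_iff_mean2 ex_opp2 by metis

lemma dl_mean_swap: "DL_walks.dl_mean r q p2 p1 b a (\<lambda>x2 x1. f x1 x2) x2 x1 = dl_mean f x1 x2"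
proof -
  interpret S: DL_walks r q p2 p1 h2 h1 o2 o1 b a by (rule swapped)
  show ?thesis by (simp add: S.dl_mean_def dl_mean_def)
qed

lemma opp_swap: "DL_walks.opp h2 h1 x2 x1 \<longleftrightarrow> opp x1 x2"
proof -
  interpret S: DL_walks r q p2 p1 h2 h1 o2 o1 b a by (rule swapped)
  show ?thesis by (auto simp: S.opp_def opp_def)
qed

lemma dl_harm_swap: "DL_walks.dl_harm r q p2 p1 h2 h1 b a (\<lambda>x2 x1. f x1 x2) \<longleftrightarrow> dl_harm f"
proof -
  interpret S: DL_walks r q p2 p1 h2 h1 o2 o1 b a by (rule swapped)
  show ?thesis unfolding S.dl_harm_def dl_harm_def by (auto simp: dl_mean_swap opp_swap)
qed

lemma dl_minimal_swap: "DL_walks.dl_minimal r q p2 p1 h2 h1 o2 o1 b a (\<lambda>x2 x1. f x1 x2) \<longleftrightarrow> dl_minimal f"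
proof -
  interpret S: DL_walks r q p2 p1 h2 h1 o2 o1 b a by (rule swapped)
  have all: "(\<forall>g. P g) \<longleftrightarrow> (\<forall>g. P (\<lambda>x2 x1. g x1 x2))" for P :: "('b \<Rightarrow> 'a \<Rightarrow> real) \<Rightarrow> bool"
  proof (intro iffI allI)
    fix g assume "\<forall>g. P (\<lambda>x2 x1. g x1 x2)"
    from this[rule_format, of "\<lambda>x1 x2. g x2 x1"] show "P g" by simp
  qed blast
  have flip: "(\<forall>x2 x1. opp x1 x2 \<longrightarrow> Q x1 x2) \<longleftrightarrow> (\<forall>x1 x2. opp x1 x2 \<longrightarrow> Q x1 x2)" for Q by blast
  show ?thesis
    unfolding S.dl_minimal_def dl_minimal_def all dl_harm_swap opp_swap flip ..
qed

section \<open>Exit from a strip through the top\<close>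

text \<open>
  The walk on the strip \<open>\<bar>h1\<bar> \<le> n\<close> below a fixed vertex \<open>w\<close> of the second tree leaves it either at the
  top, in a point \<open>(y, w)\<close> whose law depends on the first coordinate of the starting point only, or at
  the bottom. The iteration approximates the contribution of the first alternative.
\<close>

primrec top_iter :: "('a \<Rightarrow> 'b \<Rightarrow> real) \<Rightarrow> nat \<Rightarrow> 'b \<Rightarrow> nat \<Rightarrow> 'a \<Rightarrow> real" where
  "top_iter f n w 0 x = (if int n \<le> h1 x then f x w else 0)"
| "top_iter f n w (Suc m) x = (if int n \<le> h1 x then f x w else if h1 x \<le> - int n then 0
     else a / real q * (\<Sum>y\<in>A.children x. top_iter f n w m y) + (1 - a) * top_iter f n w m (p1 x))"

context
  fixes f n w
  assumes f: "dl_harm f" "\<And>x1 x2. opp x1 x2 \<Longrightarrow> 0 \<le> f x1 x2" and w: "h2 w = - int n" and n: "0 < n"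
begin

lemma top_iter_nonneg: "h1 x \<le> int n \<Longrightarrow> 0 \<le> top_iter f n w m x"
proof (induction m arbitrary: x)
  case 0
  then show ?case using f(2)[of x w] w by (auto simp: opp_def)
next
  case (Suc m)
  have "0 \<le> top_iter f n w m y" if "y \<in> A.children x" "h1 x < int n" for y
    using that A.hgt_pr[of y] by (intro Suc.IH) auto
  then have "0 \<le> a / real q * (\<Sum>y\<in>A.children x. top_iter f n w m y)" if "h1 x < int n"
    using ab_pos that by (intro mult_nonneg_nonneg sum_nonneg) auto
  moreover have "0 \<le> (1 - a) * top_iter f n w m (p1 x)"
    using Suc ab_pos by (simp add: ab_eq)
  ultimately show ?case using Suc.prems f(2)[of x w] w by (auto simp: opp_def)
qed

lemma top_iter_mono: "h1 x \<le> int n \<Longrightarrow> top_iter f n w m x \<le> top_iter f n w (Suc m) x"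
proof (induction m arbitrary: x)
  case 0
  then show ?case using top_iter_nonneg[OF 0, of "Suc 0"] by (auto simp del: top_iter.simps(2)) (simp)
next
  case (Suc m)
  have "top_iter f n w m y \<le> top_iter f n w (Suc m) y" if "y \<in> A.children x" "h1 x < int n" for y
    using that A.hgt_pr[of y] by (intro Suc.IH) auto
  moreover have "top_iter f n w m (p1 x) \<le> top_iter f n w (Suc m) (p1 x)"
    using Suc.prems by (intro Suc.IH) simp
  ultimately have "a / real q * (\<Sum>y\<in>A.children x. top_iter f n w m y) + (1 - a) * top_iter f n w m (p1 x)
      \<le> a / real q * (\<Sum>y\<in>A.children x. top_iter f n w (Suc m) y) + (1 - a) * top_iter f n w (Suc m) (p1 x)"
    if "h1 x < int n"
    using ab_pos that unfolding ab_eq by (intro add_mono mult_left_mono sum_mono) auto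
  then show ?case
    unfolding top_iter.simps(2)[of f n w m x] top_iter.simps(2)[of f n w "Suc m" x]
    by (simp del: top_iter.simps)
qed

text \<open>The comparison is made for all admissible x2 at once, so taking means preserves it. It
  starts correctly because at the top the only vertex opposite to x in the cone of w is w
  itself.\<close>

lemma top_iter_le:
  "h1 x \<le> int n \<Longrightarrow> B.anc w x2 \<Longrightarrow> opp x x2 \<Longrightarrow> top_iter f n w m x \<le> f x x2"
proof (induction m arbitrary: x x2)
  case 0
  have "x2 = w" if "int n \<le> h1 x"
    using B.anc_eqI[OF \<open>B.anc w x2\<close> B.anc_refl] 0 that w by (simp add: opp_def)
  then show ?case using f(2)[OF \<open>opp x x2\<close>] by simp
next
  case (Suc m)
  have top: "x2 = w" if "int n \<le> h1 x"
    using B.anc_eqI[OF Suc.prems(2) B.anc_refl] Suc.prems that w by (simp add: opp_def)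
  show ?case
  proof (cases "int n \<le> h1 x \<or> h1 x \<le> - int n")
    case True
    then show ?thesis using top f(2)[OF \<open>opp x x2\<close>] by (cases "int n \<le> h1 x") simp_all
  next
    case False
    have 1: "top_iter f n w m y \<le> f y (p2 x2)" if "y \<in> A.children x" for y
    proof (rule Suc.IH)
      show "h1 y \<le> int n" using that False A.hgt_pr[of y] by simp
      \<comment> \<open>Opposite to w the first height would be n, which is excluded here; so the
        predecessor of x2 stays in the cone of w.\<close>
      have "x2 \<noteq> w" using False Suc.prems w by (auto simp: opp_def)
      then show "B.anc w (p2 x2)" using B.anc_cases_pr[OF Suc.prems(2)] by simp
      show "opp y (p2 x2)" using opp_up1[OF Suc.prems(3)] that by simp
    qed
    have 2: "top_iter f n w m (p1 x) \<le> f (p1 x) y" if "y \<in> B.children x2" for y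
    proof (rule Suc.IH)
      show "h1 (p1 x) \<le> int n" using Suc.prems by simp
      show "B.anc w y" using B.anc_of_pr[of w y] Suc.prems(2) that by simp
      show "opp (p1 x) y" using opp_up2[OF Suc.prems(3)] that by simp
    qed
    have "real r * top_iter f n w m (p1 x) = (\<Sum>y\<in>B.children x2. top_iter f n w m (p1 x))"
      using B.card_children[of x2] by simp
    also have "\<dots> \<le> (\<Sum>y\<in>B.children x2. f (p1 x) y)" by (intro sum_mono 2)
    finally have "b / real r * (real r * top_iter f n w m (p1 x)) \<le> b / real r * (\<Sum>y\<in>B.children x2. f (p1 x) y)"
      using ab_pos by (intro mult_left_mono) auto
    then have "(1 - a) * top_iter f n w m (p1 x) \<le> b / real r * (\<Sum>y\<in>B.children x2. f (p1 x) y)"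
      using q_pos unfolding ab_eq(1) by simp
    moreover have "a / real q * (\<Sum>y\<in>A.children x. top_iter f n w m y) \<le> a / real q * (\<Sum>y\<in>A.children x. f y (p2 x2))"
      using ab_pos by (intro mult_left_mono sum_mono 1) auto
    ultimately have "top_iter f n w (Suc m) x \<le> dl_mean f x x2"
      using False by (simp add: dl_mean_def)
    then show ?thesis using f(1) Suc.prems(3) by (simp add: dl_harm_def)
  qed
qed

text \<open>The iteration increases and is bounded by f, so it converges. Its limit is harmonic
  inside the strip and depends on the first coordinate only, because the boundary data do.\<close>

lemma ex_top_part:
  "\<exists>g. (\<forall>x. h1 x = int n \<longrightarrow> g x = f x w) \<and> (\<forall>x. h1 x = - int n \<longrightarrow> g x = 0) \<and>
     (\<forall>x. \<bar>h1 x\<bar> < int n \<longrightarrow> A.harm_at g x) \<and>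
     (\<forall>x x2. \<bar>h1 x\<bar> \<le> int n \<longrightarrow> B.anc w x2 \<longrightarrow> opp x x2 \<longrightarrow> 0 \<le> g x \<and> g x \<le> f x x2)"
proof -
  have conv: "convergent (\<lambda>m. top_iter f n w m x)" if "\<bar>h1 x\<bar> \<le> int n" for x
  proof -
    \<comment> \<open>Any descendant of w opposite to x will do; it only supplies an upper
      bound.\<close>
    obtain x2 where x2: "B.anc w x2" "h2 x2 = h2 w + int (nat (int n - h1 x))"
      using B.ex_descendant by blast
    then have "opp x x2" using w that by (simp add: opp_def)
    have "incseq (\<lambda>m. top_iter f n w m x)" using that by (intro incseq_SucI top_iter_mono) simp
    moreover have "top_iter f n w m x \<le> f x x2" for m
      using that x2(1) \<open>opp x x2\<close> by (intro top_iter_le) auto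
    ultimately show ?thesis using incseq_convergent[of _ "f x x2"] convergentI by metis
  qed
  define g where "g x = lim (\<lambda>m. top_iter f n w m x)" for x
  have lim: "(\<lambda>m. top_iter f n w m x) \<longlonglongrightarrow> g x" if "\<bar>h1 x\<bar> \<le> int n" for x
    using conv[OF that] by (simp add: g_def convergent_LIMSEQ_iff)
  have lim_Suc: "(\<lambda>m. top_iter f n w (Suc m) x) \<longlonglongrightarrow> g x" if "\<bar>h1 x\<bar> \<le> int n" for x
    using lim[OF that] by (rule LIMSEQ_Suc)
  have "g x = f x w" if "h1 x = int n" for x
  proof -
    have "(\<lambda>m. top_iter f n w (Suc m) x) = (\<lambda>m. f x w)" using that by simp
    then show ?thesis using lim_Suc[of x] that by (simp add: LIMSEQ_const_iff)
  qed
  moreover have "g x = 0" if "h1 x = - int n" for x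
  proof -
    have "(\<lambda>m. top_iter f n w (Suc m) x) = (\<lambda>m. 0)" using that n by simp
    then show ?thesis using lim_Suc[of x] that by (simp add: LIMSEQ_const_iff)
  qed
  moreover have "A.harm_at g x" if x: "\<bar>h1 x\<bar> < int n" for x
  proof -
    have "(\<lambda>m. a / real q * (\<Sum>y\<in>A.children x. top_iter f n w m y) + (1 - a) * top_iter f n w m (p1 x))
        \<longlonglongrightarrow> a / real q * (\<Sum>y\<in>A.children x. g y) + (1 - a) * g (p1 x)"
    proof (intro tendsto_intros lim)
      show "\<bar>h1 y\<bar> \<le> int n" if "y \<in> A.children x" for y using that x A.hgt_pr[of y] by auto
      show "\<bar>h1 (p1 x)\<bar> \<le> int n" using x by auto
    qed
    moreover have "(\<lambda>m. top_iter f n w (Suc m) x) = (\<lambda>m. a / real q * (\<Sum>y\<in>A.children x. top_iter f n w m y) + (1 - a) * top_iter f n w m (p1 x))"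
      using x by (auto simp: fun_eq_iff)
    ultimately show ?thesis unfolding A.harm_at_def using lim_Suc[of x] x by (metis LIMSEQ_unique less_imp_le)
  qed
  moreover have "0 \<le> g x \<and> g x \<le> f x x2" if "\<bar>h1 x\<bar> \<le> int n" "B.anc w x2" "opp x x2" for x x2
    using lim[OF that(1)] top_iter_nonneg[of x] top_iter_le[OF _ that(2,3)] that(1)
    by (auto intro: LIMSEQ_le_const LIMSEQ_le_const2)
  ultimately show ?thesis by blast
qed

end

section \<open>Decomposition on tetrahedra and on the whole graph\<close>

text \<open>Among the points with a positive maximal value take one of greatest first height. If it
  were inner, its mean would include points of greater first height, where the value is strictly
  smaller.\<close>

lemma max_principle:
  assumes fin: "finite S" and S: "\<And>x1 x2. (x1, x2) \<in> S \<Longrightarrow> opp x1 x2"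
    and inner: "\<And>x1 x2. (x1, x2) \<in> S \<Longrightarrow> (x1, x2) \<notin> S' \<Longrightarrow> f x1 x2 = dl_mean f x1 x2 \<and>
        (\<forall>y\<in>A.children x1. (y, p2 x2) \<in> S) \<and> (\<forall>y\<in>B.children x2. (p1 x1, y) \<in> S)"
    and bd: "\<And>x1 x2. (x1, x2) \<in> S' \<Longrightarrow> f x1 x2 \<le> 0" and x: "(x1, x2) \<in> S"
  shows "f x1 x2 \<le> 0"
proof (rule ccontr)
  assume pos: "\<not> f x1 x2 \<le> 0"
  have ex_max: "\<exists>p\<in>Z. \<forall>p'\<in>Z. F p' \<le> F p" if "finite Z" "Z \<noteq> {}" for Z and F :: "'a \<times> 'b \<Rightarrow> 'c::linorder"
  proof -
    have "Max (F ` Z) \<in> F ` Z" using that by (intro Max_in) auto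
    then obtain p where "p \<in> Z" "F p = Max (F ` Z)" by auto
    then show ?thesis using Max_ge[OF finite_imageI[OF that(1)], of _ F] by (intro bexI[of _ p]) auto
  qed
  obtain p where p: "p \<in> S" "\<forall>p'\<in>S. f (fst p') (snd p') \<le> f (fst p) (snd p)"
    using ex_max[OF fin, of "\<lambda>p. f (fst p) (snd p)"] x by blast
  define M where "M = f (fst p) (snd p)"
  have le_M: "f u v \<le> M" if "(u, v) \<in> S" for u v
    using p(2) that unfolding M_def by fastforce
  have M_pos: "0 < M" using le_M[OF x] pos by simp
  define Z where "Z = {p' \<in> S. f (fst p') (snd p') = M}"
  have "finite Z" using fin by (simp add: Z_def)
  moreover have "p \<in> Z" using p(1) by (simp add: Z_def M_def)
  ultimately obtain p' where p': "p' \<in> Z" "\<forall>z\<in>Z. h1 (fst z) \<le> h1 (fst p')"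
    using ex_max[of Z "\<lambda>p. h1 (fst p)"] by blast
  define u v k where "u = fst p'" and "v = snd p'" and "k = h1 u"
  have uv: "(u, v) \<in> S" "f u v = M" "h1 u = k" using p'(1) by (auto simp: Z_def u_def v_def k_def)
  have k_max: "h1 u' \<le> k" if "(u', v') \<in> S" "f u' v' = M" for u' v'
    using p'(2) that unfolding Z_def k_def u_def by fastforce
  have "(u, v) \<notin> S'" using bd[of u v] uv M_pos by auto
  note i = inner[OF uv(1) this]
  have less: "f y (p2 v) < M" if "y \<in> A.children u" for y
  proof -
    have "(y, p2 v) \<in> S" using i that by blast
    moreover have "h1 y = k + 1" using that uv(3) A.hgt_pr[of y] by auto
    ultimately show ?thesis using le_M[of y "p2 v"] k_max[of y "p2 v"] by fastforce
  qed
  have "a / real q * (\<Sum>y\<in>A.children u. f y (p2 v)) < a / real q * (\<Sum>y\<in>A.children u. M)"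
    using A.children_nonempty[of u] ab_pos q_pos less
    by (intro mult_strict_left_mono sum_strict_mono) auto
  moreover have "b / real r * (\<Sum>y\<in>B.children v. f (p1 u) y) \<le> b / real r * (\<Sum>y\<in>B.children v. M)"
    using ab_pos q_pos i le_M by (intro mult_left_mono sum_mono) auto
  moreover have "M = a / real q * (\<Sum>y\<in>A.children u. f y (p2 v)) + b / real r * (\<Sum>y\<in>B.children v. f (p1 u) y)"
    using i uv(2) unfolding dl_mean_def by (elim conjE) (rule trans[OF sym])
  ultimately have "M < a / real q * (\<Sum>y\<in>A.children u. M) + b / real r * (\<Sum>y\<in>B.children v. M)"
    by linarith
  also have "\<dots> = a / real q * (real q * M) + b / real r * (real r * M)"
    by (simp only: sum_constant A.card_children B.card_children)
  also have "\<dots> = (a + b) * M" using q_pos by (simp add: distrib_right)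
  also have "\<dots> = M" by (simp add: a_plus_b)
  finally show False by simp
qed

text \<open>The heights sum to zero, so the lower bound on either height is an upper bound on the
  other, and cone levels are finite.\<close>

lemma finite_tetrahedron: "finite {(x1, x2). A.anc w1 x1 \<and> B.anc w2 x2 \<and> opp x1 x2}"
proof -
  define n where "n = nat (- h1 w1 - h2 w2)"
  have "{(x1, x2). A.anc w1 x1 \<and> B.anc w2 x2 \<and> opp x1 x2} \<subseteq>
      (\<Union>k\<le>n. {x. A.anc w1 x \<and> h1 x = h1 w1 + int k}) \<times> (\<Union>k\<le>n. {x. B.anc w2 x \<and> h2 x = h2 w2 + int k})"
  proof clarify
    fix x1 x2 assume *: "A.anc w1 x1" "B.anc w2 x2" "opp x1 x2"
    obtain k where k: "h1 x1 = h1 w1 + int k" using *(1) by (rule A.ancE)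
    obtain l where l: "h2 x2 = h2 w2 + int l" using *(2) by (rule B.ancE)
    have "k \<le> n" "l \<le> n" using *(3) k l by (auto simp: n_def opp_def)
    with * k l show "x1 \<in> (\<Union>k\<le>n. {x. A.anc w1 x \<and> h1 x = h1 w1 + int k}) \<and>
        x2 \<in> (\<Union>k\<le>n. {x. B.anc w2 x \<and> h2 x = h2 w2 + int k})" by blast
  qed
  then show ?thesis by (rule finite_subset) (auto intro!: A.finite_cone_level B.finite_cone_level)
qed

text \<open>The bottom of the first height is the top of the second, so the construction of the top
  part is used once in each tree. The remainder e vanishes on both faces, and the maximum principle
  for e and its negative removes it.\<close>

lemma tetrahedron_decomposition:
  assumes f: "dl_harm f" "\<And>x1 x2. opp x1 x2 \<Longrightarrow> 0 \<le> f x1 x2" and n: "0 < n"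
    and w1: "h1 w1 = - int n" and w2: "h2 w2 = - int n"
  shows "\<exists>g1 g2. (\<forall>x. \<bar>h1 x\<bar> < int n \<longrightarrow> A.harm_at g1 x) \<and>
     (\<forall>x1 x2. A.anc w1 x1 \<longrightarrow> B.anc w2 x2 \<longrightarrow> opp x1 x2 \<longrightarrow>
       0 \<le> g1 x1 \<and> 0 \<le> g2 x2 \<and> f x1 x2 = g1 x1 + g2 x2)"
proof -
  interpret S: DL_walks r q p2 p1 h2 h1 o2 o1 b a by (rule swapped)
  obtain g1 where g1: "\<And>x. h1 x = int n \<Longrightarrow> g1 x = f x w2" "\<And>x. h1 x = - int n \<Longrightarrow> g1 x = 0"
    "\<And>x. \<bar>h1 x\<bar> < int n \<Longrightarrow> A.harm_at g1 x"
    "\<And>x x2. \<bar>h1 x\<bar> \<le> int n \<Longrightarrow> B.anc w2 x2 \<Longrightarrow> opp x x2 \<Longrightarrow> 0 \<le> g1 x \<and> g1 x \<le> f x x2"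
    using ex_top_part[OF f w2 n] by blast
  have f': "S.dl_harm (\<lambda>x2 x1. f x1 x2)" "\<And>x2 x1. S.opp x2 x1 \<Longrightarrow> 0 \<le> f x1 x2"
    using f by (auto simp: dl_harm_swap opp_swap)
  obtain g2 where g2: "\<And>x. h2 x = int n \<Longrightarrow> g2 x = f w1 x" "\<And>x. h2 x = - int n \<Longrightarrow> g2 x = 0"
    "\<And>x. \<bar>h2 x\<bar> < int n \<Longrightarrow> B.harm_at g2 x"
    "\<And>x x1. \<bar>h2 x\<bar> \<le> int n \<Longrightarrow> A.anc w1 x1 \<Longrightarrow> opp x1 x \<Longrightarrow> 0 \<le> g2 x \<and> g2 x \<le> f x1 x"
    using S.ex_top_part[OF f' w1 n] unfolding opp_swap by blast
  define S where "S = {(x1, x2). A.anc w1 x1 \<and> B.anc w2 x2 \<and> opp x1 x2}"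
  define S' where "S' = {(x1, x2) \<in> S. \<bar>h1 x1\<bar> = int n}"
  define e where "e x1 x2 = f x1 x2 - g1 x1 - g2 x2" for x1 x2
  have range: "\<bar>h1 x1\<bar> \<le> int n \<and> \<bar>h2 x2\<bar> \<le> int n" if "(x1, x2) \<in> S" for x1 x2
    using that A.anc_hgt[of w1 x1] B.anc_hgt[of w2 x2] w1 w2 by (auto simp: S_def opp_def)
  have bd: "e x1 x2 = 0" if "(x1, x2) \<in> S'" for x1 x2
  proof -
    have *: "A.anc w1 x1" "B.anc w2 x2" "opp x1 x2" using that by (auto simp: S'_def S_def)
    have "\<bar>h1 x1\<bar> = int n" "h1 x1 + h2 x2 = 0" using that *(3) by (auto simp: S'_def opp_def)
    \<comment> \<open>On the upper face the second coordinate is w2 and the second summand is zero;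
      on the lower face the roles are exchanged.\<close>
    then consider "h1 x1 = int n" "h2 x2 = - int n" | "h1 x1 = - int n" "h2 x2 = int n" by linarith
    then show ?thesis
    proof cases
      case 1
      then have "x2 = w2" using B.anc_eqI[OF *(2) B.anc_refl] w2 by simp
      with 1 show ?thesis using g1 g2 by (simp add: e_def)
    next
      case 2
      then have "x1 = w1" using A.anc_eqI[OF *(1) A.anc_refl] w1 by simp
      with 2 show ?thesis using g1 g2 by (simp add: e_def)
    qed
  qed
  have inner: "e x1 x2 = dl_mean e x1 x2 \<and> (\<forall>y\<in>A.children x1. (y, p2 x2) \<in> S) \<and> (\<forall>y\<in>B.children x2. (p1 x1, y) \<in> S)"
    if "(x1, x2) \<in> S" "(x1, x2) \<notin> S'" for x1 x2
  proof -
    have *: "A.anc w1 x1" "B.anc w2 x2" "opp x1 x2" using that by (auto simp: S_def)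
    have h: "\<bar>h1 x1\<bar> < int n" "\<bar>h2 x2\<bar> < int n" using that range[OF that(1)] *(3) by (auto simp: S'_def opp_def)
    have "e x1 x2 = dl_mean f x1 x2 - dl_mean (\<lambda>x _. g1 x) x1 x2 - dl_mean (\<lambda>_ y. g2 y) x1 x2"
      using f(1) *(3) g1(3)[OF h(1)] g2(3)[OF h(2)] harm_at_iff_mean1 harm_at_iff_mean2
      unfolding e_def dl_harm_def by metis
    also have "\<dots> = dl_mean e x1 x2"
      unfolding e_def dl_mean_diff ..
    finally have 1: "e x1 x2 = dl_mean e x1 x2" .
    have "x1 \<noteq> w1" "x2 \<noteq> w2" using h w1 w2 by auto
    then have up: "A.anc w1 (p1 x1)" "B.anc w2 (p2 x2)"
      using A.anc_cases_pr[OF *(1)] B.anc_cases_pr[OF *(2)] by auto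
    have 2: "(y, p2 x2) \<in> S" if "y \<in> A.children x1" for y
      using that up opp_up1[OF *(3)] A.anc_of_pr[of w1 y] *(1) by (simp add: S_def)
    have 3: "(p1 x1, y) \<in> S" if "y \<in> B.children x2" for y
      using that up opp_up2[OF *(3)] B.anc_of_pr[of w2 y] *(2) by (simp add: S_def)
    from 1 2 3 show ?thesis by blast
  qed
  have finS: "finite S" unfolding S_def by (rule finite_tetrahedron)
  have oppS: "opp x1 x2" if "(x1, x2) \<in> S" for x1 x2 using that by (simp add: S_def)
  have "e x1 x2 = 0" if "(x1, x2) \<in> S" for x1 x2
  proof (rule antisym)
    show "e x1 x2 \<le> 0"
      by (rule max_principle[OF finS oppS inner _ that]) (use bd in auto)
    have mean_neg: "dl_mean (\<lambda>x y. - e x y) x1 x2 = - dl_mean e x1 x2" for x1 x2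
      using dl_mean_diff[of "\<lambda>_ _. 0" e x1 x2] by (simp add: dl_mean_def)
    have "- e x1 x2 \<le> 0"
    proof (rule max_principle[OF finS oppS _ _ that])
      show "- e x1 x2 = dl_mean (\<lambda>x y. - e x y) x1 x2 \<and> (\<forall>y\<in>A.children x1. (y, p2 x2) \<in> S) \<and>
          (\<forall>y\<in>B.children x2. (p1 x1, y) \<in> S)" if "(x1, x2) \<in> S" "(x1, x2) \<notin> S'" for x1 x2
        using inner[OF that] by (simp add: mean_neg)
    qed (use bd in auto)
    then show "0 \<le> e x1 x2" by simp
  qed
  then have "0 \<le> g1 x1 \<and> 0 \<le> g2 x2 \<and> f x1 x2 = g1 x1 + g2 x2"
    if "A.anc w1 x1" "B.anc w2 x2" "opp x1 x2" for x1 x2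
    using that g1(4)[of x1 x2] g2(4)[of x2 x1] range[of x1 x2] by (force simp: S_def e_def)
  with g1(3) show ?thesis by blast
qed

text \<open>At every vertex the first summands eventually lie between 0 and a value of f.
  Countability of the tree then gives a pointwise convergent subsequence.\<close>

theorem decomposition:
  assumes f: "dl_harm f" "\<And>x1 x2. opp x1 x2 \<Longrightarrow> 0 \<le> f x1 x2"
  shows "\<exists>g1 g2. (\<forall>x. A.harm_at g1 x) \<and> (\<forall>x. 0 \<le> g1 x) \<and> (\<forall>x. B.harm_at g2 x) \<and> (\<forall>x. 0 \<le> g2 x) \<and>
     (\<forall>x1 x2. opp x1 x2 \<longrightarrow> f x1 x2 = g1 x1 + g2 x2)"
proof -
  let ?w1 = "\<lambda>n. (p1 ^^ Suc n) o1" and ?w2 = "\<lambda>n. (p2 ^^ Suc n) o2"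
  have "\<exists>g1 g2. (\<forall>x. \<bar>h1 x\<bar> < int (Suc n) \<longrightarrow> A.harm_at g1 x) \<and>
     (\<forall>x1 x2. A.anc (?w1 n) x1 \<longrightarrow> B.anc (?w2 n) x2 \<longrightarrow> opp x1 x2 \<longrightarrow>
       0 \<le> g1 x1 \<and> 0 \<le> g2 x2 \<and> f x1 x2 = g1 x1 + g2 x2)" for n
    by (rule tetrahedron_decomposition[OF f]) (unfold A.hgt_pow B.hgt_pow, simp_all)
  then obtain G1 G2 where G: "\<And>n x. \<bar>h1 x\<bar> < int (Suc n) \<Longrightarrow> A.harm_at (G1 n) x"
    "\<And>n x1 x2. A.anc (?w1 n) x1 \<Longrightarrow> B.anc (?w2 n) x2 \<Longrightarrow> opp x1 x2 \<Longrightarrow>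
       0 \<le> G1 n x1 \<and> 0 \<le> G2 n x2 \<and> f x1 x2 = G1 n x1 + G2 n x2"
    by metis
  have ev1: "\<forall>\<^sub>F n in sequentially. A.anc (?w1 n) x" for x
    using A.anc_pow_rt[of x] by (rule eventually_sequentially_Suc[THEN iffD2])
  have ev2: "\<forall>\<^sub>F n in sequentially. B.anc (?w2 n) x" for x
    using B.anc_pow_rt[of x] by (rule eventually_sequentially_Suc[THEN iffD2])
  have evG: "\<forall>\<^sub>F n in sequentially. 0 \<le> G1 n x1 \<and> 0 \<le> G2 n x2 \<and> f x1 x2 = G1 n x1 + G2 n x2"
    if "opp x1 x2" for x1 x2
    using ev1[of x1] ev2[of x2] by eventually_elim (rule G(2)[OF _ _ that])
  have evH: "\<forall>\<^sub>F n in sequentially. A.harm_at (G1 n) x" for x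
    using eventually_ge_at_top[of "nat \<bar>h1 x\<bar>"] by eventually_elim (rule G(1), linarith)
  obtain c where c: "\<And>x. opp x (c x)" using ex_opp1 by metis
  \<comment> \<open>The bound on \<open>G1 n x\<close> depends on x and holds only for large n.
    Rescaling and truncating give the uniform bound required for extracting a subsequence; the
    truncation is eventually inactive.\<close>
  define F where "F n x = min 1 (max 0 (G1 n x / (f x (c x) + 1)))" for n x
  have "\<bar>F n x\<bar> \<le> 1" for n x by (simp add: F_def)
  then have "norm (F n x) \<le> 1" for n x by simp
  then obtain k where k: "strict_mono (k :: nat \<Rightarrow> nat)" "\<And>x. x \<in> UNIV \<Longrightarrow> \<exists>l. (\<lambda>n. F (k n) x) \<longlonglongrightarrow> l"
    using function_convergent_subsequence[OF A.countable_UNIV_vertices, of F 1] by blast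
  have sub: "filterlim k sequentially sequentially" using k(1) by (rule filterlim_subseq)
  have "\<exists>l. (\<lambda>n. G1 (k n) x) \<longlonglongrightarrow> l" for x
  proof -
    have pos: "0 < f x (c x) + 1" using f(2)[OF c[of x]] by simp
    obtain l where l: "(\<lambda>n. F (k n) x) \<longlonglongrightarrow> l" using k(2)[of x] by auto
    have "\<forall>\<^sub>F n in sequentially. (f x (c x) + 1) * F n x = G1 n x"
      using evG[OF c[of x]]
    proof eventually_elim
      case (elim n)
      then have "0 \<le> G1 n x / (f x (c x) + 1)" "G1 n x / (f x (c x) + 1) \<le> 1" using pos by (simp_all add: divide_le_eq)
      then show ?case using pos by (simp add: F_def)
    qed
    then have "\<forall>\<^sub>F n in sequentially. (f x (c x) + 1) * F (k n) x = G1 (k n) x"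
      using sub by (rule eventually_compose_filterlim)
    moreover have "(\<lambda>n. (f x (c x) + 1) * F (k n) x) \<longlonglongrightarrow> (f x (c x) + 1) * l"
      by (intro tendsto_intros l)
    ultimately have "(\<lambda>n. G1 (k n) x) \<longlonglongrightarrow> (f x (c x) + 1) * l"
      by (rule Lim_transform_eventually[rotated])
    then show ?thesis by (rule exI)
  qed
  then obtain g1 where g1: "\<And>x. (\<lambda>n. G1 (k n) x) \<longlonglongrightarrow> g1 x" by metis
  have evG': "\<forall>\<^sub>F n in sequentially. 0 \<le> G1 (k n) x1 \<and> 0 \<le> G2 (k n) x2 \<and> f x1 x2 = G1 (k n) x1 + G2 (k n) x2"
    if "opp x1 x2" for x1 x2
    using evG[OF that] sub by (rule eventually_compose_filterlim)
  \<comment> \<open>The second summands converge as differences. Their limit does not involve x1, so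
    any opposite vertex may be used to define g2.\<close>
  have lim2: "(\<lambda>n. G2 (k n) x2) \<longlonglongrightarrow> f x1 x2 - g1 x1" if "opp x1 x2" for x1 x2
  proof -
    have "(\<lambda>n. f x1 x2 - G1 (k n) x1) \<longlonglongrightarrow> f x1 x2 - g1 x1" by (intro tendsto_intros g1)
    moreover have "\<forall>\<^sub>F n in sequentially. f x1 x2 - G1 (k n) x1 = G2 (k n) x2"
      using evG'[OF that] by eventually_elim simp
    ultimately show ?thesis by (rule Lim_transform_eventually)
  qed
  obtain c' where c': "\<And>x. opp (c' x) x" using ex_opp2 by metis
  define g2 where "g2 x2 = f (c' x2) x2 - g1 (c' x2)" for x2
  have lim2': "(\<lambda>n. G2 (k n) x) \<longlonglongrightarrow> g2 x" for x unfolding g2_def by (rule lim2[OF c'])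
  have dec: "f x1 x2 = g1 x1 + g2 x2" if "opp x1 x2" for x1 x2
    using LIMSEQ_unique[OF lim2[OF that] lim2'] by simp
  have n1: "0 \<le> g1 x" for x
  proof (rule tendsto_lowerbound[OF g1])
    show "\<forall>\<^sub>F n in sequentially. 0 \<le> G1 (k n) x" using evG'[OF c[of x]] by eventually_elim simp
  qed simp
  have n2: "0 \<le> g2 x" for x
  proof (rule tendsto_lowerbound[OF lim2'])
    show "\<forall>\<^sub>F n in sequentially. 0 \<le> G2 (k n) x" using evG'[OF c'[of x]] by eventually_elim simp
  qed simp
  have H1: "A.harm_at g1 x" for x
  proof -
    have "(\<lambda>n. a / real q * (\<Sum>y\<in>A.children x. G1 (k n) y) + (1 - a) * G1 (k n) (p1 x)) \<longlonglongrightarrow>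
        a / real q * (\<Sum>y\<in>A.children x. g1 y) + (1 - a) * g1 (p1 x)"
      by (intro tendsto_intros g1)
    moreover have "\<forall>\<^sub>F n in sequentially. a / real q * (\<Sum>y\<in>A.children x. G1 (k n) y) + (1 - a) * G1 (k n) (p1 x) = G1 (k n) x"
      using eventually_compose_filterlim[OF evH[of x] sub] by eventually_elim (simp add: A.harm_at_def)
    ultimately have "(\<lambda>n. G1 (k n) x) \<longlonglongrightarrow> a / real q * (\<Sum>y\<in>A.children x. g1 y) + (1 - a) * g1 (p1 x)"
      by (rule Lim_transform_eventually)
    then show ?thesis unfolding A.harm_at_def using g1[of x] by (rule LIMSEQ_unique[rotated])
  qed
  \<comment> \<open>Harmonicity passes to g2 as the difference of f and a harmonic function of the
    first coordinate.\<close>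
  have "dl_harm (\<lambda>_ x2. g2 x2)"
    unfolding dl_harm_def
  proof (intro allI impI)
    fix x1 x2 assume o: "opp x1 x2"
    have "g2 x2 = dl_mean f x1 x2 - dl_mean (\<lambda>x _. g1 x) x1 x2"
      using f(1) o dec[OF o] H1[of x1] harm_at_iff_mean1[of g1 x1 x2] unfolding dl_harm_def by simp
    also have "\<dots> = dl_mean (\<lambda>x1 x2. f x1 x2 - g1 x1) x1 x2" by (simp add: dl_mean_diff)
    also have "\<dots> = dl_mean (\<lambda>_ x2. g2 x2) x1 x2" by (rule dl_mean_cong[OF o]) (simp add: dec)
    finally show "g2 x2 = dl_mean (\<lambda>_ x2. g2 x2) x1 x2" .
  qed
  then have "B.harm_at g2 x" for x using dl_harm_lift2 by blast
  with H1 n1 n2 dec show ?thesis by blast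
qed

section \<open>Transforming functions and minimality on the graph\<close>

lemma drift_product: "min 1 ((1 - a) / a) * (min 1 ((1 - b) / b) * A.\<rho>) = 1"
proof (cases "a \<le> b")
  case True
  then have le: "1 \<le> b / a" "a / b \<le> 1" using ab_pos by simp_all
  then have "max (b / a) (a / b) = b / a" by simp
  with le show ?thesis unfolding A.\<rho>_def ab_eq using ab_pos by (simp add: min_absorb1 min_absorb2)
next
  case False
  then have le: "b / a \<le> 1" "1 \<le> a / b" using ab_pos by simp_all
  then have "max (b / a) (a / b) = a / b" by simp
  with le show ?thesis unfolding A.\<rho>_def ab_eq using ab_pos by (simp add: min_absorb1 min_absorb2)
qed

text \<open>Opposite heights invert the base, so on the second tree \<open>A.\<psi>\<close> is the
  harmonic power of the height that \<open>B.\<psi>\<close> did not choose; \<rho> is the quotient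
  of the two bases.\<close>

lemma \<psi>_opp: "opp x1 x2 \<Longrightarrow> A.\<psi> x1 = B.\<psi> x2 * A.\<rho> powi h2 x2"
proof -
  assume "opp x1 x2"
  then have h: "h1 x1 = - h2 x2" by (simp add: opp_def)
  let ?F = "min 1 ((1 - a) / a)" and ?G = "min 1 ((1 - b) / b)"
  have "?G * A.\<rho> = inverse ?F" using drift_product by (metis inverse_unique)
  then have "(?G * A.\<rho>) powi h2 x2 = ?F powi (- h2 x2)" by (simp only: power_int_inverse power_int_minus)
  then show ?thesis unfolding A.\<psi>_def B.\<psi>_def h power_int_mult_distrib by simp
qed

text \<open>At a zero of f the minorant vanishes as well, so the condition on quotients yields a
  genuine proportionality.\<close>

lemma dl_minimalD:
  assumes "dl_minimal f" "dl_harm g" "\<And>x1 x2. opp x1 x2 \<Longrightarrow> 0 \<le> g x1 x2"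
    "\<And>x1 x2. opp x1 x2 \<Longrightarrow> g x1 x2 \<le> f x1 x2"
  shows "\<exists>c. \<forall>x1 x2. opp x1 x2 \<longrightarrow> g x1 x2 = c * f x1 x2"
proof -
  obtain c where c: "\<And>x1 x2. opp x1 x2 \<Longrightarrow> g x1 x2 / f x1 x2 = c"
    using assms unfolding dl_minimal_def by blast
  have "g x1 x2 = c * f x1 x2" if "opp x1 x2" for x1 x2
    using c[OF that] assms(3,4)[OF that] by (cases "f x1 x2 = 0") (auto simp: divide_eq_eq)
  then show ?thesis by blast
qed

lemma tree_minimal_lift1:
  assumes "dl_minimal (\<lambda>x _. f x)"
  shows "A.tree_minimal f"
  unfolding A.tree_minimal_def
proof (intro conjI allI impI)
  show "A.harm_at f x" for x using assms dl_harm_lift1 unfolding dl_minimal_def by blast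
  show "0 \<le> f x" for x using assms ex_opp1[of x] unfolding dl_minimal_def by blast
  show "f o1 = 1" using assms unfolding dl_minimal_def by blast
  fix g assume g: "(\<forall>x. A.harm_at g x) \<and> (\<forall>x. 0 \<le> g x) \<and> (\<forall>x. g x \<le> f x)"
  then have "\<exists>c. \<forall>x1 x2. opp x1 x2 \<longrightarrow> g x1 = c * f x1"
    using dl_minimalD[OF assms, of "\<lambda>x _. g x"] dl_harm_lift1[of g] by simp
  then show "\<exists>c. \<forall>x. g x = c * f x" using ex_opp1 by metis
qed

lemma tree_minimal_lift2:
  assumes "dl_minimal (\<lambda>_ y. f y)"
  shows "B.tree_minimal f"
proof -
  interpret S: DL_walks r q p2 p1 h2 h1 o2 o1 b a by (rule swapped)
  show ?thesis using S.tree_minimal_lift1[of f] dl_minimal_swap[of "\<lambda>_ y. f y"] assms by simp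
qed

text \<open>By the decomposition only sums of one-coordinate functions need to be tested against f;
  positivity turns the resulting product back into a quotient.\<close>

lemma minimalI:
  assumes "dl_harm f" "\<And>x1 x2. opp x1 x2 \<Longrightarrow> 0 < f x1 x2" "f o1 o2 = 1"
    and "\<And>g1 g2. (\<And>x. A.harm_at g1 x) \<Longrightarrow> (\<And>x. 0 \<le> g1 x) \<Longrightarrow> (\<And>x. B.harm_at g2 x) \<Longrightarrow> (\<And>x. 0 \<le> g2 x) \<Longrightarrow>
      (\<And>x1 x2. opp x1 x2 \<Longrightarrow> g1 x1 + g2 x2 \<le> f x1 x2) \<Longrightarrow> \<exists>c. \<forall>x1 x2. opp x1 x2 \<longrightarrow> g1 x1 + g2 x2 = c * f x1 x2"
  shows "dl_minimal f"
  unfolding dl_minimal_def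
proof (intro conjI allI impI)
  show "0 \<le> f x1 x2" if "opp x1 x2" for x1 x2 using assms(2)[OF that] by simp
  fix g assume g: "dl_harm g \<and> (\<forall>x1 x2. opp x1 x2 \<longrightarrow> 0 \<le> g x1 x2) \<and> (\<forall>x1 x2. opp x1 x2 \<longrightarrow> g x1 x2 \<le> f x1 x2)"
  then obtain g1 g2 where d: "\<And>x. A.harm_at g1 x" "\<And>x. 0 \<le> g1 x" "\<And>x. B.harm_at g2 x" "\<And>x. 0 \<le> g2 x"
    "\<And>x1 x2. opp x1 x2 \<Longrightarrow> g x1 x2 = g1 x1 + g2 x2"
    using decomposition[of g] by blast
  have "\<exists>c. \<forall>x1 x2. opp x1 x2 \<longrightarrow> g1 x1 + g2 x2 = c * f x1 x2"
    by (rule assms(4)[OF d(1-4)]) (use g d(5) in force)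
  then obtain c where "\<And>x1 x2. opp x1 x2 \<Longrightarrow> g x1 x2 = c * f x1 x2" using d(5) by metis
  then have "opp x1 x2 \<Longrightarrow> g x1 x2 / f x1 x2 = c" for x1 x2
    using assms(2)[of x1 x2] by (simp add: divide_eq_eq)
  then show "\<exists>c. \<forall>x1 x2. opp x1 x2 \<longrightarrow> g x1 x2 / f x1 x2 = c" by blast
qed (use assms in auto)

theorem martin_line_dl_minimal1:
  assumes C: "A.line C"
  shows "dl_minimal (\<lambda>x _. A.martin_line C x)"
proof (rule minimalI)
  show "dl_harm (\<lambda>x _. A.martin_line C x)"
    using A.harm_at_martin_line[OF C] dl_harm_lift1 by blast
  fix g1 g2
  assume g: "\<And>x. A.harm_at g1 x" "\<And>x. 0 \<le> g1 x" "\<And>x. B.harm_at g2 x" "\<And>x. 0 \<le> g2 x"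
    "\<And>x1 x2. opp x1 x2 \<Longrightarrow> g1 x1 + g2 x2 \<le> A.martin_line C x1"
  have g2: "g2 x2 = 0" for x2
  proof (rule ccontr)
    assume "g2 x2 \<noteq> 0"
    then have "0 < g2 x2" using g(4)[of x2] by simp
    \<comment> \<open>Fixing the height makes x1 opposite to x2, so the small kernel value
      contradicts the domination of g2 at that point.\<close>
    then obtain x1 where x1: "h1 x1 = - h2 x2" "A.martin_line C x1 < g2 x2"
      using A.martin_line_small[OF A.line_chain[OF C]] by blast
    then have "opp x1 x2" by (simp add: opp_def)
    then show False using g(5) g(2)[of x1] x1(2) by fastforce
  qed
  have "g1 x \<le> A.martin_line C x" for x
    using ex_opp1[of x] g(5)[of x] g2 by auto
  then obtain c where "\<And>x. g1 x = c * A.martin_line C x"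
    using A.martin_line_minimal[OF C g(1,2)] by blast
  then show "\<exists>c. \<forall>x1 x2. opp x1 x2 \<longrightarrow> g1 x1 + g2 x2 = c * A.martin_line C x1" using g2 by auto
qed (auto intro: A.martin_line_pos)

theorem martin_line_dl_minimal2:
  assumes C: "B.line C"
  shows "dl_minimal (\<lambda>_ y. B.martin_line C y)"
proof -
  interpret S: DL_walks r q p2 p1 h2 h1 o2 o1 b a by (rule swapped)
  show ?thesis using S.martin_line_dl_minimal1[OF C] dl_minimal_swap[of "\<lambda>_ y. B.martin_line C y"] by simp
qed

text \<open>Both summands of a minorant are bounded harmonic functions of a driftless tree walk,
  hence constant.\<close>

theorem one_dl_minimal:
  assumes "a = 1 / 2"
  shows "dl_minimal (\<lambda>_ _. 1)"
proof (rule minimalI)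
  have b: "b = 1 / 2" using assms a_plus_b by simp
  show "dl_harm (\<lambda>_ _. 1)"
    using dl_harm_lift1[of "\<lambda>_. 1"] A.card_children q_pos by (simp add: A.harm_at_def)
  fix g1 g2
  assume g: "\<And>x. A.harm_at g1 x" "\<And>x. 0 \<le> g1 x" "\<And>x. B.harm_at g2 x" "\<And>x. 0 \<le> g2 x"
    "\<And>x1 x2. opp x1 x2 \<Longrightarrow> g1 x1 + g2 x2 \<le> 1"
  have "g1 x \<le> 1" for x using ex_opp1[of x] g(5)[of x] g(4) by (meson add_increasing2 order_trans order_refl)
  then have 1: "g1 x = g1 o1" for x using A.harm_const_of_bounded[OF assms g(1,2)] by blast
  have "g2 x \<le> 1" for x using ex_opp2[of x] g(5)[of _ x] g(2) by (meson add_increasing order_trans order_refl)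
  then have 2: "g2 x = g2 o2" for x using B.harm_const_of_bounded[OF b g(3,4)] by blast
  show "\<exists>c. \<forall>x1 x2. opp x1 x2 \<longrightarrow> g1 x1 + g2 x2 = c * 1"
    by (rule exI[of _ "g1 o1 + g2 o2"]) (metis 1 2 mult.right_neutral)
qed auto

text \<open>
  Off the symmetric case, \<open>A.\<psi>\<close> reads off the second tree as a harmonic function whose increments are
  all positive, hence it is not carried by a single line.
\<close>

lemma \<psi>_not_dl_minimal1:
  assumes "a \<noteq> 1 / 2"
  shows "\<not> dl_minimal (\<lambda>x _. A.\<psi> x)"
proof
  assume "dl_minimal (\<lambda>x _. A.\<psi> x)"
  then have "dl_minimal (\<lambda>_ y. B.\<psi> y * A.\<rho> powi h2 y)"
    using dl_minimal_cong[of "\<lambda>x _. A.\<psi> x" "\<lambda>_ y. B.\<psi> y * A.\<rho> powi h2 y"] \<psi>_opp by blast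
  then have "B.tree_minimal (\<lambda>y. B.\<psi> y * A.\<rho> powi h2 y)" by (rule tree_minimal_lift2)
  moreover have "\<not> B.tree_minimal (\<lambda>y. B.\<psi> y * A.\<rho> powi h2 y)"
  proof (rule B.not_tree_minimal_growing)
    fix x
    have "a \<noteq> b" using assms a_plus_b by auto
    then have \<rho>: "1 < A.\<rho>"
      unfolding A.\<rho>_def ab_eq using ab_pos by (cases "a < b") (auto simp: less_max_iff_disj)
    then have "A.\<rho> powi (h2 x - 1) < A.\<rho> powi h2 x" by (intro power_int_strict_increasing) auto
    then show "0 < B.incr (\<lambda>y. (B.\<psi> y * A.\<rho> powi h2 y) / B.\<psi> y) x"
      by (simp add: B.incr_def)
  qed
  ultimately show False by contradiction
qed

lemma \<psi>_not_dl_minimal2: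
  assumes "a \<noteq> 1 / 2"
  shows "\<not> dl_minimal (\<lambda>_ y. B.\<psi> y)"
proof -
  interpret S: DL_walks r q p2 p1 h2 h1 o2 o1 b a by (rule swapped)
  have "b \<noteq> 1 / 2" using assms a_plus_b by auto
  then show ?thesis using S.\<psi>_not_dl_minimal1 dl_minimal_swap[of "\<lambda>_ y. B.\<psi> y"] by simp
qed

text \<open>Each summand of the decomposition lies below f and is therefore a multiple of f. The
  multipliers add up to 1, so one of them is nonzero and f depends on that coordinate alone.\<close>

theorem dl_minimal_cases:
  assumes f: "dl_minimal f"
  shows "(\<exists>C. A.line C \<and> (\<forall>x1 x2. opp x1 x2 \<longrightarrow> f x1 x2 = A.martin_line C x1)) \<or>
    (\<exists>C. B.line C \<and> (\<forall>x1 x2. opp x1 x2 \<longrightarrow> f x1 x2 = B.martin_line C x2)) \<or>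
    (a = 1 / 2 \<and> (\<forall>x1 x2. opp x1 x2 \<longrightarrow> f x1 x2 = 1))"
proof -
  have fh: "dl_harm f" "\<And>x1 x2. opp x1 x2 \<Longrightarrow> 0 \<le> f x1 x2" "f o1 o2 = 1"
    using f unfolding dl_minimal_def by blast+
  obtain g1 g2 where d: "\<And>x. A.harm_at g1 x" "\<And>x. 0 \<le> g1 x" "\<And>x. B.harm_at g2 x" "\<And>x. 0 \<le> g2 x"
    "\<And>x1 x2. opp x1 x2 \<Longrightarrow> f x1 x2 = g1 x1 + g2 x2"
    using decomposition[OF fh(1,2)] by blast
  have "dl_harm (\<lambda>x _. g1 x)" "dl_harm (\<lambda>_ y. g2 y)" using d dl_harm_lift1 dl_harm_lift2 by blast+
  moreover have "g1 x1 \<le> f x1 x2" "g2 x2 \<le> f x1 x2" if "opp x1 x2" for x1 x2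
    using d(5)[OF that] d(2)[of x1] d(4)[of x2] by auto
  ultimately have "\<exists>c1. \<forall>x1 x2. opp x1 x2 \<longrightarrow> g1 x1 = c1 * f x1 x2" "\<exists>c2. \<forall>x1 x2. opp x1 x2 \<longrightarrow> g2 x2 = c2 * f x1 x2"
    using d(2,4) by (intro dl_minimalD[OF f, of "\<lambda>x _. g1 x"] dl_minimalD[OF f, of "\<lambda>_ y. g2 y"]; simp)+
  then obtain c1 c2 where c: "\<And>x1 x2. opp x1 x2 \<Longrightarrow> g1 x1 = c1 * f x1 x2" "\<And>x1 x2. opp x1 x2 \<Longrightarrow> g2 x2 = c2 * f x1 x2"
    by blast
  have "g1 o1 = c1" "g2 o2 = c2" using c[OF opp_origin] fh(3) by simp_all
  then have "c1 + c2 = 1" using d(5)[OF opp_origin] fh(3) by simp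
  then consider "c1 \<noteq> 0" | "c2 \<noteq> 0" by fastforce
  then show ?thesis
  proof cases
    case 1
    then have eq: "f x1 x2 = g1 x1 / c1" if "opp x1 x2" for x1 x2 using c(1)[OF that] by simp
    then have min: "dl_minimal (\<lambda>x _. g1 x / c1)" using f dl_minimal_cong[of f "\<lambda>x _. g1 x / c1"] by blast
    then have "A.tree_minimal (\<lambda>x. g1 x / c1)" by (rule tree_minimal_lift1)
    then consider "(\<lambda>x. g1 x / c1) = A.\<psi>" | C where "A.line C" "(\<lambda>x. g1 x / c1) = A.martin_line C"
      using A.tree_minimal_cases by blast
    then show ?thesis
    proof cases
      case 1
      have "dl_minimal (\<lambda>x _. A.\<psi> x)" using min unfolding fun_cong[OF 1] .
      then have half: "a = 1 / 2" using \<psi>_not_dl_minimal1 by blast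
      have "f x1 x2 = 1" if "opp x1 x2" for x1 x2
        using eq[OF that, unfolded fun_cong[OF 1] A.\<psi>_def] by (simp add: half)
      with half show ?thesis by blast
    next
      case 2
      have "f x1 x2 = A.martin_line C x1" if "opp x1 x2" for x1 x2
        using eq[OF that] unfolding fun_cong[OF 2(2)] .
      with 2(1) show ?thesis by blast
    qed
  next
    case 2
    then have eq: "f x1 x2 = g2 x2 / c2" if "opp x1 x2" for x1 x2 using c(2)[OF that] by simp
    then have min: "dl_minimal (\<lambda>_ y. g2 y / c2)" using f dl_minimal_cong[of f "\<lambda>_ y. g2 y / c2"] by blast
    then have "B.tree_minimal (\<lambda>y. g2 y / c2)" by (rule tree_minimal_lift2)
    then consider "(\<lambda>y. g2 y / c2) = B.\<psi>" | C where "B.line C" "(\<lambda>y. g2 y / c2) = B.martin_line C"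
      using B.tree_minimal_cases by blast
    then show ?thesis
    proof cases
      case 1
      have "dl_minimal (\<lambda>_ y. B.\<psi> y)" using min unfolding fun_cong[OF 1] .
      then have half: "a = 1 / 2" using \<psi>_not_dl_minimal2 by blast
      then have b_half: "b = 1 / 2" using a_plus_b by simp
      have "f x1 x2 = 1" if "opp x1 x2" for x1 x2
        using eq[OF that, unfolded fun_cong[OF 1] B.\<psi>_def] by (simp add: b_half)
      with half show ?thesis by blast
    next
      case 2
      have "f x1 x2 = B.martin_line C x2" if "opp x1 x2" for x1 x2
        using eq[OF that] unfolding fun_cong[OF 2(2)] .
      with 2(1) show ?thesis by blast
    qed
  qed
qed

end

section \<open>Transfer to ends and Martin kernels\<close>

locale two_trees =
  T1: tree_with_end_walk T1 q a + T2: tree_with_end_walk T2 r b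
  for T1 :: "'a rooted_tree" and T2 :: "'b rooted_tree" and q r :: nat and a b :: real +
  assumes a_plus_b: "a + b = 1"
begin

sublocale D: DL_walks q r T1.up T2.up T1.ht T2.ht "origin T1" "origin T2" a b
  using a_plus_b by unfold_locales

lemma DL_verts_eq: "DL_verts T1 T2 = {(x1, x2). D.opp x1 x2}"
  by (simp add: DL_verts_def D.opp_def T1.busemann_eq T2.busemann_eq)

lemma DL_walk_eq:
  "DL_walk q r a T1 T2 (x1, x2) (y1, y2) =
     (if T1.up y1 = x1 \<and> y2 = T2.up x2 then a / real q
      else if y1 = T1.up x1 \<and> T2.up y2 = x2 then b / real r else 0)"
  by (simp only: DL_walk_def prod.case T1.predecessor_eq T2.predecessor_eq D.ab_eq)

text \<open>The transition probabilities vanish outside two disjoint finite families of neighbours,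
  so the infinite sum reduces to the explicit mean.\<close>

lemma has_sum_DL_walk:
  assumes x: "D.opp x1 x2"
  shows "((\<lambda>y. DL_walk q r a T1 T2 (x1, x2) y * h y) has_sum s) (DL_verts T1 T2) \<longleftrightarrow>
    s = D.dl_mean (\<lambda>x y. h (x, y)) x1 x2"
proof -
  let ?f = "\<lambda>y. DL_walk q r a T1 T2 (x1, x2) y * h y"
  let ?N1 = "(\<lambda>y. (y, T2.up x2)) ` T1.P.children x1" and ?N2 = "(\<lambda>y. (T1.up x1, y)) ` T2.P.children x2"
  have N: "?N1 \<union> ?N2 \<subseteq> DL_verts T1 T2"
    using D.opp_up1[OF x] D.opp_up2[OF x] by (auto simp: DL_verts_eq)
  have disj: "?N1 \<inter> ?N2 = {}"
    using T1.W.pr_pr_neq T1.W.pr_pr_neq[THEN not_sym] by auto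
  have "(?f has_sum s) (DL_verts T1 T2) \<longleftrightarrow> (?f has_sum s) (?N1 \<union> ?N2)"
  proof (rule has_sum_cong_neutral)
    fix y assume "y \<in> DL_verts T1 T2 - (?N1 \<union> ?N2)"
    then show "?f y = 0" by (cases y) (auto simp: DL_walk_eq)
  qed (use N in auto)
  also have "\<dots> \<longleftrightarrow> s = sum ?f (?N1 \<union> ?N2)" by (subst has_sum_finite_iff) auto
  also have "sum ?f (?N1 \<union> ?N2) = sum ?f ?N1 + sum ?f ?N2" using disj by (intro sum.union_disjoint) auto
  also have "sum ?f ?N1 = (\<Sum>y\<in>T1.P.children x1. ?f (y, T2.up x2))"
    by (subst sum.reindex) (auto intro: inj_onI)
  also have "\<dots> = (\<Sum>y\<in>T1.P.children x1. a / real q * h (y, T2.up x2))"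
    by (intro sum.cong) (auto simp: DL_walk_eq)
  also have "sum ?f ?N2 = (\<Sum>y\<in>T2.P.children x2. ?f (T1.up x1, y))"
    by (subst sum.reindex) (auto intro: inj_onI)
  also have "\<dots> = (\<Sum>y\<in>T2.P.children x2. b / real r * h (T1.up x1, y))"
    using T1.W.pr_pr_neq T1.W.pr_pr_neq[THEN not_sym] by (intro sum.cong) (auto simp: DL_walk_eq)
  finally show ?thesis by (simp only: D.dl_mean_def sum_distrib_left)
qed

lemma harmonic_on_iff: "harmonic_on (DL_verts T1 T2) (DL_walk q r a T1 T2) h \<longleftrightarrow> D.dl_harm (\<lambda>x y. h (x, y))"
  unfolding harmonic_on_def D.dl_harm_def using has_sum_DL_walk by (auto simp: DL_verts_eq)

lemma DL_minimal_iff: "DL_minimal q r a T1 T2 h \<longleftrightarrow> D.dl_minimal (\<lambda>x y. h (x, y))"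
proof -
  have V: "(\<forall>x\<in>DL_verts T1 T2. Q x) \<longleftrightarrow> (\<forall>x1 x2. D.opp x1 x2 \<longrightarrow> Q (x1, x2))" for Q
    by (auto simp: DL_verts_eq)
  have all: "(\<forall>g. Q (\<lambda>x y. g (x, y))) \<longleftrightarrow> (\<forall>g. Q g)" for Q :: "('a \<Rightarrow> 'b \<Rightarrow> real) \<Rightarrow> bool"
  proof (intro iffI allI)
    fix g assume "\<forall>g. Q (\<lambda>x y. g (x, y))"
    from this[rule_format, of "\<lambda>(x, y). g x y"] show "Q g" by simp
  qed blast
  show ?thesis
    unfolding DL_minimal_def minimal_harmonic_on_def D.dl_minimal_def harmonic_on_iff V
    by (subst all[symmetric]) (rule refl)
qed

lemma proj_walk_eqs: "proj_walk1 q a T1 = T1.W.walk" "proj_walk2 r a T2 = T2.W.walk"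
  using T1.proj_walk1_eq T2.proj_walk2_eq by (simp_all add: D.ab_eq)

theorem martin_kernels_minimal:
  "\<xi> \<in> ends_star T1 \<Longrightarrow> DL_minimal q r a T1 T2 (\<lambda>(x1, x2). martin_kernel T1 (proj_walk1 q a T1) x1 \<xi>)"
  "\<xi>' \<in> ends_star T2 \<Longrightarrow> DL_minimal q r a T1 T2 (\<lambda>(x1, x2). martin_kernel T2 (proj_walk2 r a T2) x2 \<xi>')"
proof -
  assume "\<xi> \<in> ends_star T1"
  then obtain C where "T1.P.line C" "\<And>x. martin_kernel T1 T1.W.walk x \<xi> = T1.W.martin_line C x"
    using T1.martin_kernel_end by blast
  then show "DL_minimal q r a T1 T2 (\<lambda>(x1, x2). martin_kernel T1 (proj_walk1 q a T1) x1 \<xi>)"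
    using D.martin_line_dl_minimal1 by (simp add: DL_minimal_iff proj_walk_eqs)
next
  assume "\<xi>' \<in> ends_star T2"
  then obtain C where "T2.P.line C" "\<And>x. martin_kernel T2 T2.W.walk x \<xi>' = T2.W.martin_line C x"
    using T2.martin_kernel_end by blast
  then show "DL_minimal q r a T1 T2 (\<lambda>(x1, x2). martin_kernel T2 (proj_walk2 r a T2) x2 \<xi>')"
    using D.martin_line_dl_minimal2 by (simp add: DL_minimal_iff proj_walk_eqs)
qed

theorem DL_minimal_cases:
  assumes "DL_minimal q r a T1 T2 h"
  shows "(\<exists>\<xi>\<in>ends_star T1. \<forall>(x1, x2)\<in>DL_verts T1 T2. h (x1, x2) = martin_kernel T1 (proj_walk1 q a T1) x1 \<xi>) \<or>
    (\<exists>\<xi>\<in>ends_star T2. \<forall>(x1, x2)\<in>DL_verts T1 T2. h (x1, x2) = martin_kernel T2 (proj_walk2 r a T2) x2 \<xi>) \<or>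
    a = 1 / 2 \<and> (\<forall>z\<in>DL_verts T1 T2. h z = 1)"
proof -
  from D.dl_minimal_cases[OF assms[unfolded DL_minimal_iff]] consider
    C where "T1.P.line C" "\<And>x1 x2. D.opp x1 x2 \<Longrightarrow> h (x1, x2) = T1.W.martin_line C x1"
    | C where "T2.P.line C" "\<And>x1 x2. D.opp x1 x2 \<Longrightarrow> h (x1, x2) = T2.W.martin_line C x2"
    | "a = 1 / 2" "\<And>x1 x2. D.opp x1 x2 \<Longrightarrow> h (x1, x2) = 1"
    by blast
  then show ?thesis
  proof cases
    case 1
    obtain \<xi> where "\<xi> \<in> ends_star T1" "\<And>x. martin_kernel T1 T1.W.walk x \<xi> = T1.W.martin_line C x"
      using T1.martin_kernel_line[OF 1(1)] by blast
    with 1(2) show ?thesis by (intro disjI1 bexI[of _ \<xi>]) (auto simp: DL_verts_eq proj_walk_eqs)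
  next
    case 2
    obtain \<xi> where "\<xi> \<in> ends_star T2" "\<And>x. martin_kernel T2 T2.W.walk x \<xi> = T2.W.martin_line C x"
      using T2.martin_kernel_line[OF 2(1)] by blast
    with 2(2) show ?thesis by (intro disjI2 disjI1 bexI[of _ \<xi>]) (auto simp: DL_verts_eq proj_walk_eqs)
  next
    case 3
    then show ?thesis by (intro disjI2 conjI) (auto simp: DL_verts_eq)
  qed
qed

end

theorem theorem4p4:
  fixes q r :: nat and \<alpha> :: real
    and T1 :: "'a rooted_tree" and T2 :: "'b rooted_tree"
  assumes "2 \<le> q" "2 \<le> r" "0 < \<alpha>" "\<alpha> < 1"
    and "homogeneous_tree q (adj T1)" "ref_end T1 \<in> ends T1"
    and "homogeneous_tree r (adj T2)" "ref_end T2 \<in> ends T2"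
  shows
    "((\<forall>\<xi>\<in>ends_star T1.
          DL_minimal q r \<alpha> T1 T2 (\<lambda>(x1, x2). martin_kernel T1 (proj_walk1 q \<alpha> T1) x1 \<xi>)) \<and>
      (\<forall>\<xi>\<in>ends_star T2.
          DL_minimal q r \<alpha> T1 T2 (\<lambda>(x1, x2). martin_kernel T2 (proj_walk2 r \<alpha> T2) x2 \<xi>))) \<and>
     (\<alpha> \<noteq> 1 / 2 \<longrightarrow>
        (\<forall>h. DL_minimal q r \<alpha> T1 T2 h \<longrightarrow>
          (\<exists>\<xi>\<in>ends_star T1. \<forall>(x1, x2)\<in>DL_verts T1 T2.
             h (x1, x2) = martin_kernel T1 (proj_walk1 q \<alpha> T1) x1 \<xi>) \<or>
          (\<exists>\<xi>\<in>ends_star T2. \<forall>(x1, x2)\<in>DL_verts T1 T2.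
             h (x1, x2) = martin_kernel T2 (proj_walk2 r \<alpha> T2) x2 \<xi>))) \<and>
     (\<alpha> = 1 / 2 \<longrightarrow>
        DL_minimal q r \<alpha> T1 T2 (\<lambda>_. 1) \<and>
        (\<forall>h. DL_minimal q r \<alpha> T1 T2 h \<longrightarrow>
          (\<exists>\<xi>\<in>ends_star T1. \<forall>(x1, x2)\<in>DL_verts T1 T2.
             h (x1, x2) = martin_kernel T1 (proj_walk1 q \<alpha> T1) x1 \<xi>) \<or>
          (\<exists>\<xi>\<in>ends_star T2. \<forall>(x1, x2)\<in>DL_verts T1 T2.
             h (x1, x2) = martin_kernel T2 (proj_walk2 r \<alpha> T2) x2 \<xi>) \<or>
          (\<forall>z\<in>DL_verts T1 T2. h z = 1)))"
proof -
  interpret two_trees T1 T2 q r \<alpha> "1 - \<alpha>"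
    by unfold_locales (use assms in auto)
  have one: "DL_minimal q r \<alpha> T1 T2 (\<lambda>_. 1)" if "\<alpha> = 1 / 2"
    using D.one_dl_minimal[OF that] by (simp add: DL_minimal_iff)
  show ?thesis
    using martin_kernels_minimal one DL_minimal_cases by blast
qed

end
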